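(* Let $n \geq 2$ and let $f$ be a real analytic function defined on an open neighborhood of the origin $0 \in \mathbb{R}^n$. Suppose that $\operatorname{codim}_{0}(Z_f) \geq 2$, where $Z_f=\{x: f(x)=0\}$. Then there exists an open neighborhood $U$ of $0$ such that $\log|f| \in W^{1,1}(U)$; that is, $\log|f| \in L^1(U)$ and its distributional gradient on $U$ belongs to $L^1(U)$ (and coincides a.e. with the pointwise gradient $\nabla f/f$ computed off $Z_f$).
   Context: For a real analytic subset $X$ of an open set in $\mathbb{R}^n$, a point $p \in X$ is a smooth point of dimension $d$ if there is an open neighborhood $W$ of $p$ such that $W\cap X$ is a real analytic submanifold of $W$ of dimension $d$. The dimension of $X$ at $p$, $\dim_p X$, is the largest $d$ such that $p$ lies in the closure of the set of smooth points of $X$ of dimension $d$, and $\operatorname{codim}_p X := n - \dim_p X$. If $0 \notin Z_f$ the hypothesis is considered satisfied (and the conclusion is trivial). The hypothesis $\operatorname{codim}_0(Z_f)\ge 2$ in particular excludes $f \equiv 0$, so $Z_f$ has Lebesgue measure zero near $0$ and $\log|f|$ is defined a.e. *)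

theory Defs
  imports "HOL-Analysis.Analysis"
begin

definition real_analytic_on :: "(real^'n \<Rightarrow> real) \<Rightarrow> (real^'n) set \<Rightarrow> bool" where
  "real_analytic_on f S \<longleftrightarrow>
     (\<forall>p\<in>S. \<exists>r>0. \<exists>c :: ('n \<Rightarrow> nat) \<Rightarrow> real.
        \<forall>x\<in>ball p r.
          ((\<lambda>\<alpha>. c \<alpha> * (\<Prod>i\<in>UNIV. (x$i - p$i) ^ \<alpha> i)) has_sum f x) UNIV)"

definition analytic_submanifold :: "(real^'n) set \<Rightarrow> (real^'n) set \<Rightarrow> nat \<Rightarrow> bool" where
  "analytic_submanifold M W d \<longleftrightarrow>
     d \<le> CARD('n) \<and> M \<subseteq> W \<and>
     (\<forall>q\<in>M. \<exists>V. open V \<and> q \<in> V \<and> V \<subseteq> W \<and>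
        (\<exists>g :: nat \<Rightarrow> real^'n \<Rightarrow> real.
           (\<forall>j < CARD('n) - d. real_analytic_on (g j) V) \<and>
           (\<forall>x\<in>V. \<exists>D :: nat \<Rightarrow> real^'n.
               (\<forall>j < CARD('n) - d. (g j has_derivative (\<lambda>h. D j \<bullet> h)) (at x)) \<and>
               (\<forall>a :: nat \<Rightarrow> real. (\<Sum>j < CARD('n) - d. a j *\<^sub>R D j) = 0
                   \<longrightarrow> (\<forall>j < CARD('n) - d. a j = 0))) \<and>
           M \<inter> V = {x\<in>V. \<forall>j < CARD('n) - d. g j x = 0}))"

definition smooth_point :: "(real^'n) set \<Rightarrow> real^'n \<Rightarrow> nat \<Rightarrow> bool" where
  "smooth_point X p d \<longleftrightarrow> p \<in> X \<and>
     (\<exists>W. open W \<and> p \<in> W \<and> analytic_submanifold (W \<inter> X) W d)"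

text \<open>dim_p X = the largest d such that p lies in the closure of the smooth points of
  dimension d (the set of such d is contained in {0..n}; its Sup is 0 if it is empty,
  which only happens for p outside the closure of X).\<close>
definition analytic_dim_at :: "(real^'n) set \<Rightarrow> real^'n \<Rightarrow> nat" where
  "analytic_dim_at X p = Sup {d. p \<in> closure {q. smooth_point X q d}}"

definition analytic_codim_at :: "(real^'n) set \<Rightarrow> real^'n \<Rightarrow> nat" where
  "analytic_codim_at X p = CARD('n) - analytic_dim_at X p"

definition partial_deriv :: "'n \<Rightarrow> (real^'n \<Rightarrow> real) \<Rightarrow> real^'n \<Rightarrow> real" where
  "partial_deriv i g x = deriv (\<lambda>t. g (x + t *\<^sub>R axis i 1)) 0"

fun iter_partial :: "'n list \<Rightarrow> (real^'n \<Rightarrow> real) \<Rightarrow> real^'n \<Rightarrow> real" where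
  "iter_partial [] g = g"
| "iter_partial (i # is) g = partial_deriv i (iter_partial is g)"

definition smooth_fun :: "(real^'n \<Rightarrow> real) \<Rightarrow> bool" where
  "smooth_fun \<phi> \<longleftrightarrow>
     (\<forall>is. continuous_on UNIV (iter_partial is \<phi>) \<and>
        (\<forall>i x. (\<lambda>t. iter_partial is \<phi> (x + t *\<^sub>R axis i 1)) differentiable (at 0)))"

definition test_fun :: "(real^'n) set \<Rightarrow> (real^'n \<Rightarrow> real) \<Rightarrow> bool" where
  "test_fun U \<phi> \<longleftrightarrow> smooth_fun \<phi> \<and> compact (closure {x. \<phi> x \<noteq> 0}) \<and> closure {x. \<phi> x \<noteq> 0} \<subseteq> U"

definition weak_gradient_on :: "(real^'n) set \<Rightarrow> (real^'n \<Rightarrow> real) \<Rightarrow> (real^'n \<Rightarrow> real^'n) \<Rightarrow> bool" where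
  "weak_gradient_on U u G \<longleftrightarrow>
     (\<forall>\<phi> i. test_fun U \<phi> \<longrightarrow>
        (LINT x:U|lebesgue. u x * partial_deriv i \<phi> x) = - (LINT x:U|lebesgue. G x $ i * \<phi> x))"

definition L1_on :: "(real^'n) set \<Rightarrow> (real^'n \<Rightarrow> real) \<Rightarrow> bool" where
  "L1_on U u \<longleftrightarrow> set_integrable lebesgue U u"

end

theory Submission
  imports Defs "HOL-Complex_Analysis.Conformal_Mappings"
begin

text \<open>
  Fix a direction \<open>v\<close> with \<open>f v \<noteq> 0\<close> and expand \<open>f\<close> in a power series, so that
  \<open>t \<mapsto> f (x + t v)\<close> becomes a holomorphic function on a fixed disc whose zeros
  \<open>\<xi>\<close> number at most \<open>N\<close>, uniformly in \<open>x\<close> near \<open>0\<close>.  Let \<open>k\<close> be the largest number of distinct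
  zeros over real \<open>x\<close>.  The sum over all \<open>k\<close>-tuples of zeros of the product of their differences is a polynomial
  in the power sums of the zeros, hence an analytic function \<open>D\<close> of \<open>x\<close>; it is nonzero exactly
  where there are \<open>k\<close> distinct zeros, and there it is bounded by a constant times the distance of any two of them.
  If \<open>D x \<noteq> 0\<close>, a real zero on the line through \<open>x\<close> would lie on a smooth hypersurface contained in the
  zero set, which the codimension hypothesis forbids.  So all zeros are non-real, come in conjugate pairs, and
  satisfy \<open>\<bar>Im \<xi>\<bar> \<ge> const * \<bar>D x\<bar>\<close>.  Hence the integral of \<open>\<bar>\<partial>\<^sub>v f / f\<bar>\<close> over the line is
  \<open>O(1 + \<bar>ln \<bar>D x\<bar>\<bar>)\<close>, and the logarithm of a nonzero analytic function is locally integrable.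
  On almost every line \<open>f\<close> has no zero, so one may integrate by parts there; the coordinate derivatives are
  combinations of derivatives in admissible directions.

  Fubini is used in the form \<open>2a \<integral> g(x) dx = \<integral> \<integral>\<^sub>-\<^sub>a\<^sup>a g(x + t v) dt dx\<close>, with the base point \<open>x\<close> ranging over
  the whole space; this avoids adapted coordinates and any induction on the dimension.
\<close>

section \<open>Factorization of holomorphic functions on a disc\<close>


text \<open>The usual discriminant vanishes identically as soon as \<open>f\<close> has a repeated
  factor. Weighting the tuples of zeros by multiplicities cures this: when at most \<open>k\<close>
  distinct zeros are present, only tuples enumerating all of them survive, and since the product
  runs over ordered pairs they all contribute the same number. Its coefficient is a sum of products
  of multiplicities, a bounded nonnegative integer, so nothing can cancel. No square-free part and
  no Weierstrass polynomial is formed. Multiplicity is also the obstacle in the hypersurface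
  argument: the gradient of \<open>f\<close> may vanish on the zero set, so a derivative of
  \<open>f\<close> of suitable order serves as the equation. \<open>D\<close> depends on the base
  point and not on the line alone, because the window in which zeros are counted moves with it;
  averaging over all base points, instead of slicing by a hyperplane, makes this harmless. The
  coordinate axes may be inadmissible, as \<open>f\<close> may vanish on them; hence the differences
  of nearby admissible directions.\<close>

lemma holomorphic_factor_finite_zeros:
  assumes hol: "h holomorphic_on S" and S: "open S" "connected S"
    and fin: "finite Z" and Z: "\<And>\<xi>. \<xi> \<in> Z \<Longrightarrow> \<xi> \<in> S \<and> h \<xi> = 0"
    and t0: "t0 \<in> S" "h t0 \<noteq> 0"
  shows "\<exists>u n. u holomorphic_on S \<and> (\<forall>t\<in>S. h t = u t * (\<Prod>\<xi>\<in>Z. (t - \<xi>) ^ n \<xi>)) \<and>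
           (\<forall>\<xi>\<in>Z. u \<xi> \<noteq> 0 \<and> n \<xi> \<ge> (1::nat))"
  using fin Z
proof (induction Z rule: finite_induct)
  case empty
  then show ?case using hol by (intro exI[of _ h]) auto
next
  case (insert \<xi> Z)
  have "\<exists>u n. u holomorphic_on S \<and> (\<forall>t\<in>S. h t = u t * (\<Prod>\<xi>\<in>Z. (t - \<xi>) ^ n \<xi>)) \<and>
           (\<forall>\<xi>\<in>Z. u \<xi> \<noteq> 0 \<and> n \<xi> \<ge> (1::nat))"
    by (rule insert.IH) (use insert.prems in blast)
  then obtain u n where u: "u holomorphic_on S"
    and hu': "\<forall>t\<in>S. h t = u t * (\<Prod>\<xi>\<in>Z. (t - \<xi>) ^ n \<xi>)"
    and nz': "\<forall>\<xi>\<in>Z. u \<xi> \<noteq> 0 \<and> n \<xi> \<ge> (1::nat)" by (elim exE conjE)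
  note hu = hu'[rule_format] and nz = nz'[rule_format]
  have \<xi>: "\<xi> \<in> S" "h \<xi> = 0" using insert.prems by auto
  \<comment> \<open>The old factors do not vanish at the new point, so the quotient \<open>u\<close>
    must; \<open>u t0 \<noteq> 0\<close> keeps \<open>u\<close> non-constant, hence its order of
    vanishing is finite.\<close>
  have "(\<Prod>\<xi>'\<in>Z. (\<xi> - \<xi>') ^ n \<xi>') \<noteq> 0" using insert.hyps by auto
  then have u\<xi>: "u \<xi> = 0" using hu[OF \<xi>(1)] \<xi>(2) by simp
  have "u t0 \<noteq> 0" using hu[OF t0(1)] t0 by auto
  then have nc: "\<not> u constant_on S" using u\<xi> \<xi>(1) t0(1) by (metis constant_on_def)
  obtain g r m where m: "0 < m" and r: "0 < r" "ball \<xi> r \<subseteq> S" and g: "g holomorphic_on ball \<xi> r"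
    and ug: "\<And>w. w \<in> ball \<xi> r \<Longrightarrow> u w = (w - \<xi>) ^ m * g w"
    and gn: "\<And>w. w \<in> ball \<xi> r \<Longrightarrow> g w \<noteq> 0"
    by (rule holomorphic_factor_zero_nonconstant[OF u S \<xi>(1) u\<xi> nc]) (rule that; assumption)
  define u' where "u' = (\<lambda>w. if w = \<xi> then g \<xi> else u w / (w - \<xi>) ^ m)"
  have "u' holomorphic_on (S - {\<xi>})"
    by (rule holomorphic_transform[where f = "\<lambda>w. u w / (w - \<xi>) ^ m"])
       (auto simp: u'_def intro!: holomorphic_intros holomorphic_on_subset[OF u])
  moreover have "u' holomorphic_on ball \<xi> r"
    by (rule holomorphic_transform[OF g]) (auto simp: u'_def ug)
  ultimately have "u' holomorphic_on ((S - {\<xi>}) \<union> ball \<xi> r)"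
    using S by (intro holomorphic_on_Un) auto
  moreover have "(S - {\<xi>}) \<union> ball \<xi> r = S" using r by auto
  ultimately have u': "u' holomorphic_on S" by simp
  have uu: "u t = u' t * (t - \<xi>) ^ m" if "t \<in> S" for t
    using u\<xi> m by (auto simp: u'_def)
  define n' where "n' = n(\<xi> := m)"
  have pr: "(\<Prod>\<xi>'\<in>Z. (t - \<xi>') ^ n' \<xi>') = (\<Prod>\<xi>'\<in>Z. (t - \<xi>') ^ n \<xi>')" for t
    using insert.hyps by (intro prod.cong) (auto simp: n'_def)
  have "h t = u' t * (\<Prod>\<xi>'\<in>insert \<xi> Z. (t - \<xi>') ^ n' \<xi>')" if "t \<in> S" for t
    unfolding hu[OF that] uu[OF that] using insert.hyps by (simp add: pr) (simp add: n'_def)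
  moreover have "u' \<xi>' \<noteq> 0 \<and> n' \<xi>' \<ge> 1" if "\<xi>' \<in> insert \<xi> Z" for \<xi>'
    using that nz[of \<xi>'] gn[of \<xi>] m r insert.hyps by (auto simp: u'_def n'_def)
  ultimately show ?case using u' by blast
qed

text \<open>
  The factors are normalised to have modulus at most \<open>1\<close> on the circle of radius \<open>\<rho>\<close> and at least \<open>3/2\<close> on the one of
  radius \<open>4\<rho>\<close>: the maximum principle then bounds both \<open>u\<close> and the number of zeros.
\<close>

lemma bounded_factorization:
  fixes h :: "complex \<Rightarrow> complex"
  assumes \<rho>: "\<rho> > 0" and hol: "h holomorphic_on ball 0 (5 * \<rho>)"
    and M: "\<And>t. norm t \<le> 4 * \<rho> \<Longrightarrow> norm (h t) \<le> M"
    and c: "c > 0" "\<And>t. norm t = \<rho> \<Longrightarrow> c \<le> norm (h t)"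
  obtains Z n u where "finite Z" "Z = {t \<in> ball 0 \<rho>. h t = 0}" "u holomorphic_on ball 0 (5 * \<rho>)"
    "\<And>t. t \<in> ball 0 (5 * \<rho>) \<Longrightarrow> h t = u t * (\<Prod>\<xi>\<in>Z. ((t - \<xi>) / (2 * \<rho>)) ^ n \<xi>)"
    "\<And>\<xi>. \<xi> \<in> Z \<Longrightarrow> n \<xi> \<ge> (1::nat)"
    "\<And>t. norm t \<le> \<rho> \<Longrightarrow> c \<le> norm (u t)" "\<And>t. norm t \<le> 4 * \<rho> \<Longrightarrow> norm (u t) \<le> M"
    "real (\<Sum>\<xi>\<in>Z. n \<xi>) \<le> ln (M / c) / ln (3/2)"
proof -
  let ?S = "ball (0::complex) (5 * \<rho>)"
  define t0 :: complex where "t0 = of_real \<rho>"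
  have t0: "norm t0 = \<rho>" using \<rho> by (simp add: t0_def)
  have t0S: "t0 \<in> ?S" "h t0 \<noteq> 0" using t0 \<rho> c(1) c(2)[of t0] by auto
  define Z where "Z = {t \<in> ball 0 \<rho>. h t = 0}"
  have finZ: "finite Z"
  proof (cases "Z = {}")
    case False
    then obtain z where "z \<in> Z" by auto
    then have "\<not> h constant_on ?S" using t0S \<rho> unfolding constant_on_def Z_def by fastforce
    then have "finite {z\<in>cball 0 \<rho>. h z = 0}" using hol \<rho>
      by (intro holomorphic_compact_finite_zeros[where S="?S"]) auto
    then show ?thesis by (rule finite_subset[rotated]) (auto simp: Z_def)
  qed auto
  have ZS: "\<xi> \<in> Z \<Longrightarrow> \<xi> \<in> ?S \<and> h \<xi> = 0" for \<xi> using \<rho> by (auto simp: Z_def)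
  have "\<exists>u n. u holomorphic_on ?S \<and> (\<forall>t\<in>?S. h t = u t * (\<Prod>\<xi>\<in>Z. (t - \<xi>) ^ n \<xi>)) \<and>
           (\<forall>\<xi>\<in>Z. u \<xi> \<noteq> 0 \<and> n \<xi> \<ge> (1::nat))"
    by (rule holomorphic_factor_finite_zeros[OF hol open_ball connected_ball finZ ZS t0S])
  then obtain u0 n where u0: "u0 holomorphic_on ?S"
    and hu0': "\<forall>t\<in>?S. h t = u0 t * (\<Prod>\<xi>\<in>Z. (t - \<xi>) ^ n \<xi>)"
    and nz': "\<forall>\<xi>\<in>Z. u0 \<xi> \<noteq> 0 \<and> n \<xi> \<ge> (1::nat)"
    by (elim exE conjE)
  note hu0 = hu0'[rule_format] and nz = nz'[rule_format]
  define N where "N = (\<Sum>\<xi>\<in>Z. n \<xi>)"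
  define u where "u = (\<lambda>t. u0 t * of_real ((2 * \<rho>) ^ N))"
  have u: "u holomorphic_on ?S" unfolding u_def by (intro holomorphic_intros u0)
  have pr: "(\<Prod>\<xi>\<in>Z. ((t - \<xi>) / (2 * \<rho>)) ^ n \<xi>) = (\<Prod>\<xi>\<in>Z. (t - \<xi>) ^ n \<xi>) / of_real ((2 * \<rho>) ^ N)" for t
    by (simp add: power_divide prod_dividef N_def power_sum)
  have hu: "h t = u t * (\<Prod>\<xi>\<in>Z. ((t - \<xi>) / (2 * \<rho>)) ^ n \<xi>)" if "t \<in> ?S" for t
    unfolding pr hu0[OF that] u_def using \<rho> by simp
  \<comment> \<open>Division to full order removes the zeros in \<open>Z\<close>, and
    \<open>c\<close> excludes zeros of \<open>h\<close> on the circle; so the maximum principle may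
    be applied to \<open>inverse u\<close> on the closed disc.\<close>
  have u_nz: "u t \<noteq> 0" if "norm t \<le> \<rho>" for t
  proof (cases "h t = 0")
    case True
    then have "norm t \<noteq> \<rho>" using c(2)[of t] c(1) by auto
    then have "t \<in> Z" using True that by (auto simp: Z_def)
    then show ?thesis using nz[of t] \<rho> by (auto simp: u_def)
  next
    case False
    then show ?thesis using hu[of t] that \<rho> by auto
  qed
  have sph: "c \<le> norm (u t)" if "norm t = \<rho>" for t
  proof -
    have tS: "t \<in> ?S" using that \<rho> by auto
    have "norm (\<Prod>\<xi>\<in>Z. ((t - \<xi>) / (2 * \<rho>)) ^ n \<xi>) \<le> 1"
      unfolding prod_norm[symmetric] norm_power
    proof (intro prod_le_1 conjI power_le_one)
      fix \<xi> assume "\<xi> \<in> Z"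
      then have "norm (t - \<xi>) \<le> 2 * \<rho>" using norm_triangle_ineq4[of t \<xi>] that by (auto simp: Z_def)
      then show "norm ((t - \<xi>) / (2 * \<rho>)) \<le> 1" using \<rho> by (simp add: norm_divide)
    qed auto
    then have "norm (h t) \<le> norm (u t) * 1"
      unfolding hu[of t, OF tS] norm_mult by (intro mult_left_mono) auto
    then show ?thesis using c(2)[OF that] by simp
  qed
  have lower: "c \<le> norm (u t)" if "norm t \<le> \<rho>" for t
  proof -
    have "norm (inverse (u t)) \<le> inverse c"
    proof (rule maximum_modulus_frontier[of "\<lambda>t. inverse (u t)" "cball 0 \<rho>"])
      show "(\<lambda>t. inverse (u t)) holomorphic_on interior (cball 0 \<rho>)"
        using u_nz \<rho> by (intro holomorphic_intros holomorphic_on_subset[OF u]) auto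
      show "continuous_on (closure (cball 0 \<rho>)) (\<lambda>t. inverse (u t))"
        using u_nz \<rho> by (intro continuous_intros holomorphic_on_imp_continuous_on
           holomorphic_on_subset[OF u]) auto
      show "cmod (inverse (u z)) \<le> inverse c" if "z \<in> frontier (cball 0 \<rho>)" for z
        using sph[of z] c(1) that \<rho> by (auto simp: norm_inverse intro!: le_imp_inverse_le)
    qed (use that in auto)
    then show ?thesis using c(1) u_nz[OF that] by (auto simp: norm_inverse inverse_le_iff_le)
  qed
  have upper: "norm (u t) \<le> M / (3/2) ^ N" if "norm t \<le> 4 * \<rho>" for t
  proof (rule maximum_modulus_frontier[of u "cball 0 (4 * \<rho>)"])
    show "u holomorphic_on interior (cball 0 (4 * \<rho>))"
      using \<rho> by (intro holomorphic_on_subset[OF u]) auto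
    show "continuous_on (closure (cball 0 (4 * \<rho>))) u"
      using \<rho> by (intro holomorphic_on_imp_continuous_on holomorphic_on_subset[OF u]) auto
    show "cmod (u z) \<le> M / (3 / 2) ^ N" if "z \<in> frontier (cball 0 (4 * \<rho>))" for z
    proof -
      have z: "norm z = 4 * \<rho>" using that \<rho> by auto
      have "(3/2) ^ N = (\<Prod>\<xi>\<in>Z. (3/2::real) ^ n \<xi>)" by (simp add: N_def power_sum)
      also have "\<dots> \<le> (\<Prod>\<xi>\<in>Z. norm (((z - \<xi>) / (2 * \<rho>)) ^ n \<xi>))"
        unfolding norm_power
      proof (intro prod_mono conjI power_mono)
        fix \<xi> assume "\<xi> \<in> Z"
        then have "norm (z - \<xi>) \<ge> 3 * \<rho>" using norm_triangle_ineq2[of z \<xi>] z by (auto simp: Z_def)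
        then show "3/2 \<le> norm ((z - \<xi>) / (2 * \<rho>))" using \<rho> by (simp add: norm_divide field_simps)
      qed auto
      finally have "norm (u z) * (3/2) ^ N \<le> norm (u z) * (\<Prod>\<xi>\<in>Z. norm (((z - \<xi>) / (2 * \<rho>)) ^ n \<xi>))"
        by (intro mult_left_mono) auto
      also have "\<dots> = norm (h z)" using hu[of z] z \<rho> by (simp add: norm_mult prod_norm)
      also have "\<dots> \<le> M" using M z by auto
      finally show ?thesis by (simp add: field_simps)
    qed
  qed (use that in auto)
  \<comment> \<open>A Jensen-type count: each zero costs a factor \<open>3/2\<close> in the upper
    bound, so comparing both bounds at the single point \<open>t0\<close> limits their
    number.\<close>
  have "c \<le> M / (3/2) ^ N" using lower[of t0] upper[of t0] t0 \<rho> by simp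
  then have "(3/2) ^ N \<le> M / c" using c(1) by (simp add: field_simps)
  moreover have "0 < (3/2::real) ^ N" by simp
  ultimately have "ln ((3/2) ^ N) \<le> ln (M / c)" by (subst ln_le_cancel_iff) linarith+
  then have "real N * ln (3/2) \<le> ln (M / c)" unfolding ln_realpow .
  then have N: "real N \<le> ln (M / c) / ln (3/2)" by (simp add: field_simps)
  have "0 \<le> M" using M[of 0] \<rho> by (smt (verit) norm_ge_zero norm_zero)
  then have upper': "norm (u t) \<le> M" if "norm t \<le> 4 * \<rho>" for t
    using upper[OF that] by (smt (verit, best) divide_le_eq_1_pos frac_le one_le_power div_by_1)
  show ?thesis
    by (rule that[OF finZ Z_def u hu _ lower upper' N[unfolded N_def]]) (use nz in auto)
qed

section \<open>Logarithmic derivatives and power sums of zeros\<close>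

lemma has_field_derivative_prod_powers:
  fixes \<rho> :: complex
  assumes "finite Z" "t \<notin> Z" "\<rho> \<noteq> 0"
  shows "((\<lambda>t. \<Prod>\<xi>\<in>Z. ((t - \<xi>) / \<rho>) ^ n \<xi>) has_field_derivative
           (\<Prod>\<xi>\<in>Z. ((t - \<xi>) / \<rho>) ^ n \<xi>) * (\<Sum>\<xi>\<in>Z. of_nat (n \<xi>) / (t - \<xi>))) (at t)"
  using assms
proof (induction Z rule: finite_induct)
  case (insert \<xi> Z)
  have "((\<lambda>t. ((t - \<xi>) / \<rho>) ^ n \<xi>) has_field_derivative
          of_nat (n \<xi>) * (1 / \<rho> * ((t - \<xi>) / \<rho>) ^ (n \<xi> - Suc 0))) (at t)"
    by (rule DERIV_power) (use insert.prems in \<open>auto intro!: derivative_eq_intros\<close>)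
  moreover have "of_nat (n \<xi>) * (1 / \<rho> * ((t - \<xi>) / \<rho>) ^ (n \<xi> - Suc 0)) =
          ((t - \<xi>) / \<rho>) ^ n \<xi> * (of_nat (n \<xi>) / (t - \<xi>))"
    using insert.prems insert.hyps by (cases "n \<xi>") auto
  ultimately have "((\<lambda>t. ((t - \<xi>) / \<rho>) ^ n \<xi>) has_field_derivative
          ((t - \<xi>) / \<rho>) ^ n \<xi> * (of_nat (n \<xi>) / (t - \<xi>))) (at t)" by simp
  from DERIV_mult[OF this insert.IH] insert show ?case
    by (simp add: algebra_simps)
qed auto

lemma log_derivative_factorization:
  assumes S: "open S" "t \<in> S" and u: "u holomorphic_on S" "u t \<noteq> 0"
    and h: "\<And>t. t \<in> S \<Longrightarrow> h t = u t * (\<Prod>\<xi>\<in>Z. ((t - \<xi>) / \<rho>) ^ n \<xi>)"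
    and Z: "finite Z" "t \<notin> Z" "\<rho> \<noteq> (0::complex)"
  shows "deriv h t / h t = deriv u t / u t + (\<Sum>\<xi>\<in>Z. of_nat (n \<xi>) / (t - \<xi>))"
proof -
  let ?P = "\<lambda>t. \<Prod>\<xi>\<in>Z. ((t - \<xi>) / \<rho>) ^ n \<xi>"
  have "((\<lambda>t. u t * ?P t) has_field_derivative
     deriv u t * ?P t + ?P t * (\<Sum>\<xi>\<in>Z. of_nat (n \<xi>) / (t - \<xi>)) * u t) (at t)"
    by (intro DERIV_mult has_field_derivative_prod_powers Z holomorphic_derivI[OF u(1) S])
  then have "(h has_field_derivative
     deriv u t * ?P t + ?P t * (\<Sum>\<xi>\<in>Z. of_nat (n \<xi>) / (t - \<xi>)) * u t) (at t)"
    by (rule has_field_derivative_transform_within_open[OF _ S]) (simp add: h)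
  then have "deriv h t = deriv u t * ?P t + ?P t * (\<Sum>\<xi>\<in>Z. of_nat (n \<xi>) / (t - \<xi>)) * u t"
    by (rule DERIV_imp_deriv)
  moreover have "?P t \<noteq> 0" using Z by auto
  ultimately show ?thesis using u(2) h[OF S(2)] by (simp add: field_simps)
qed

text \<open>The factorization replaces residues by two standard facts: \<open>deriv u / u\<close> is
  holomorphic near the closed disc and integrates to 0, and each zero contributes by Cauchy's
  integral formula.\<close>

lemma power_sum_contour_integral:
  assumes \<rho>: "\<rho> > 0" "\<rho> < R" and u: "u holomorphic_on ball 0 R" "\<And>t. norm t \<le> \<rho> \<Longrightarrow> u t \<noteq> 0"
    and h: "\<And>t. t \<in> ball 0 R \<Longrightarrow> h t = u t * (\<Prod>\<xi>\<in>Z. ((t - \<xi>) / a) ^ n \<xi>)"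
    and Z: "finite Z" "Z \<subseteq> ball 0 \<rho>" "a \<noteq> (0::complex)"
  shows "((\<lambda>t. t ^ j * (deriv h t / h t)) has_contour_integral
           (2 * of_real pi * \<i> * (\<Sum>\<xi>\<in>Z. of_nat (n \<xi>) * \<xi> ^ j))) (circlepath 0 \<rho>)"
proof -
  \<comment> \<open>Cauchy's theorem is applied on an open disc containing the circle, so the
    zero-free region must extend beyond it; compactness of the closed disc gives the margin
    \<open>e\<close>.\<close>
  obtain \<rho>' where \<rho>': "\<rho> < \<rho>'" "\<rho>' \<le> R" "\<And>t. norm t < \<rho>' \<Longrightarrow> u t \<noteq> 0"
  proof -
    have "open {t \<in> ball 0 R. u t \<in> - {0}}"
      using u by (intro continuous_openin_preimage_gen[THEN openin_open_trans, unfolded vimage_def Int_def, simplified])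
        (auto intro: holomorphic_on_imp_continuous_on)
    moreover have "cball 0 \<rho> \<subseteq> {t \<in> ball 0 R. u t \<in> - {0}}" using u(2) \<rho> by auto
    ultimately obtain e where e: "e > 0" "(\<Union>x\<in>cball 0 \<rho>. ball x e) \<subseteq> {t \<in> ball 0 R. u t \<in> - {0}}"
      using compact_subset_open_imp_ball_epsilon_subset[of "cball (0::complex) \<rho>"] by auto
    show ?thesis
    proof (rule that[of "min R (\<rho> + e)"])
      fix t :: complex assume t: "norm t < min R (\<rho> + e)"
      have "\<exists>x\<in>cball 0 \<rho>. t \<in> ball x e"
      proof (cases "norm t \<le> \<rho>")
        case False
        define x where "x = of_real (\<rho> / norm t) * t"
        have "t \<noteq> 0" using False \<rho> by auto
        then have "norm x = \<rho>" using False \<rho> by (simp add: x_def norm_mult norm_divide)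
        moreover have "x - t = of_real (\<rho> / norm t - 1) * t" by (simp add: x_def algebra_simps)
        then have "norm (x - t) = \<bar>\<rho> / norm t - 1\<bar> * norm t" by (simp only: norm_mult norm_of_real)
        then have "norm (x - t) = norm t - \<rho>" using False \<rho> \<open>t \<noteq> 0\<close>
          by (simp add: abs_if diff_divide_eq_iff)
        ultimately show ?thesis using t by (intro bexI[of _ x]) (auto simp: dist_norm)
      qed (use e in \<open>auto intro!: bexI[of _ t]\<close>)
      then have "t \<in> {t \<in> ball 0 R. u t \<in> - {0}}" using e(2) by blast
      then show "u t \<noteq> 0" by simp
    qed (use \<rho> e in auto)
  qed
  have 1: "((\<lambda>t. t ^ j * (deriv u t / u t)) has_contour_integral 0) (circlepath 0 \<rho>)"
    by (rule Cauchy_theorem_disc_simple[of _ 0 \<rho>'])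
       (use \<rho> \<rho>' in \<open>auto intro!: holomorphic_intros holomorphic_on_subset[OF holomorphic_deriv[OF u(1)]] holomorphic_on_subset[OF u(1)]\<close>)
  have 2: "((\<lambda>t. of_nat (n \<xi>) * (t ^ j / (t - \<xi>))) has_contour_integral
             of_nat (n \<xi>) * (2 * of_real pi * \<i> * \<xi> ^ j)) (circlepath 0 \<rho>)" if "\<xi> \<in> Z" for \<xi>
    using that Z by (intro has_contour_integral_lmul Cauchy_integral_circlepath_simple)
      (auto intro!: holomorphic_intros)
  have 3: "((\<lambda>t. t ^ j * (deriv u t / u t) + (\<Sum>\<xi>\<in>Z. of_nat (n \<xi>) * (t ^ j / (t - \<xi>)))) has_contour_integral
     (0 + (\<Sum>\<xi>\<in>Z. of_nat (n \<xi>) * (2 * of_real pi * \<i> * \<xi> ^ j)))) (circlepath 0 \<rho>)"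
    by (intro has_contour_integral_add 1 has_contour_integral_sum 2 Z)
  have "((\<lambda>t. t ^ j * (deriv h t / h t)) has_contour_integral
     (0 + (\<Sum>\<xi>\<in>Z. of_nat (n \<xi>) * (2 * of_real pi * \<i> * \<xi> ^ j)))) (circlepath 0 \<rho>)"
  proof (rule has_contour_integral_eq[OF 3])
    fix t assume "t \<in> path_image (circlepath 0 \<rho>)"
    then have t: "norm t = \<rho>" using \<rho> by auto
    have "deriv h t / h t = deriv u t / u t + (\<Sum>\<xi>\<in>Z. of_nat (n \<xi>) / (t - \<xi>))"
      using t \<rho> Z by (intro log_derivative_factorization[where S="ball 0 R" and \<rho>=a] u h) auto
    then show "t ^ j * (deriv u t / u t) + (\<Sum>\<xi>\<in>Z. of_nat (n \<xi>) * (t ^ j / (t - \<xi>))) = t ^ j * (deriv h t / h t)"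
      by (simp add: sum_distrib_left algebra_simps)
  qed
  then show ?thesis by (simp add: sum_distrib_left mult_ac)
qed

section \<open>Integrals along a line\<close>


text \<open>With \<open>a = Re \<xi>\<close> and \<open>b = \<bar>Im \<xi>\<bar>\<close> a primitive
  is \<open>arsinh ((t - a) / b)\<close>, which grows only logarithmically in \<open>1 / b\<close>.
  This is why the distance of a zero from the real line may be as small as a multiple of an analytic
  function.\<close>

lemma nn_integral_inverse_dist_le:
  fixes \<xi> :: complex
  assumes \<rho>: "0 < \<rho>" "\<rho> \<le> 1/2" and \<xi>: "norm \<xi> \<le> \<rho>" "\<delta> \<le> \<bar>Im \<xi>\<bar>" and \<delta>: "0 < \<delta>" "\<delta> \<le> 1"
  shows "(\<integral>\<^sup>+t. ennreal (1 / norm (of_real t - \<xi>)) * indicator {-\<rho>..\<rho>} t \<partial>lborel) \<le> ennreal (2 * ln (3 / \<delta>))"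
proof -
  define a b where "a = Re \<xi>" and "b = \<bar>Im \<xi>\<bar>"
  have b: "b > 0" "\<delta> \<le> b" using \<xi> \<delta> by (auto simp: b_def)
  have a: "\<bar>a\<bar> \<le> \<rho>" using \<xi>(1) abs_Re_le_cmod[of \<xi>] by (simp add: a_def)
  have "((\<lambda>t. arsinh ((t - a) / b)) has_real_derivative 1 / norm (of_real t - \<xi>)) (at t within {-\<rho>..\<rho>})" for t
  proof -
    have "sqrt (((t - a) / b)\<^sup>2 + 1) * b = sqrt ((((t - a) / b)\<^sup>2 + 1) * b\<^sup>2)"
      using b by (simp add: real_sqrt_mult)
    also have "(((t - a) / b)\<^sup>2 + 1) * b\<^sup>2 = (t - a)\<^sup>2 + (Im \<xi>)\<^sup>2"
      using b by (simp add: field_simps power_divide) (simp add: b_def)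
    also have "sqrt \<dots> = norm (of_real t - \<xi>)" by (simp add: cmod_def a_def)
    finally have eq: "1 / norm (of_real t - \<xi>) = 1 / sqrt (((t - a) / b)\<^sup>2 + 1) * (1 / b)" by simp
    show ?thesis unfolding eq
      by (rule DERIV_chain2[OF arsinh_real_has_field_derivative]) (use b in \<open>auto intro!: derivative_eq_intros\<close>)
  qed
  then have "((\<lambda>t. 1 / norm (of_real t - \<xi>)) has_integral arsinh ((\<rho> - a) / b) - arsinh ((-\<rho> - a) / b)) {-\<rho>..\<rho>}"
    using \<rho> by (intro fundamental_theorem_of_calculus) (auto simp: has_real_derivative_iff_has_vector_derivative)
  then have "(\<integral>\<^sup>+t. ennreal (1 / norm (of_real t - \<xi>)) * indicator {-\<rho>..\<rho>} t \<partial>lborel) =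
     ennreal (arsinh ((\<rho> - a) / b) - arsinh ((-\<rho> - a) / b))"
    by (intro nn_integral_has_integral_lebesgue') auto
  also have "\<dots> \<le> ennreal (2 * ln (3 / \<delta>))"
  proof (intro ennreal_leI)
    have *: "arsinh y \<le> ln (3 / \<delta>)" if "y \<le> 1 / \<delta>" for y :: real
    proof -
      have y: "arsinh y \<le> arsinh (1 / \<delta>)" using that arsinh_real_strict_mono[of y "1 / \<delta>"] by (metis less_eq_real_def)
      \<comment> \<open>As \<open>\<delta> \<le> 1\<close>, the argument of the logarithm in
        \<open>arsinh (1/\<delta>)\<close> is at most
        \<open>2/\<delta> + 1 \<le> 3/\<delta>\<close>: the origin of the 3.\<close>
      have "sqrt ((1/\<delta>)\<^sup>2 + 1) \<le> 1/\<delta> + 1" using \<delta>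
        by (intro real_le_lsqrt) (auto simp: power2_eq_square algebra_simps)
      then have "1/\<delta> + sqrt ((1/\<delta>)\<^sup>2 + 1) \<le> 3 / \<delta>" using \<delta> by (simp add: field_simps)
      moreover have "1/\<delta> + sqrt ((1/\<delta>)\<^sup>2 + 1) > 0" using arsinh_real_aux by blast
      ultimately have "arsinh (1/\<delta>) \<le> ln (3 / \<delta>)" unfolding arsinh_real_def
        by (subst ln_le_cancel_iff) (use \<delta> in auto)
      then show ?thesis using y by simp
    qed
    have q: "x / b \<le> 1 / \<delta>" if "x \<le> 1" for x
    proof (cases "x \<ge> 0")
      case True
      then show ?thesis using that b \<delta> by (intro frac_le) auto
    next
      case False
      then have "x / b \<le> 0" using b by (simp add: divide_nonpos_pos)
      then show ?thesis using \<delta> by (smt (verit) divide_pos_pos)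
    qed
    have "arsinh ((\<rho> - a) / b) \<le> ln (3 / \<delta>)" using a \<rho> by (intro * q) auto
    moreover have "- arsinh ((-\<rho> - a) / b) = arsinh ((\<rho> + a) / b)"
      by (simp flip: arsinh_minus_real add: minus_divide_left add.commute)
    moreover have "arsinh ((\<rho> + a) / b) \<le> ln (3 / \<delta>)" using a \<rho> by (intro * q) auto
    ultimately show "arsinh ((\<rho> - a) / b) - arsinh ((-\<rho> - a) / b) \<le> 2 * ln (3 / \<delta>)" by simp
  qed
  finally show ?thesis .
qed

section \<open>Logarithmic singularities\<close>

text \<open>Infinite at \<open>0\<close>, where \<open>ln 0 = 0\<close>, so that a finite integral also shows that zeros form a null set.\<close>

definition abs_ln :: "real \<Rightarrow> ennreal" where
  "abs_ln y = (if y = 0 then \<infinity> else ennreal \<bar>ln y\<bar>)"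

lemma abs_ln_measurable [measurable]: "abs_ln \<in> borel_measurable borel"
  unfolding abs_ln_def by measurable

lemma abs_ln_mult: "x \<ge> 0 \<Longrightarrow> y \<ge> 0 \<Longrightarrow> abs_ln (x * y) \<le> abs_ln x + abs_ln y"
  by (auto simp: abs_ln_def ln_mult simp flip: ennreal_plus intro!: ennreal_leI)

lemma abs_ln_prod:
  "(\<And>a. a \<in> A \<Longrightarrow> f a \<ge> 0) \<Longrightarrow> abs_ln (\<Prod>a\<in>A. f a) \<le> (\<Sum>a\<in>A. abs_ln (f a))"
proof (induction A rule: infinite_finite_induct)
  case (insert x F)
  have "abs_ln (f x * prod f F) \<le> abs_ln (f x) + abs_ln (prod f F)"
    using insert.prems by (intro abs_ln_mult) (auto intro: prod_nonneg)
  also have "\<dots> \<le> abs_ln (f x) + (\<Sum>a\<in>F. abs_ln (f a))" using insert by (intro add_left_mono) auto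
  finally show ?case using insert by simp
qed (auto simp: abs_ln_def)

lemma abs_ln_power: "x \<ge> 0 \<Longrightarrow> abs_ln (x ^ n) \<le> of_nat n * abs_ln x"
  using abs_ln_prod[of "{..<n}" "\<lambda>_. x"] by simp

text \<open>Replacing \<open>\<xi>\<close> by its real part only brings it closer to the real
  points, so real and non-real zeros alike are dominated by one singularity
  \<open>ln \<bar>s\<bar>\<close>. In contrast to the inverse distance, no lower bound on
  \<open>\<bar>Im \<xi>\<bar>\<close> enters.\<close>

lemma nn_integral_abs_ln_dist_le:
  fixes \<xi> :: complex
  assumes \<rho>: "0 < \<rho>" and \<xi>: "norm \<xi> \<le> \<rho>"
  shows "(\<integral>\<^sup>+t. abs_ln (norm ((of_real t - \<xi>) / (2 * \<rho>))) * indicator {-\<rho>..\<rho>} t \<partial>lborel) \<le> ennreal (16 * \<rho>)"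
proof -
  define a where "a = Re \<xi>"
  have a: "\<bar>a\<bar> \<le> \<rho>" using \<xi>(1) abs_Re_le_cmod[of \<xi>] by (simp add: a_def)
  \<comment> \<open>The majorant comes from
    \<open>- ln s = 2 * ln (s powr (-1/2)) \<le> 2 * s powr (-1/2)\<close>. It has integral 8 over
    \<open>{-1..1}\<close>, and rescaling by \<open>2 * \<rho>\<close> yields the stated
    \<open>16 * \<rho>\<close>.\<close>
  define g where "g = (\<lambda>s. ennreal (2 * \<bar>s\<bar> powr (-1/2)) * indicator {-1..1} s)"
  have [measurable]: "g \<in> borel_measurable borel" unfolding g_def by measurable
  have hi: "((\<lambda>s. 2 * s powr (-1/2)) has_integral 4) {0..1::real}"
    using has_integral_mult_right[OF has_integral_powr_from_0[of "-1/2" 1], of 2] by simp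
  have 1: "(\<integral>\<^sup>+s. ennreal (2 * s powr (-1/2)) * indicator {0..1} s \<partial>lborel) = 4"
    by (subst nn_integral_has_integral_lebesgue'[OF _ hi]) auto
  have 2: "(\<integral>\<^sup>+s. ennreal (2 * (-s) powr (-1/2)) * indicator {0..1} (-s) \<partial>lborel) = 4"
    by (subst nn_integral_real_affine[of _ "-1" 0]) (use 1 in simp_all)
  have "(\<integral>\<^sup>+s. g s \<partial>lborel) \<le> (\<integral>\<^sup>+s. ennreal (2 * s powr (-1/2)) * indicator {0..1} s +
           ennreal (2 * (-s) powr (-1/2)) * indicator {0..1} (-s) \<partial>lborel)"
    by (intro nn_integral_mono) (auto simp: g_def indicator_def abs_if)
  also have "\<dots> = 8" by (subst nn_integral_add) (use 1 2 in simp_all)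
  finally have g8: "(\<integral>\<^sup>+s. g s \<partial>lborel) \<le> 8" .
  have "(\<integral>\<^sup>+t. g (- a / (2 * \<rho>) + (1 / (2 * \<rho>)) * t) \<partial>lborel) = ennreal (2 * \<rho>) * (\<integral>\<^sup>+s. g s \<partial>lborel)"
    using nn_integral_real_affine[of "\<lambda>t. g (- a / (2 * \<rho>) + (1 / (2 * \<rho>)) * t)" "2 * \<rho>" a] \<rho>
    by (simp add: field_simps)
  also have "\<dots> \<le> ennreal (2 * \<rho>) * 8" by (intro mult_left_mono g8) auto
  also have "\<dots> = ennreal (16 * \<rho>)" using \<rho> by (simp flip: ennreal_numeral ennreal_mult)
  finally have g16: "(\<integral>\<^sup>+t. g (- a / (2 * \<rho>) + (1 / (2 * \<rho>)) * t) \<partial>lborel) \<le> ennreal (16 * \<rho>)" .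
  have "(\<integral>\<^sup>+t. abs_ln (norm ((of_real t - \<xi>) / (2 * \<rho>))) * indicator {-\<rho>..\<rho>} t \<partial>lborel)
     \<le> (\<integral>\<^sup>+t. g (- a / (2 * \<rho>) + (1 / (2 * \<rho>)) * t) \<partial>lborel)"
  proof (rule nn_integral_mono_AE)
    show "AE t in lborel. abs_ln (norm ((of_real t - \<xi>) / (2 * \<rho>))) * indicator {-\<rho>..\<rho>} t
        \<le> g (- a / (2 * \<rho>) + (1 / (2 * \<rho>)) * t)"
      using AE_lborel_singleton[of a]
    proof (eventually_elim)
      case (elim t)
      define s where "s = - a / (2 * \<rho>) + (1 / (2 * \<rho>)) * t"
      have s: "s = (t - a) / (2 * \<rho>)" by (simp add: s_def diff_divide_distrib)
      show ?case
      proof (cases "t \<in> {-\<rho>..\<rho>}")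
        case True
        define y where "y = norm ((of_real t - \<xi>) / (2 * \<rho>))"
        have yn: "y = norm (of_real t - \<xi>) / (2 * \<rho>)" using \<rho> by (simp add: y_def norm_divide)
        have "\<bar>t - a\<bar> \<le> norm (of_real t - \<xi>)" using abs_Re_le_cmod[of "of_real t - \<xi>"] by (simp add: a_def)
        then have ys: "\<bar>s\<bar> \<le> y" unfolding yn s using \<rho> by (simp add: divide_right_mono)
        have s0: "\<bar>s\<bar> > 0" using elim \<rho> by (simp add: s)
        have "norm (of_real t - \<xi>) \<le> 2 * \<rho>" using norm_triangle_ineq4[of "of_real t" \<xi>] \<xi> True by auto
        then have y1: "y \<le> 1" unfolding yn using \<rho> by simp
        have "\<bar>ln y\<bar> = - ln y" using y1 ys s0 by simp
        also have "\<dots> \<le> - ln \<bar>s\<bar>" using ys s0 by simp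
        also have "\<dots> = 2 * ln (\<bar>s\<bar> powr (-1/2))" using s0 by (simp add: ln_powr)
        also have "\<dots> \<le> 2 * \<bar>s\<bar> powr (-1/2)" using ln_le_minus_one[of "\<bar>s\<bar> powr (-1/2)"] s0 by simp
        finally have "\<bar>ln y\<bar> \<le> 2 * \<bar>s\<bar> powr (-1/2)" .
        moreover have "s \<in> {-1..1}" using ys y1 by auto
        ultimately show ?thesis using True ys s0 unfolding s_def[symmetric] y_def[symmetric] g_def abs_ln_def
          by (auto intro!: ennreal_leI)
      qed auto
    qed
  qed
  then show ?thesis using g16 by simp
qed

text \<open>\<open>C\<close> is chosen before \<open>h\<close>, because all lines near the origin
  share \<open>M\<close> and \<open>c\<close>. The logarithm of \<open>norm u\<close> lies between
  \<open>ln c\<close> and \<open>ln M\<close>, and the remaining factors, counted with multiplicity,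
  number at most \<open>N0\<close>.\<close>

lemma nn_integral_abs_ln_holomorphic_bound:
  assumes \<rho>: "0 < \<rho>" and c: "0 < c"
  shows "\<exists>C::real. \<forall>h. h holomorphic_on ball 0 (5 * \<rho>) \<and> (\<forall>t. norm t \<le> 4 * \<rho> \<longrightarrow> norm (h t) \<le> M) \<and>
      (\<forall>t. norm t = \<rho> \<longrightarrow> c \<le> norm (h t)) \<longrightarrow>
      (\<integral>\<^sup>+t. abs_ln (norm (h (of_real t))) * indicator {-\<rho>..\<rho>} t \<partial>lborel) \<le> ennreal C"
proof -
  define K where "K = \<bar>ln c\<bar> + \<bar>ln M\<bar>"
  define N0 where "N0 = ln (M / c) / ln (3/2)"
  have "(\<integral>\<^sup>+t. abs_ln (norm (h (of_real t))) * indicator {-\<rho>..\<rho>} t \<partial>lborel)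
      \<le> ennreal (K * (2 * \<rho>) + N0 * (16 * \<rho>))"
    if h: "h holomorphic_on ball 0 (5 * \<rho>)" "\<And>t. norm t \<le> 4 * \<rho> \<Longrightarrow> norm (h t) \<le> M"
      "\<And>t. norm t = \<rho> \<Longrightarrow> c \<le> norm (h t)" for h
  proof -
    obtain Z n u where Z: "finite Z" "Z = {t \<in> ball 0 \<rho>. h t = 0}" and u: "u holomorphic_on ball 0 (5 * \<rho>)"
      and hu: "\<And>t. t \<in> ball 0 (5 * \<rho>) \<Longrightarrow> h t = u t * (\<Prod>\<xi>\<in>Z. ((t - \<xi>) / (2 * \<rho>)) ^ n \<xi>)"
      and n: "\<And>\<xi>. \<xi> \<in> Z \<Longrightarrow> n \<xi> \<ge> (1::nat)"
      and lo: "\<And>t. norm t \<le> \<rho> \<Longrightarrow> c \<le> norm (u t)" and up: "\<And>t. norm t \<le> 4 * \<rho> \<Longrightarrow> norm (u t) \<le> M"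
      and N: "real (\<Sum>\<xi>\<in>Z. n \<xi>) \<le> ln (M / c) / ln (3/2)"
      by (rule bounded_factorization[OF \<rho> h(1,2) c h(3)]) (assumption, assumption, (rule that; assumption))
    note N' = N[folded N0_def]
    have le: "abs_ln (norm (h (of_real t))) \<le> ennreal K +
        (\<Sum>\<xi>\<in>Z. of_nat (n \<xi>) * abs_ln (norm ((of_real t - \<xi>) / (2 * \<rho>))))" if "t \<in> {-\<rho>..\<rho>}" for t
    proof -
      have t: "norm (of_real t :: complex) \<le> \<rho>" using that by auto
      have "norm (h (of_real t)) = norm (u (of_real t)) * (\<Prod>\<xi>\<in>Z. norm ((of_real t - \<xi>) / (2 * \<rho>)) ^ n \<xi>)"
        using t \<rho> by (subst hu) (auto simp: norm_mult norm_power simp flip: prod_norm)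
      also have "abs_ln \<dots> \<le> abs_ln (norm (u (of_real t))) + abs_ln (\<Prod>\<xi>\<in>Z. norm ((of_real t - \<xi>) / (2 * \<rho>)) ^ n \<xi>)"
        by (intro abs_ln_mult) (auto intro: prod_nonneg)
      also have "\<dots> \<le> ennreal K + (\<Sum>\<xi>\<in>Z. of_nat (n \<xi>) * abs_ln (norm ((of_real t - \<xi>) / (2 * \<rho>))))"
      proof (intro add_mono)
        have lt: "c \<le> norm (u (of_real t))" "norm (u (of_real t)) \<le> M" using lo[OF t] up[of "of_real t"] t \<rho> by auto
        moreover have "0 < norm (u (of_real t))" using lt c by linarith
        ultimately have "ln c \<le> ln (norm (u (of_real t)))" "ln (norm (u (of_real t))) \<le> ln M" using c by (auto simp: ln_mono)
        then have "\<bar>ln (norm (u (of_real t)))\<bar> \<le> K" unfolding K_def by linarith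
        then show "abs_ln (norm (u (of_real t))) \<le> ennreal K"
          using lt c by (auto simp: abs_ln_def intro!: ennreal_leI)
        show "abs_ln (\<Prod>\<xi>\<in>Z. norm ((of_real t - \<xi>) / (2 * \<rho>)) ^ n \<xi>) \<le> (\<Sum>\<xi>\<in>Z. of_nat (n \<xi>) * abs_ln (norm ((of_real t - \<xi>) / (2 * \<rho>))))"
          by (rule order_trans[OF abs_ln_prod]) (auto intro!: sum_mono abs_ln_power)
      qed
      finally show ?thesis .
    qed
    have "(\<integral>\<^sup>+t. abs_ln (norm (h (of_real t))) * indicator {-\<rho>..\<rho>} t \<partial>lborel) \<le>
       (\<integral>\<^sup>+t. ennreal K * indicator {-\<rho>..\<rho>} t +
        (\<Sum>\<xi>\<in>Z. of_nat (n \<xi>) * (abs_ln (norm ((of_real t - \<xi>) / (2 * \<rho>))) * indicator {-\<rho>..\<rho>} t)) \<partial>lborel)"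
      using le by (intro nn_integral_mono) (auto simp: indicator_def)
    also have "\<dots> = ennreal K * emeasure lborel {-\<rho>..\<rho>} +
        (\<Sum>\<xi>\<in>Z. of_nat (n \<xi>) * (\<integral>\<^sup>+t. (abs_ln (norm ((of_real t - \<xi>) / (2 * \<rho>))) * indicator {-\<rho>..\<rho>} t) \<partial>lborel))"
      by (subst nn_integral_add; (subst nn_integral_sum)?) (auto simp: nn_integral_cmult)
    also have "\<dots> \<le> ennreal K * ennreal (2 * \<rho>) + (\<Sum>\<xi>\<in>Z. of_nat (n \<xi>) * ennreal (16 * \<rho>))"
      using \<rho> Z(2) by (intro add_mono sum_mono mult_left_mono nn_integral_abs_ln_dist_le) auto
    also have "(\<Sum>\<xi>\<in>Z. of_nat (n \<xi>) * ennreal (16 * \<rho>)) = ennreal (real (\<Sum>\<xi>\<in>Z. n \<xi>)) * ennreal (16 * \<rho>)"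
      by (subst ennreal_of_nat_eq_real_of_nat[symmetric]) (simp only: of_nat_sum sum_distrib_right)
    also have "\<dots> \<le> ennreal N0 * ennreal (16 * \<rho>)"
      using N' by (intro mult_right_mono ennreal_leI) auto
    also have "ennreal K * ennreal (2 * \<rho>) + ennreal N0 * ennreal (16 * \<rho>) = ennreal (K * (2 * \<rho>) + N0 * (16 * \<rho>))"
    proof -
      have "0 \<le> real (\<Sum>\<xi>\<in>Z. n \<xi>)" by (rule of_nat_0_le_iff)
      then have "0 \<le> N0" "0 \<le> K" using N' by (linarith, simp add: K_def)
      then show ?thesis using \<rho>
        by (simp only: ennreal_mult[symmetric] ennreal_plus[symmetric] mult_nonneg_nonneg zero_le_numeral less_imp_le)
    qed
    finally show ?thesis by (auto intro: add_mono)
  qed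
  then show ?thesis by blast
qed

text \<open>Partial fractions: \<open>deriv u / u\<close> is bounded by Cauchy's estimate, and each
  of the boundedly many poles costs at most \<open>2 * ln (3 / \<delta>)\<close>. In the final form
  the individual line enters through \<open>\<delta>\<close> alone.\<close>

lemma nn_integral_log_derivative_bound:
  assumes \<rho>: "0 < \<rho>" "\<rho> \<le> 1/2" and c: "0 < c"
  shows "\<exists>C::real. C \<ge> 0 \<and> (\<forall>h \<delta>. h holomorphic_on ball 0 (5 * \<rho>) \<and> (\<forall>t. norm t \<le> 4 * \<rho> \<longrightarrow> norm (h t) \<le> M) \<and>
      (\<forall>t. norm t = \<rho> \<longrightarrow> c \<le> norm (h t)) \<and> 0 < \<delta> \<and> \<delta> \<le> 1 \<and>
      (\<forall>\<xi>. norm \<xi> < \<rho> \<and> h \<xi> = 0 \<longrightarrow> \<delta> \<le> \<bar>Im \<xi>\<bar>) \<longrightarrow>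
      (\<integral>\<^sup>+t. ennreal (norm (deriv h (of_real t) / h (of_real t))) * indicator {-\<rho>..\<rho>} t \<partial>lborel)
        \<le> ennreal (C + C * ln (3 / \<delta>)))"
proof -
  define N0 where "N0 = \<bar>ln (M / c) / ln (3/2)\<bar>"
  define C where "C = 2 * \<bar>M\<bar> / c + N0 * 2"
  have C0: "C \<ge> 0" using c by (auto simp: C_def N0_def)
  have "(\<integral>\<^sup>+t. ennreal (norm (deriv h (of_real t) / h (of_real t))) * indicator {-\<rho>..\<rho>} t \<partial>lborel)
        \<le> ennreal (C + C * ln (3 / \<delta>))"
    if h: "h holomorphic_on ball 0 (5 * \<rho>)" "\<And>t. norm t \<le> 4 * \<rho> \<Longrightarrow> norm (h t) \<le> M"
      "\<And>t. norm t = \<rho> \<Longrightarrow> c \<le> norm (h t)" and \<delta>: "0 < \<delta>" "\<delta> \<le> 1"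
      and \<delta>': "\<And>\<xi>. norm \<xi> < \<rho> \<Longrightarrow> h \<xi> = 0 \<Longrightarrow> \<delta> \<le> \<bar>Im \<xi>\<bar>" for h \<delta>
  proof -
    obtain Z n u where Z: "finite Z" "Z = {t \<in> ball 0 \<rho>. h t = 0}" and u: "u holomorphic_on ball 0 (5 * \<rho>)"
      and hu: "\<And>t. t \<in> ball 0 (5 * \<rho>) \<Longrightarrow> h t = u t * (\<Prod>\<xi>\<in>Z. ((t - \<xi>) / (2 * \<rho>)) ^ n \<xi>)"
      and n: "\<And>\<xi>. \<xi> \<in> Z \<Longrightarrow> n \<xi> \<ge> (1::nat)"
      and lo: "\<And>t. norm t \<le> \<rho> \<Longrightarrow> c \<le> norm (u t)" and up: "\<And>t. norm t \<le> 4 * \<rho> \<Longrightarrow> norm (u t) \<le> M"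
      and N: "real (\<Sum>\<xi>\<in>Z. n \<xi>) \<le> ln (M / c) / ln (3/2)"
      by (rule bounded_factorization[OF \<rho>(1) h(1,2) c h(3)]) (assumption, assumption, (rule that; assumption))
    then have N': "real (\<Sum>\<xi>\<in>Z. n \<xi>) \<le> N0" unfolding N0_def by linarith
    have M0: "M > 0" using lo[of 0] up[of 0] c \<rho> by auto
    have le: "norm (deriv h (of_real t) / h (of_real t)) \<le> M / (\<rho> * c) +
        (\<Sum>\<xi>\<in>Z. real (n \<xi>) * (1 / norm (of_real t - \<xi>)))" if "t \<in> {-\<rho>..\<rho>}" for t
    proof -
      have t: "norm (of_real t :: complex) \<le> \<rho>" using that by auto
      have tZ: "complex_of_real t \<notin> Z"
      proof
        assume "complex_of_real t \<in> Z"
        then have "\<delta> \<le> \<bar>Im (complex_of_real t)\<bar>" by (intro \<delta>') (auto simp: Z(2))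
        then show False using \<delta> by simp
      qed
      have u0: "u (of_real t) \<noteq> 0" using lo[OF t] c by auto
      have *: "deriv h (of_real t) / h (of_real t) = deriv u (of_real t) / u (of_real t) +
          (\<Sum>\<xi>\<in>Z. of_nat (n \<xi>) / (of_real t - \<xi>))"
        using t \<rho> Z(1) tZ u0 by (intro log_derivative_factorization[where S="ball 0 (5 * \<rho>)" and \<rho> = "2 * \<rho>"] u hu) auto
      \<comment> \<open>Room for Cauchy's estimate: discs of radius \<open>\<rho>\<close> about
        points of the interval stay where \<open>norm u \<le> M\<close> is known.\<close>
      have sub: "cball (complex_of_real t) \<rho> \<subseteq> cball 0 (4 * \<rho>)"
      proof
        fix z assume "z \<in> cball (complex_of_real t) \<rho>"
        then have "norm z \<le> norm (complex_of_real t) + \<rho>"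
          using norm_triangle_ineq2[of z "of_real t"] by (auto simp: dist_norm norm_minus_commute)
        then show "z \<in> cball 0 (4 * \<rho>)" using t \<rho> by auto
      qed
      have "norm ((deriv ^^ 1) u (of_real t)) \<le> fact 1 * M / \<rho> ^ 1"
      proof (rule Cauchy_inequality)
        have sub': "cball (complex_of_real t) \<rho> \<subseteq> ball 0 (5 * \<rho>)" using sub \<rho> by fastforce
        show "u holomorphic_on ball (of_real t) \<rho>"
          using sub' by (intro holomorphic_on_subset[OF u]) auto
        show "continuous_on (cball (of_real t) \<rho>) u"
          using sub' by (intro holomorphic_on_imp_continuous_on holomorphic_on_subset[OF u]) auto
        fix x :: complex assume "norm (of_real t - x) = \<rho>"
        then have "x \<in> cball (of_real t) \<rho>" by (simp add: dist_norm)
        then have "x \<in> cball 0 (4 * \<rho>)" using sub by blast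
        then show "norm (u x) \<le> M" by (intro up) auto
      qed (use \<rho> in auto)
      then have "norm (deriv u (of_real t) / u (of_real t)) \<le> (M / \<rho>) / c"
        using lo[OF t] c M0 \<rho> unfolding norm_divide by (intro frac_le) auto
      moreover have "norm (\<Sum>\<xi>\<in>Z. of_nat (n \<xi>) / (of_real t - \<xi>)) \<le> (\<Sum>\<xi>\<in>Z. real (n \<xi>) * (1 / norm (of_real t - \<xi>)))"
        by (rule order_trans[OF norm_sum]) (auto intro!: sum_mono simp: norm_divide)
      ultimately show ?thesis unfolding * using norm_triangle_ineq[of "deriv u (of_real t) / u (of_real t)"
          "\<Sum>\<xi>\<in>Z. of_nat (n \<xi>) / (of_real t - \<xi>)"] by simp
    qed
    have "(\<integral>\<^sup>+t. ennreal (norm (deriv h (of_real t) / h (of_real t))) * indicator {-\<rho>..\<rho>} t \<partial>lborel) \<le>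
       (\<integral>\<^sup>+t. ennreal (M / (\<rho> * c)) * indicator {-\<rho>..\<rho>} t +
        (\<Sum>\<xi>\<in>Z. of_nat (n \<xi>) * (ennreal (1 / norm (of_real t - \<xi>)) * indicator {-\<rho>..\<rho>} t)) \<partial>lborel)"
    proof (intro nn_integral_mono)
      fix t :: real
      show "ennreal (norm (deriv h (of_real t) / h (of_real t))) * indicator {-\<rho>..\<rho>} t \<le>
        ennreal (M / (\<rho> * c)) * indicator {-\<rho>..\<rho>} t +
        (\<Sum>\<xi>\<in>Z. of_nat (n \<xi>) * (ennreal (1 / norm (of_real t - \<xi>)) * indicator {-\<rho>..\<rho>} t))"
      proof (cases "t \<in> {-\<rho>..\<rho>}")
        case True
        have "ennreal (M / (\<rho> * c) + (\<Sum>\<xi>\<in>Z. real (n \<xi>) * (1 / norm (of_real t - \<xi>)))) =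
           ennreal (M / (\<rho> * c)) + (\<Sum>\<xi>\<in>Z. of_nat (n \<xi>) * ennreal (1 / norm (of_real t - \<xi>)))"
          using M0 \<rho> c by (subst ennreal_plus)
            (auto intro!: sum_nonneg sum.cong simp: sum_ennreal[symmetric] ennreal_mult'[symmetric] ennreal_of_nat_eq_real_of_nat simp del: sum_ennreal)
        then show ?thesis using ennreal_leI[OF le[OF True]] True by simp
      qed auto
    qed
    also have "\<dots> = ennreal (M / (\<rho> * c)) * emeasure lborel {-\<rho>..\<rho>} +
        (\<Sum>\<xi>\<in>Z. of_nat (n \<xi>) * (\<integral>\<^sup>+t. (ennreal (1 / norm (of_real t - \<xi>)) * indicator {-\<rho>..\<rho>} t) \<partial>lborel))"
      by (subst nn_integral_add; (subst nn_integral_sum)?) (auto simp: nn_integral_cmult)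
    also have "\<dots> \<le> ennreal (M / (\<rho> * c)) * ennreal (2 * \<rho>) + (\<Sum>\<xi>\<in>Z. of_nat (n \<xi>) * ennreal (2 * ln (3 / \<delta>)))"
      using \<rho> Z(2) \<delta> by (intro add_mono sum_mono mult_left_mono nn_integral_inverse_dist_le \<delta>') auto
    also have "(\<Sum>\<xi>\<in>Z. of_nat (n \<xi>) * ennreal (2 * ln (3 / \<delta>))) = ennreal (real (\<Sum>\<xi>\<in>Z. n \<xi>)) * ennreal (2 * ln (3 / \<delta>))"
      by (subst ennreal_of_nat_eq_real_of_nat[symmetric]) (simp only: of_nat_sum sum_distrib_right)
    also have "\<dots> \<le> ennreal N0 * ennreal (2 * ln (3 / \<delta>))"
      using N' by (intro mult_right_mono ennreal_leI) auto
    also have "ennreal (M / (\<rho> * c)) * ennreal (2 * \<rho>) + ennreal N0 * ennreal (2 * ln (3 / \<delta>)) =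
       ennreal (2 * M / c + N0 * (2 * ln (3 / \<delta>)))"
      using \<rho> N' M0 c \<delta> by (subst ennreal_plus) (auto simp: ennreal_mult'[symmetric] N0_def ln_ge_zero)
    also have "\<dots> \<le> ennreal (C + C * ln (3 / \<delta>))"
    proof (rule ennreal_leI)
      have l: "ln (3 / \<delta>) \<ge> 0" using \<delta> by (intro ln_ge_zero) auto
      have "N0 * (2 * ln (3 / \<delta>)) \<le> C * ln (3 / \<delta>)"
        using l M0 c by (auto simp: C_def algebra_simps)
      moreover have "2 * M / c \<le> C" using M0 c by (auto simp: C_def N0_def)
      ultimately show "2 * M / c + N0 * (2 * ln (3 / \<delta>)) \<le> C + C * ln (3 / \<delta>)" by simp
    qed
    finally show ?thesis by (auto intro: add_mono)
  qed
  then show ?thesis using C0 by blast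
qed

section \<open>Averaging over translated segments\<close>

lemma nn_integral_line_average:
  fixes g :: "'a::euclidean_space \<Rightarrow> ennreal"
  assumes [measurable]: "g \<in> borel_measurable borel" and a: "a > 0"
  shows "ennreal (2 * a) * (\<integral>\<^sup>+x. g x \<partial>lborel) =
     (\<integral>\<^sup>+x. (\<integral>\<^sup>+t. g (x + t *\<^sub>R v) * indicator {-a..a} t \<partial>lborel) \<partial>lborel)"
proof -
  have "(\<integral>\<^sup>+x. (\<integral>\<^sup>+t. g (x + t *\<^sub>R v) * indicator {-a..a} t \<partial>lborel) \<partial>lborel) =
     (\<integral>\<^sup>+t. (\<integral>\<^sup>+x. g (x + t *\<^sub>R v) * indicator {-a..a} t \<partial>lborel) \<partial>lborel)"
    by (rule lborel_pair.Fubini') measurable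
  also have "\<dots> = (\<integral>\<^sup>+t. (\<integral>\<^sup>+x. g x \<partial>lborel) * indicator {-a..a} t \<partial>lborel)"
  proof (intro nn_integral_cong)
    fix t :: real
    have "(\<integral>\<^sup>+x. g x \<partial>lborel) = (\<integral>\<^sup>+x. g (x + t *\<^sub>R v) \<partial>lborel)"
      by (subst lborel_distr_plus[symmetric, of "t *\<^sub>R v"], subst nn_integral_distr) (auto simp: add.commute)
    then show "(\<integral>\<^sup>+x. g (x + t *\<^sub>R v) * indicator {-a..a} t \<partial>lborel) = (\<integral>\<^sup>+x. g x \<partial>lborel) * indicator {-a..a} t"
      by (simp add: nn_integral_multc)
  qed
  also have "\<dots> = (\<integral>\<^sup>+x. g x \<partial>lborel) * ennreal (2 * a)"
    using a by (subst nn_integral_cmult_indicator) auto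
  finally show ?thesis by (simp add: mult.commute)
qed

section \<open>Multivariate power series\<close>


definition monom_at :: "('n::finite \<Rightarrow> nat) \<Rightarrow> 'a::comm_ring_1 ^ 'n \<Rightarrow> 'a" where
  "monom_at \<alpha> z = (\<Prod>i\<in>UNIV. (z $ i) ^ \<alpha> i)"

definition cvec :: "real ^ 'n \<Rightarrow> complex ^ 'n" where
  "cvec x = (\<chi> i. of_real (x $ i))"

text \<open>Testing real points controls complex ones too: summability of real families is absolute,
  and a complex vector has the same Euclidean norm as the vector of its moduli.\<close>

definition converges_on_ball :: "(('n::finite \<Rightarrow> nat) \<Rightarrow> real) \<Rightarrow> real \<Rightarrow> bool" where
  "converges_on_ball c r \<longleftrightarrow> (\<forall>x\<in>ball (0::real^'n) r. (\<lambda>\<alpha>. c \<alpha> * monom_at \<alpha> x) summable_on UNIV)"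

definition pseries :: "(('n::finite \<Rightarrow> nat) \<Rightarrow> real) \<Rightarrow> complex ^ 'n \<Rightarrow> complex" where
  "pseries c z = (\<Sum>\<^sub>\<infinity>\<alpha>. of_real (c \<alpha>) * monom_at \<alpha> z)"

definition pderiv_coeff :: "'n \<Rightarrow> (('n::finite \<Rightarrow> nat) \<Rightarrow> real) \<Rightarrow> ('n \<Rightarrow> nat) \<Rightarrow> real" where
  "pderiv_coeff i c \<alpha> = real (\<alpha> i + 1) * c (\<alpha>(i := \<alpha> i + 1))"

definition dirderiv_coeff :: "real ^ 'n \<Rightarrow> (('n::finite \<Rightarrow> nat) \<Rightarrow> real) \<Rightarrow> ('n \<Rightarrow> nat) \<Rightarrow> real" where
  "dirderiv_coeff v c \<alpha> = (\<Sum>i\<in>UNIV. v $ i * pderiv_coeff i c \<alpha>)"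

lemma has_sum_finite_sum:
  fixes f :: "'i \<Rightarrow> 'a \<Rightarrow> 'b::topological_comm_monoid_add"
  assumes "\<And>i. i \<in> I \<Longrightarrow> (f i has_sum s i) A"
  shows "((\<lambda>x. \<Sum>i\<in>I. f i x) has_sum (\<Sum>i\<in>I. s i)) A"
  using assms
proof (induction I rule: infinite_finite_induct)
  case (insert i I)
  then show ?case by (simp add: has_sum_add)
qed (auto simp: has_sum_0)

lemma cvec_nth [simp]: "cvec x $ i = of_real (x $ i)" by (simp add: cvec_def)

lemma norm_cvec [simp]: "norm (cvec x) = norm x"
  by (simp add: norm_vec_def)

lemma cvec_add: "cvec (x + y) = cvec x + cvec y" by (simp add: vec_eq_iff)
lemma cvec_diff: "cvec (x - y) = cvec x - cvec y" by (simp add: vec_eq_iff)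
lemma cvec_scale: "cvec (t *\<^sub>R x) = of_real t *s cvec x" by (simp add: vec_eq_iff)
lemma cvec_0 [simp]: "cvec 0 = 0" by (simp add: vec_eq_iff)

lemma norm_vscale: "norm (s *s (z :: complex ^ 'n)) = norm s * norm z"
  by (simp add: norm_vec_def norm_mult L2_set_right_distrib)

lemma continuous_on_cvec [continuous_intros]:
  "continuous_on S g \<Longrightarrow> continuous_on S (\<lambda>x. cvec (g x))"
  unfolding cvec_def by (intro continuous_on_vec_lambda continuous_intros)

lemma continuous_on_vscale [continuous_intros]:
  fixes g :: "'b::topological_space \<Rightarrow> complex ^ 'n"
  assumes "continuous_on S f" "continuous_on S g"
  shows "continuous_on S (\<lambda>x. f x *s g x)"
  unfolding vector_scalar_mult_def by (intro continuous_on_vec_lambda continuous_intros assms)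

lemma norm_monom_at: "norm (monom_at \<alpha> (z :: complex ^ 'n)) = (\<Prod>i\<in>UNIV. norm (z $ i) ^ \<alpha> i)"
  by (simp add: monom_at_def prod_norm[symmetric] norm_power)

lemma monom_at_cvec: "monom_at \<alpha> (cvec x) = of_real (monom_at \<alpha> x)"
  by (simp add: monom_at_def)

text \<open>The spare \<open>\<delta>\<close> in every coordinate is what later pays for perturbing
  the point and for differentiating the series.\<close>

lemma converges_on_ball_dominated:
  fixes c :: "('n::finite \<Rightarrow> nat) \<Rightarrow> real" and y :: "'n \<Rightarrow> real"
  assumes c: "converges_on_ball c r" and y: "\<And>i. y i \<ge> 0" "L2_set y UNIV < r"
  shows "\<exists>\<delta>>0. (\<lambda>\<alpha>. \<bar>c \<alpha>\<bar> * (\<Prod>i\<in>UNIV. (y i + \<delta>) ^ \<alpha> i)) summable_on UNIV"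
proof -
  \<comment> \<open>Adding \<open>\<delta>\<close> to each of the n coordinates raises the norm by
    at most \<open>n * \<delta>\<close>, which is half of the gap to \<open>r\<close>.\<close>
  define \<delta> where "\<delta> = (r - L2_set y UNIV) / (2 * CARD('n))"
  have \<delta>: "\<delta> > 0" using y by (simp add: \<delta>_def)
  define x :: "real^'n" where "x = (\<chi> i. y i + \<delta>)"
  have "norm x = norm ((\<chi> i. y i) + (\<chi> i. \<delta>) :: real^'n)" by (simp add: x_def plus_vec_def)
  also have "\<dots> \<le> norm ((\<chi> i. y i) :: real^'n) + norm ((\<chi> i. \<delta>) :: real^'n)" by (rule norm_triangle_ineq)
  also have "norm ((\<chi> i. y i) :: real^'n) = L2_set y UNIV" using y by (simp add: norm_vec_def)
  also have "norm ((\<chi> i. \<delta>) :: real^'n) \<le> (\<Sum>i\<in>(UNIV::'n set). \<bar>\<delta>\<bar>)"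
    by (rule order_trans[OF norm_le_l1_cart]) simp
  also have "\<dots> = (r - L2_set y UNIV) / 2" using y by (simp add: \<delta>_def)
  finally have "norm x < r" using y(2) by (simp add: field_simps)
  then have "(\<lambda>\<alpha>. c \<alpha> * monom_at \<alpha> x) summable_on UNIV" using c by (auto simp: converges_on_ball_def)
  then have "(\<lambda>\<alpha>. norm (c \<alpha> * monom_at \<alpha> x)) summable_on UNIV"
    by (rule summable_on_iff_abs_summable_on_real[THEN iffD1])
  moreover have "norm (c \<alpha> * monom_at \<alpha> x) = \<bar>c \<alpha>\<bar> * (\<Prod>i\<in>UNIV. (y i + \<delta>) ^ \<alpha> i)" for \<alpha>
    using y \<delta> by (simp add: abs_mult monom_at_def x_def abs_prod power_abs)
  ultimately show ?thesis using \<delta> by auto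
qed

lemma pseries_dominated:
  fixes z :: "complex ^ 'n"
  assumes c: "converges_on_ball c r" and z: "norm z < r"
  obtains \<delta> M where "\<delta> > 0" "M summable_on UNIV"
    "\<And>\<alpha> z'. (\<And>i. norm (z' $ i - z $ i) \<le> \<delta>) \<Longrightarrow> norm (of_real (c \<alpha>) * monom_at \<alpha> z') \<le> M \<alpha>"
proof -
  obtain \<delta> where \<delta>: "\<delta> > 0" "(\<lambda>\<alpha>. \<bar>c \<alpha>\<bar> * (\<Prod>i\<in>UNIV. (norm (z $ i) + \<delta>) ^ \<alpha> i)) summable_on UNIV"
    using converges_on_ball_dominated[OF c, of "\<lambda>i. norm (z $ i)"] z by (auto simp: norm_vec_def)
  show ?thesis
  proof (rule that[OF \<delta>])
    fix \<alpha> and z' :: "complex ^ 'n" assume z': "\<And>i. norm (z' $ i - z $ i) \<le> \<delta>"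
    have "norm (z' $ i) \<le> norm (z $ i) + \<delta>" for i
      using z'[of i] norm_triangle_ineq2[of "z' $ i" "z $ i"] by linarith
    then show "norm (of_real (c \<alpha>) * monom_at \<alpha> z') \<le> \<bar>c \<alpha>\<bar> * (\<Prod>i\<in>UNIV. (norm (z $ i) + \<delta>) ^ \<alpha> i)"
      unfolding norm_mult norm_monom_at norm_of_real by (intro mult_left_mono prod_mono conjI power_mono) auto
  qed
qed

lemma pseries_has_sum:
  assumes "converges_on_ball c r" "norm z < r"
  shows "((\<lambda>\<alpha>. of_real (c \<alpha>) * monom_at \<alpha> z) has_sum pseries c z) UNIV"
proof -
  obtain \<delta> M where *: "\<delta> > 0" "M summable_on UNIV"
    "\<And>\<alpha> z'. (\<And>i. norm (z' $ i - z $ i) \<le> \<delta>) \<Longrightarrow> norm (of_real (c \<alpha>) * monom_at \<alpha> z') \<le> M \<alpha>"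
    using pseries_dominated[OF assms] by blast
  have "(\<lambda>\<alpha>. norm (of_real (c \<alpha>) * monom_at \<alpha> z)) summable_on UNIV"
    by (rule Infinite_Sum.abs_summable_on_comparison_test'[OF *(2)]) (rule *(3), use *(1) in simp)
  then have "(\<lambda>\<alpha>. of_real (c \<alpha>) * monom_at \<alpha> z) summable_on UNIV" by (rule abs_summable_summable)
  then show ?thesis unfolding pseries_def by simp
qed

lemma pseries_cvec_has_sum:
  assumes "converges_on_ball c r" "norm x < r"
  shows "((\<lambda>\<alpha>. c \<alpha> * monom_at \<alpha> x) has_sum Re (pseries c (cvec x))) UNIV"
  using has_sum_Re[OF pseries_has_sum[OF assms(1), of "cvec x"]] assms(2) by (simp add: monom_at_cvec)

lemma pseries_cvec:
  assumes "converges_on_ball c r" "norm x < r"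
  shows "pseries c (cvec x) = of_real (Re (pseries c (cvec x)))"
proof -
  have "((\<lambda>\<alpha>. of_real (c \<alpha>) * monom_at \<alpha> (cvec x) :: complex) has_sum of_real (Re (pseries c (cvec x)))) UNIV"
    using has_sum_of_real[OF pseries_cvec_has_sum[OF assms], where 'a = complex] by (simp add: monom_at_cvec)
  then show ?thesis using pseries_has_sum[OF assms(1), of "cvec x"] assms(2)
    by (intro has_sum_unique) auto
qed

lemma pseries_cnj:
  assumes "converges_on_ball c r" "norm z < r"
  shows "pseries c (\<chi> i. cnj (z $ i)) = cnj (pseries c z)"
proof -
  have "norm (\<chi> i. cnj (z $ i)) < r" using assms(2) by (simp add: norm_vec_def)
  from pseries_has_sum[OF assms(1) this]
  have 1: "((\<lambda>\<alpha>. of_real (c \<alpha>) * cnj (monom_at \<alpha> z)) has_sum pseries c (\<chi> i. cnj (z $ i))) UNIV"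
    by (simp add: monom_at_def)
  have "((\<lambda>\<alpha>. of_real (c \<alpha>) * cnj (monom_at \<alpha> z)) has_sum cnj (pseries c z)) UNIV"
    using pseries_has_sum[OF assms] has_sum_cnj_iff[of "\<lambda>\<alpha>. of_real (c \<alpha>) * monom_at \<alpha> z"] by simp
  from has_sum_unique[OF 1 this] show ?thesis .
qed

lemma continuous_on_pseries:
  fixes c :: "('n::finite \<Rightarrow> nat) \<Rightarrow> real"
  assumes c: "converges_on_ball c r"
  shows "continuous_on (ball 0 r) (pseries c)"
proof -
  have "isCont (pseries c) z" if z: "norm z < r" for z
  proof -
    obtain \<delta> M where *: "\<delta> > 0" "M summable_on UNIV"
      "\<And>\<alpha> z'. (\<And>i. norm (z' $ i - z $ i) \<le> \<delta>) \<Longrightarrow> norm (of_real (c \<alpha>) * monom_at \<alpha> z') \<le> M \<alpha>"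
      using pseries_dominated[OF c z] by blast
    have "uniform_limit (ball z \<delta>) (\<lambda>A z. \<Sum>\<alpha>\<in>A. of_real (c \<alpha>) * monom_at \<alpha> z)
        (\<lambda>z. \<Sum>\<^sub>\<infinity>\<alpha>. of_real (c \<alpha>) * monom_at \<alpha> z) (finite_subsets_at_top UNIV)"
    proof (rule Weierstrass_m_test_general[OF _ *(2)])
      fix \<alpha> and z' assume "z' \<in> ball z \<delta>"
      then have "norm (z' - z) < \<delta>" by (simp add: dist_norm norm_minus_commute)
      then show "norm (of_real (c \<alpha>) * monom_at \<alpha> z') \<le> M \<alpha>"
        using Finite_Cartesian_Product.norm_nth_le[of "z' - z"] by (intro *(3)) (smt (verit) vector_minus_component)
    qed
    then have "continuous_on (ball z \<delta>) (pseries c)"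
      unfolding pseries_def
      by (rule uniform_limit_theorem[rotated]) (auto simp: monom_at_def intro!: always_eventually continuous_intros)
    then show ?thesis using *(1) by (simp add: continuous_on_eq_continuous_at)
  qed
  then show ?thesis by (auto simp: continuous_on_eq_continuous_at)
qed

text \<open>One term of the binomial expansion. It absorbs the factor \<open>\<alpha> i + 1\<close>
  produced by differentiation, so the derived series converges on the same ball.\<close>

lemma Suc_mult_power_le_power_add:
  fixes y \<delta> :: real
  assumes "y \<ge> 0" "\<delta> \<ge> 0"
  shows "real (m + 1) * y ^ m * \<delta> \<le> (y + \<delta>) ^ (m + 1)"
proof (induction m)
  case (Suc m)
  have "real (Suc m + 1) * y ^ Suc m * \<delta> = y * (real (m + 1) * y ^ m * \<delta>) + \<delta> * y ^ Suc m"
    by (simp add: algebra_simps)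
  also have "\<dots> \<le> y * (y + \<delta>) ^ (m + 1) + \<delta> * (y + \<delta>) ^ Suc m"
    using assms by (intro add_mono mult_left_mono Suc power_mono) auto
  also have "\<dots> = (y + \<delta>) ^ (Suc m + 1)" by (simp add: algebra_simps)
  finally show ?case .
qed (use assms in auto)

lemma prod_fun_upd_power:
  fixes y :: "'n::finite \<Rightarrow> 'a::comm_monoid_mult"
  shows "(\<Prod>j\<in>UNIV. y j ^ (\<alpha>(i := k)) j) = y i ^ k * (\<Prod>j\<in>UNIV - {i}. y j ^ \<alpha> j)"
  by (subst prod.remove[of _ i]) (auto intro!: arg_cong2[where f="(*)"] prod.cong)

lemma converges_on_ball_pderiv_coeff:
  fixes c :: "('n::finite \<Rightarrow> nat) \<Rightarrow> real"
  assumes c: "converges_on_ball c r"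
  shows "converges_on_ball (pderiv_coeff i c) r"
  unfolding converges_on_ball_def
proof
  fix x :: "real^'n" assume x: "x \<in> ball 0 r"
  define y where "y = (\<lambda>i. \<bar>x $ i\<bar>)"
  obtain \<delta> where \<delta>: "\<delta> > 0" "(\<lambda>\<alpha>. \<bar>c \<alpha>\<bar> * (\<Prod>i\<in>UNIV. (y i + \<delta>) ^ \<alpha> i)) summable_on UNIV"
    using converges_on_ball_dominated[OF c, of y] x by (auto simp: norm_vec_def y_def)
  define S where "S = (\<lambda>\<alpha>. \<bar>c \<alpha>\<bar> * (\<Prod>i\<in>UNIV. (y i + \<delta>) ^ \<alpha> i))"
  \<comment> \<open>Differentiation shifts the exponent of coordinate \<open>i\<close>; the shift is
    injective, so the dominating series may be summed along its range.\<close>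
  define \<sigma> where "\<sigma> = (\<lambda>\<alpha>::'n\<Rightarrow>nat. \<alpha>(i := \<alpha> i + 1))"
  have inj: "inj \<sigma>" by (rule injI) (auto simp: \<sigma>_def fun_eq_iff split: if_splits; metis)
  have "S summable_on range \<sigma>" using \<delta>(2) unfolding S_def by (rule summable_on_subset_banach) auto
  then have "(\<lambda>\<alpha>. S (\<sigma> \<alpha>)) summable_on UNIV" using summable_on_reindex[OF inj, of S] by (simp add: o_def)
  then have "(\<lambda>\<alpha>. (1/\<delta>) * S (\<sigma> \<alpha>)) summable_on UNIV" by (rule summable_on_cmult_right)
  then have "(\<lambda>\<alpha>. norm (pderiv_coeff i c \<alpha> * monom_at \<alpha> x)) summable_on UNIV"
  proof (rule Infinite_Sum.abs_summable_on_comparison_test')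
    fix \<alpha> :: "'n \<Rightarrow> nat"
    have y0: "y j \<ge> 0" for j by (simp add: y_def)
    have "\<bar>monom_at \<alpha> x\<bar> = (\<Prod>j\<in>UNIV. y j ^ \<alpha> j)" by (simp add: monom_at_def y_def abs_prod power_abs)
    also have "\<dots> = y i ^ \<alpha> i * (\<Prod>j\<in>UNIV - {i}. y j ^ \<alpha> j)" using prod_fun_upd_power[of y \<alpha> i "\<alpha> i"] by simp
    finally have m: "\<bar>monom_at \<alpha> x\<bar> = \<dots>" .
    have "norm (pderiv_coeff i c \<alpha> * monom_at \<alpha> x) =
       (1/\<delta>) * (\<bar>c (\<sigma> \<alpha>)\<bar> * ((real (\<alpha> i + 1) * y i ^ \<alpha> i * \<delta>) * (\<Prod>j\<in>UNIV - {i}. y j ^ \<alpha> j)))"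
      using \<delta> by (simp add: abs_mult m pderiv_coeff_def \<sigma>_def)
    also have "\<dots> \<le> (1/\<delta>) * (\<bar>c (\<sigma> \<alpha>)\<bar> * ((y i + \<delta>) ^ (\<alpha> i + 1) * (\<Prod>j\<in>UNIV - {i}. (y j + \<delta>) ^ \<alpha> j)))"
      using \<delta> y0 by (intro mult_left_mono mult_mono Suc_mult_power_le_power_add prod_mono conjI power_mono)
        (auto intro!: prod_nonneg)
    also have "\<dots> = (1/\<delta>) * S (\<sigma> \<alpha>)" unfolding S_def \<sigma>_def prod_fun_upd_power ..
    finally show "norm (pderiv_coeff i c \<alpha> * monom_at \<alpha> x) \<le> (1/\<delta>) * S (\<sigma> \<alpha>)" .
  qed
  then show "(\<lambda>\<alpha>. pderiv_coeff i c \<alpha> * monom_at \<alpha> x) summable_on UNIV" by (rule abs_summable_summable)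
qed

lemma pseries_dirderiv_coeff_has_sum:
  assumes c: "converges_on_ball c r" and z: "norm z < r"
  shows "((\<lambda>\<alpha>. of_real (dirderiv_coeff v c \<alpha>) * monom_at \<alpha> z) has_sum
           (\<Sum>i\<in>UNIV. of_real (v $ i) * pseries (pderiv_coeff i c) z)) UNIV"
  unfolding dirderiv_coeff_def of_real_sum sum_distrib_right of_real_mult mult.assoc
  by (intro has_sum_finite_sum has_sum_cmult_right pseries_has_sum[OF converges_on_ball_pderiv_coeff[OF c] z])

lemma pseries_dirderiv_coeff:
  assumes c: "converges_on_ball c r" and z: "norm z < r"
  shows "pseries (dirderiv_coeff v c) z = (\<Sum>i\<in>UNIV. of_real (v $ i) * pseries (pderiv_coeff i c) z)"
  unfolding pseries_def[of "dirderiv_coeff v c"] by (rule infsumI[OF pseries_dirderiv_coeff_has_sum[OF assms]])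

lemma converges_on_ball_dirderiv_coeff:
  fixes c :: "('n::finite \<Rightarrow> nat) \<Rightarrow> real"
  assumes c: "converges_on_ball c r"
  shows "converges_on_ball (dirderiv_coeff v c) r"
  unfolding converges_on_ball_def
proof
  fix x :: "real^'n" assume "x \<in> ball 0 r"
  then have "norm (cvec x) < r" by simp
  from has_sum_Re[OF pseries_dirderiv_coeff_has_sum[OF c this, of v]]
  show "(\<lambda>\<alpha>. dirderiv_coeff v c \<alpha> * monom_at \<alpha> x) summable_on UNIV"
    by (auto simp: monom_at_cvec summable_on_def)
qed

text \<open>Along a complex line the finite partial sums are holomorphic and converge uniformly on a
  disc, so by Weierstrass's theorem their derivatives converge to the derivative of the limit; what
  remains is to identify this limit at \<open>s = 0\<close>.\<close>

lemma pseries_has_field_derivative_0: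
  fixes c :: "('n::finite \<Rightarrow> nat) \<Rightarrow> real"
  assumes c: "converges_on_ball c r" and z: "norm z < r"
  shows "((\<lambda>s. pseries c (z + s *s cvec v)) has_field_derivative pseries (dirderiv_coeff v c) z) (at 0)"
proof -
  define w where "w = cvec v"
  obtain \<delta> M where *: "\<delta> > 0" "M summable_on UNIV"
    "\<And>\<alpha> z'. (\<And>i. norm (z' $ i - z $ i) \<le> \<delta>) \<Longrightarrow> norm (of_real (c \<alpha>) * monom_at \<alpha> z') \<le> M \<alpha>"
    using pseries_dominated[OF c z] by blast
  \<comment> \<open>Keeps every coordinate of \<open>s *s w\<close> within \<open>\<delta>\<close>;
    the summand 1 admits \<open>w = 0\<close>.\<close>
  define \<eta> where "\<eta> = \<delta> / (norm w + 1)"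
  have \<eta>: "\<eta> > 0" using *(1) by (auto simp: \<eta>_def intro!: divide_pos_pos add_nonneg_pos)
  define dm where "dm = (\<lambda>\<alpha> i (z :: complex ^ 'n). of_nat (\<alpha> i) * (z $ i) ^ (\<alpha> i - 1) * (\<Prod>j\<in>UNIV - {i}. (z $ j) ^ \<alpha> j))"
  define f where "f = (\<lambda>A s. \<Sum>\<alpha>\<in>A. of_real (c \<alpha>) * monom_at \<alpha> (z + s *s w))"
  define f' where "f' = (\<lambda>A s. \<Sum>\<alpha>\<in>A. of_real (c \<alpha>) * (\<Sum>i\<in>UNIV. w $ i * dm \<alpha> i (z + s *s w)))"
  have dm: "((\<lambda>s. monom_at \<alpha> (z + s *s w)) has_field_derivative (\<Sum>i\<in>UNIV. w $ i * dm \<alpha> i (z + s *s w))) (at s)" for \<alpha> s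
  proof -
    have "((\<lambda>s. \<Prod>i\<in>UNIV. (z $ i + s * w $ i) ^ \<alpha> i) has_field_derivative
       (\<Sum>i\<in>UNIV. (of_nat (\<alpha> i) * (w $ i * (z $ i + s * w $ i) ^ (\<alpha> i - Suc 0))) * (\<Prod>j\<in>UNIV - {i}. (z $ j + s * w $ j) ^ \<alpha> j))) (at s)"
      by (intro has_field_derivative_prod DERIV_power) (auto intro!: derivative_eq_intros)
    then show ?thesis by (simp add: monom_at_def dm_def mult_ac)
  qed
  have fd: "(f A has_field_derivative f' A s) (at s)" for A s
    unfolding f_def f'_def by (intro DERIV_sum DERIV_cmult dm)
  have ul: "uniform_limit (cball 0 \<eta>) f (\<lambda>s. pseries c (z + s *s w)) (finite_subsets_at_top UNIV)"
    unfolding f_def pseries_def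
  proof (rule Weierstrass_m_test_general[OF *(3) *(2)])
    fix s i assume "s \<in> cball (0::complex) \<eta>"
    then have "norm s * norm (w $ i) \<le> \<eta> * (norm w + 1)"
      using Finite_Cartesian_Product.norm_nth_le[of w i] \<eta> by (intro mult_mono) auto
    also have "\<dots> = \<delta>" using norm_ge_zero[of w] by (simp add: \<eta>_def) (smt (verit) norm_ge_zero)
    finally show "norm ((z + s *s w) $ i - z $ i) \<le> \<delta>" by (simp add: norm_mult)
  qed
  have "\<forall>\<^sub>F A in finite_subsets_at_top UNIV. continuous_on (cball 0 \<eta>) (f A) \<and>
      (\<forall>s\<in>ball 0 \<eta>. (f A has_field_derivative f' A s) (at s))"
    using fd by (intro always_eventually allI conjI ballI continuous_at_imp_continuous_on) (auto intro: DERIV_isCont)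
  then obtain g' where g': "\<And>s. s \<in> ball 0 \<eta> \<Longrightarrow> ((\<lambda>s. pseries c (z + s *s w)) has_field_derivative g' s) (at s) \<and>
      ((\<lambda>A. f' A s) \<longlongrightarrow> g' s) (finite_subsets_at_top UNIV)"
    by (rule has_complex_derivative_uniform_limit[OF _ ul finite_subsets_at_top_neq_bot \<eta>]) (rule that; assumption)
  have hs: "((\<lambda>\<alpha>. of_real (c \<alpha>) * dm \<alpha> i z) has_sum pseries (pderiv_coeff i c) z) UNIV" for i
  proof -
    define \<sigma> where "\<sigma> = (\<lambda>\<alpha>::'n\<Rightarrow>nat. \<alpha>(i := \<alpha> i + 1))"
    have inj: "inj \<sigma>" by (rule injI) (auto simp: \<sigma>_def fun_eq_iff split: if_splits; metis)
    have "(((\<lambda>\<alpha>. of_real (c \<alpha>) * dm \<alpha> i z) \<circ> \<sigma>) has_sum pseries (pderiv_coeff i c) z) UNIV"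
    proof -
      have "of_real (c (\<sigma> \<alpha>)) * dm (\<sigma> \<alpha>) i z = of_real (pderiv_coeff i c \<alpha>) * monom_at \<alpha> z" for \<alpha>
      proof -
        have "monom_at \<alpha> z = (z $ i) ^ \<alpha> i * (\<Prod>j\<in>UNIV - {i}. (z $ j) ^ \<alpha> j)"
          using prod_fun_upd_power[of "\<lambda>j. z $ j" \<alpha> i "\<alpha> i"] by (simp add: monom_at_def)
        moreover have "(\<Prod>j\<in>UNIV - {i}. (z $ j) ^ \<sigma> \<alpha> j) = (\<Prod>j\<in>UNIV - {i}. (z $ j) ^ \<alpha> j)"
          by (intro prod.cong) (auto simp: \<sigma>_def)
        ultimately show ?thesis by (simp add: dm_def pderiv_coeff_def) (simp add: \<sigma>_def)
      qed
      then show ?thesis using pseries_has_sum[OF converges_on_ball_pderiv_coeff[OF c] z, of i] by (simp add: o_def)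
    qed
    then have "((\<lambda>\<alpha>. of_real (c \<alpha>) * dm \<alpha> i z) has_sum pseries (pderiv_coeff i c) z) (range \<sigma>)"
      by (simp add: has_sum_reindex[OF inj])
    \<comment> \<open>Exponents outside the range of \<open>\<sigma>\<close> have
      \<open>\<alpha> i = 0\<close>, and the corresponding monomials have zero derivative.\<close>
    then show ?thesis
    proof (rule has_sum_cong_neutral[THEN iffD1, rotated 3])
      fix \<alpha> assume "\<alpha> \<in> UNIV - range \<sigma>"
      have "\<alpha> i = 0"
      proof (rule ccontr)
        assume "\<alpha> i \<noteq> 0"
        then have "\<sigma> (\<alpha>(i := \<alpha> i - 1)) = \<alpha>" by (auto simp: \<sigma>_def)
        then show False using \<open>\<alpha> \<in> UNIV - range \<sigma>\<close> by (metis DiffD2 rangeI)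
      qed
      then show "of_real (c \<alpha>) * dm \<alpha> i z = 0" by (simp add: dm_def)
    qed auto
  qed
  have "((\<lambda>\<alpha>. \<Sum>i\<in>UNIV. w $ i * (of_real (c \<alpha>) * dm \<alpha> i z)) has_sum
      (\<Sum>i\<in>UNIV. w $ i * pseries (pderiv_coeff i c) z)) UNIV"
    by (intro has_sum_finite_sum has_sum_cmult_right hs)
  then have "((\<lambda>A. f' A 0) \<longlongrightarrow> pseries (dirderiv_coeff v c) z) (finite_subsets_at_top UNIV)"
    unfolding has_sum_def f'_def pseries_dirderiv_coeff[OF c z]
    by (simp add: w_def sum_distrib_left mult_ac)
  moreover have "((\<lambda>A. f' A 0) \<longlongrightarrow> g' 0) (finite_subsets_at_top UNIV)" using g'[of 0] \<eta> by auto
  ultimately have "g' 0 = pseries (dirderiv_coeff v c) z"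
    by (intro tendsto_unique[OF finite_subsets_at_top_neq_bot])
  then show ?thesis using g'[of 0] \<eta> by (simp add: w_def)
qed

lemma pseries_has_field_derivative:
  assumes c: "converges_on_ball c r" and z: "norm (z + s *s cvec v) < r"
  shows "((\<lambda>s. pseries c (z + s *s cvec v)) has_field_derivative pseries (dirderiv_coeff v c) (z + s *s cvec v)) (at s)"
proof -
  have "((\<lambda>h. pseries c ((z + s *s cvec v) + h *s cvec v)) has_field_derivative
      pseries (dirderiv_coeff v c) (z + s *s cvec v)) (at 0)"
    by (rule pseries_has_field_derivative_0[OF c z])
  also have "(\<lambda>h. pseries c ((z + s *s cvec v) + h *s cvec v)) = (\<lambda>h. pseries c (z + (s + h) *s cvec v))"
    by (simp add: vec_eq_iff algebra_simps fun_eq_iff)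
  finally show ?thesis using DERIV_shift[of "\<lambda>s. pseries c (z + s *s cvec v)" _ 0 s] by (simp add: add.commute)
qed

section \<open>Real analytic functions\<close>


definition dirderiv :: "real ^ 'n \<Rightarrow> (real ^ 'n \<Rightarrow> real) \<Rightarrow> real ^ 'n \<Rightarrow> real" where
  "dirderiv v f x = deriv (\<lambda>t. f (x + t *\<^sub>R v)) 0"

lemma real_analytic_on_iff_pseries:
  fixes f :: "real ^ 'n \<Rightarrow> real"
  shows "real_analytic_on f S \<longleftrightarrow>
     (\<forall>p\<in>S. \<exists>r>0. \<exists>c. converges_on_ball c r \<and> (\<forall>x\<in>ball p r. f x = Re (pseries c (cvec (x - p)))))"
proof -
  have "(\<forall>x\<in>ball p r. ((\<lambda>\<alpha>. c \<alpha> * (\<Prod>i\<in>UNIV. (x $ i - p $ i) ^ \<alpha> i)) has_sum f x) UNIV) \<longleftrightarrow>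
     converges_on_ball c r \<and> (\<forall>x\<in>ball p r. f x = Re (pseries c (cvec (x - p))))" (is "?L \<longleftrightarrow> ?R")
    for p :: "real ^ 'n" and r :: real and c :: "('n \<Rightarrow> nat) \<Rightarrow> real"
  proof
    assume L: ?L
    have 1: "((\<lambda>\<alpha>. c \<alpha> * monom_at \<alpha> y) has_sum f (p + y)) UNIV" if "norm y < r" for y
      using bspec[OF L, of "p + y"] that by (simp add: dist_norm monom_at_def)
    then have conv: "converges_on_ball c r" unfolding converges_on_ball_def summable_on_def by fastforce
    show ?R
    proof (intro conjI ballI conv)
      fix x assume "x \<in> ball p r"
      then have n: "norm (x - p) < r" by (simp add: dist_norm norm_minus_commute)
      show "f x = Re (pseries c (cvec (x - p)))"
        using has_sum_unique[OF 1[OF n] pseries_cvec_has_sum[OF conv n]] by simp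
    qed
  next
    assume R: ?R
    show ?L
    proof
      fix x assume x: "x \<in> ball p r"
      then have n: "norm (x - p) < r" by (simp add: dist_norm norm_minus_commute)
      show "((\<lambda>\<alpha>. c \<alpha> * (\<Prod>i\<in>UNIV. (x $ i - p $ i) ^ \<alpha> i)) has_sum f x) UNIV"
        using pseries_cvec_has_sum[OF conjunct1[OF R] n] R x by (simp add: monom_at_def)
    qed
  qed
  then show ?thesis unfolding real_analytic_on_def by simp
qed

lemma pseries_has_real_derivative:
  assumes c: "converges_on_ball c r" and x: "norm (x - p) < r"
    and f: "\<And>x. x \<in> ball p r \<Longrightarrow> f x = Re (pseries c (cvec (x - p)))"
  shows "((\<lambda>t. f (x + t *\<^sub>R v)) has_real_derivative Re (pseries (dirderiv_coeff v c) (cvec (x - p)))) (at 0)"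
proof -
  have "((\<lambda>s. pseries c (cvec (x - p) + s *s cvec v)) has_field_derivative
      pseries (dirderiv_coeff v c) (cvec (x - p))) (at (of_real 0))"
    using pseries_has_field_derivative_0[OF c, of "cvec (x - p)"] x by simp
  from has_field_derivative_Re[OF has_vector_derivative_real_field[OF this]]
  have "((\<lambda>t. Re (pseries c (cvec (x - p) + of_real t *s cvec v))) has_real_derivative
      Re (pseries (dirderiv_coeff v c) (cvec (x - p)))) (at 0)" .
  moreover have "\<forall>\<^sub>F t in nhds 0. Re (pseries c (cvec (x - p) + of_real t *s cvec v)) = f (x + t *\<^sub>R v)"
  proof -
    have "\<forall>\<^sub>F t in nhds 0. x + t *\<^sub>R v \<in> ball p r"
    proof (rule topological_tendstoD)
      show "((\<lambda>t. x + t *\<^sub>R v) \<longlongrightarrow> x + 0 *\<^sub>R v) (nhds 0)" by (intro tendsto_intros filterlim_ident)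
    qed (use x in \<open>auto simp: dist_norm norm_minus_commute\<close>)
    then show ?thesis
      by eventually_elim (simp add: f cvec_add cvec_diff cvec_scale algebra_simps)
  qed
  ultimately show ?thesis by (subst DERIV_cong_ev[OF refl _ refl, symmetric]) 
qed

lemma dirderiv_pseries:
  assumes "converges_on_ball c r" "norm (x - p) < r"
    "\<And>x. x \<in> ball p r \<Longrightarrow> f x = Re (pseries c (cvec (x - p)))"
  shows "dirderiv v f x = Re (pseries (dirderiv_coeff v c) (cvec (x - p)))"
  unfolding dirderiv_def by (rule DERIV_imp_deriv[OF pseries_has_real_derivative[OF assms]])

lemma real_analytic_on_dirderiv:
  assumes "real_analytic_on f S"
  shows "real_analytic_on (dirderiv v f) S"
  unfolding real_analytic_on_iff_pseries
proof
  fix p assume "p \<in> S"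
  then obtain r c where r: "r > 0" and c: "converges_on_ball c r"
    and f: "\<forall>x\<in>ball p r. f x = Re (pseries c (cvec (x - p)))"
    using assms unfolding real_analytic_on_iff_pseries by blast
  have "dirderiv v f x = Re (pseries (dirderiv_coeff v c) (cvec (x - p)))" if "x \<in> ball p r" for x
    using that by (intro dirderiv_pseries[OF c] f[rule_format]) (auto simp: dist_norm norm_minus_commute)
  then show "\<exists>r>0. \<exists>c. converges_on_ball c r \<and> (\<forall>x\<in>ball p r. dirderiv v f x = Re (pseries c (cvec (x - p))))"
    using r converges_on_ball_dirderiv_coeff[OF c] by blast
qed

lemma real_analytic_on_dirderiv_iter:
  "real_analytic_on f S \<Longrightarrow> real_analytic_on ((dirderiv v ^^ j) f) S"
  by (induction j) (auto intro: real_analytic_on_dirderiv)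

lemma real_analytic_on_subset: "real_analytic_on f S \<Longrightarrow> T \<subseteq> S \<Longrightarrow> real_analytic_on f T"
  unfolding real_analytic_on_def by blast

lemma real_analytic_on_has_dirderiv:
  assumes "real_analytic_on f S" "p \<in> S"
  shows "((\<lambda>t. f (p + t *\<^sub>R v)) has_real_derivative dirderiv v f p) (at 0)"
proof -
  obtain r c where r: "r > 0" and c: "converges_on_ball c r"
    and f: "\<forall>x\<in>ball p r. f x = Re (pseries c (cvec (x - p)))"
    using assms unfolding real_analytic_on_iff_pseries by blast
  have "((\<lambda>t. f (p + t *\<^sub>R v)) has_real_derivative Re (pseries (dirderiv_coeff v c) (cvec (p - p)))) (at 0)"
    using r by (intro pseries_has_real_derivative[OF c] f[rule_format]) auto
  then show ?thesis using DERIV_imp_deriv dirderiv_def by metis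
qed

lemma real_analytic_on_isCont:
  assumes "real_analytic_on f S" "p \<in> S"
  shows "isCont f p"
proof -
  obtain r c where r: "r > 0" and c: "converges_on_ball c r"
    and f: "\<forall>x\<in>ball p r. f x = Re (pseries c (cvec (x - p)))"
    using assms unfolding real_analytic_on_iff_pseries by blast
  have "continuous_on (ball p r) (\<lambda>x. Re (pseries c (cvec (x - p))))"
    by (intro continuous_intros continuous_on_compose2[OF continuous_on_pseries[OF c]])
       (auto simp: dist_norm norm_minus_commute)
  then have "continuous_on (ball p r) f" using f by (metis (no_types, lifting) continuous_on_cong)
  then show ?thesis using r by (simp add: continuous_on_eq_continuous_at)
qed

section \<open>From directional to total derivatives\<close>

lemma has_real_derivative_shift_line:
  fixes x v :: "'a::real_vector"
  assumes "((\<lambda>s. f ((x + t *\<^sub>R v) + s *\<^sub>R v)) has_real_derivative D) (at 0)"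
  shows "((\<lambda>t. f (x + t *\<^sub>R v)) has_real_derivative D) (at t)"
  using assms DERIV_shift[of "\<lambda>t. f (x + t *\<^sub>R v)" D 0 t] by (simp add: algebra_simps)

text \<open>\<open>p\<close> is moved to \<open>y\<close> one coordinate at a time, with a mean
  value estimate at each move. Test functions are specified by iterated partial derivatives, so they
  too reach total differentiability this way.\<close>

lemma has_derivative_of_continuous_partials:
  fixes f :: "real ^ 'n \<Rightarrow> real"
  assumes S: "open S" "p \<in> S"
    and f': "\<And>x i. x \<in> S \<Longrightarrow> ((\<lambda>t. f (x + t *\<^sub>R axis i 1)) has_real_derivative f' i x) (at 0)"
    and cont: "\<And>i. isCont (f' i) p"
  shows "(f has_derivative (\<lambda>h. \<Sum>i\<in>UNIV. h $ i * f' i p)) (at p)"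
  unfolding has_derivative_at_alt
proof (intro conjI allI impI)
  show "bounded_linear (\<lambda>h. \<Sum>i\<in>UNIV. h $ i * f' i p)"
    by (intro bounded_linear_sum bounded_linear_mult_const bounded_linear_vec_nth)
next
  fix e :: real assume e: "e > 0"
  \<comment> \<open>There are n moves, each with an error of at most
    \<open>e' * norm h\<close>.\<close>
  define e' where "e' = e / real CARD('n)"
  have e': "e' > 0" using e by (simp add: e'_def)
  have "\<forall>\<^sub>F x in nhds p. \<forall>i. dist (f' i x) (f' i p) < e'"
    using cont e' by (intro eventually_all_finite tendstoD) (auto simp: isCont_def tendsto_at_iff_tendsto_nhds)
  moreover have "\<forall>\<^sub>F x in nhds p. x \<in> S" using S by (simp add: eventually_nhds_in_open)
  ultimately have "\<forall>\<^sub>F x in nhds p. x \<in> S \<and> (\<forall>i. dist (f' i x) (f' i p) < e')" by eventually_elim auto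
  then obtain d where d: "d > 0" "\<And>x. dist x p < d \<Longrightarrow> x \<in> S \<and> (\<forall>i. dist (f' i x) (f' i p) < e')"
    unfolding eventually_nhds_metric by blast
  have "norm (f y - f p - (\<Sum>i\<in>UNIV. (y - p) $ i * f' i p)) \<le> e * norm (y - p)" if y: "norm (y - p) < d" for y
  proof -
    define h where "h = y - p"
    define P where "P = (\<lambda>A. (\<chi> i. if i \<in> A then h $ i else 0) :: real ^ 'n)"
    have claim: "\<bar>f (p + P A) - f p - (\<Sum>i\<in>A. h $ i * f' i p)\<bar> \<le> e' * (\<Sum>i\<in>A. \<bar>h $ i\<bar>)" if "finite A" for A
      using that
    proof (induction A rule: finite_induct)
      case empty
      have "P {} = 0" by (simp add: P_def vec_eq_iff)
      then show ?case by simp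
    next
      case (insert i A)
      have Pi: "P (insert i A) = P A + h $ i *\<^sub>R axis i 1"
        using insert.hyps by (auto simp: P_def vec_eq_iff axis_def)
      define g where "g = (\<lambda>t. f ((p + P A) + t *\<^sub>R axis i 1) - t * f' i p)"
      define g' where "g' = (\<lambda>t. f' i ((p + P A) + t *\<^sub>R axis i 1) - f' i p)"
      have near: "dist ((p + P A) + t *\<^sub>R axis i 1) p < d" if "t \<in> closed_segment 0 (h $ i)" for t
      proof -
        have "norm (P A + t *\<^sub>R axis i 1) \<le> norm h"
        proof (rule norm_le_componentwise_cart)
          fix j
          have "\<bar>t\<bar> \<le> \<bar>h $ i\<bar>" using that by (auto simp: closed_segment_eq_real_ivl split: if_splits)
          then show "norm ((P A + t *\<^sub>R axis i 1) $ j) \<le> norm (h $ j)"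
            using insert.hyps by (auto simp: P_def axis_def)
        qed
        then show ?thesis using y by (simp add: h_def dist_norm add.assoc)
      qed
      have "norm (g (h $ i) - g 0) \<le> e' * norm (h $ i - 0)"
      proof (rule field_differentiable_bound[of "closed_segment 0 (h $ i)" g g'])
        fix t assume t: "t \<in> closed_segment 0 (h $ i)"
        have "((\<lambda>t. f ((p + P A) + t *\<^sub>R axis i 1)) has_real_derivative f' i ((p + P A) + t *\<^sub>R axis i 1)) (at t)"
          by (rule has_real_derivative_shift_line, rule f') (use d(2)[OF near[OF t]] in auto)
        then show "(g has_real_derivative g' t) (at t within closed_segment 0 (h $ i))"
          unfolding g_def g'_def by (auto intro!: derivative_eq_intros intro: has_field_derivative_at_within)
        show "norm (g' t) \<le> e'" using d(2)[OF near[OF t]] by (auto simp: g'_def dist_norm intro: less_imp_le)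
      qed auto
      then have "\<bar>f (p + P (insert i A)) - h $ i * f' i p - f (p + P A)\<bar> \<le> e' * \<bar>h $ i\<bar>"
        by (simp add: g_def Pi add.assoc)
      then have "\<bar>f (p + P (insert i A)) - f p - (h $ i * f' i p + (\<Sum>i\<in>A. h $ i * f' i p))\<bar>
         \<le> e' * \<bar>h $ i\<bar> + e' * (\<Sum>i\<in>A. \<bar>h $ i\<bar>)" using insert.IH by linarith
      then show ?case using insert.hyps by (simp add: algebra_simps)
    qed
    have "P UNIV = h" by (simp add: P_def vec_eq_iff)
    then have "\<bar>f y - f p - (\<Sum>i\<in>UNIV. h $ i * f' i p)\<bar> \<le> e' * (\<Sum>i\<in>UNIV. \<bar>h $ i\<bar>)"
      using claim[of UNIV] by (simp add: h_def)
    also have "\<dots> \<le> e' * (\<Sum>i\<in>(UNIV::'n set). norm h)"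
      using e' by (intro mult_left_mono sum_mono component_le_norm_cart) auto
    also have "\<dots> = e * norm h" by (simp add: e'_def)
    finally show ?thesis by (simp add: h_def)
  qed
  then show "\<exists>d>0. \<forall>y. norm (y - p) < d \<longrightarrow> norm (f y - f p - (\<Sum>i\<in>UNIV. (y - p) $ i * f' i p)) \<le> e * norm (y - p)"
    using d(1) by blast
qed

text \<open>The second part makes \<open>dirderiv v f p\<close> linear in \<open>v\<close>;
  coordinate derivatives can then be recovered from admissible directions.\<close>

lemma real_analytic_on_has_derivative:
  fixes f :: "real ^ 'n \<Rightarrow> real"
  assumes f: "real_analytic_on f S" and S: "open S" "p \<in> S"
  shows "(f has_derivative (\<lambda>h. (\<chi> i. dirderiv (axis i 1) f p) \<bullet> h)) (at p)"
    and "dirderiv v f p = (\<chi> i. dirderiv (axis i 1) f p) \<bullet> v"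
proof -
  have "(f has_derivative (\<lambda>h. \<Sum>i\<in>UNIV. h $ i * dirderiv (axis i 1) f p)) (at p)"
    using real_analytic_on_isCont[OF real_analytic_on_dirderiv[OF f]] S
    by (intro has_derivative_of_continuous_partials[OF S] real_analytic_on_has_dirderiv[OF f]) auto
  then show 1: "(f has_derivative (\<lambda>h. (\<chi> i. dirderiv (axis i 1) f p) \<bullet> h)) (at p)"
    by (simp add: inner_vec_def mult.commute)
  have "((\<lambda>t. f (p + t *\<^sub>R v)) has_derivative (\<lambda>t. (\<chi> i. dirderiv (axis i 1) f p) \<bullet> (t *\<^sub>R v))) (at 0)"
    by (rule has_derivative_compose[of "\<lambda>t. p + t *\<^sub>R v" _ _ _ f, OF _ ])
       (use 1 in \<open>auto intro!: derivative_eq_intros\<close>)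
  then have "((\<lambda>t. f (p + t *\<^sub>R v)) has_real_derivative (\<chi> i. dirderiv (axis i 1) f p) \<bullet> v) (at 0)"
    unfolding has_field_derivative_def by (rule has_derivative_eq_rhs) (simp add: fun_eq_iff mult.commute)
  then show "dirderiv v f p = (\<chi> i. dirderiv (axis i 1) f p) \<bullet> v"
    unfolding dirderiv_def by (rule DERIV_imp_deriv)
qed

lemma smooth_fun_has_derivative:
  fixes \<phi> :: "real ^ 'n \<Rightarrow> real"
  assumes "smooth_fun \<phi>"
  shows "(\<phi> has_derivative (\<lambda>h. \<Sum>i\<in>UNIV. h $ i * partial_deriv i \<phi> x)) (at x)"
proof (rule has_derivative_of_continuous_partials[of UNIV])
  fix x i
  have "(\<lambda>t. iter_partial [] \<phi> (x + t *\<^sub>R axis i 1)) differentiable (at 0)"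
    using assms unfolding smooth_fun_def by blast
  then show "((\<lambda>t. \<phi> (x + t *\<^sub>R axis i 1)) has_real_derivative partial_deriv i \<phi> x) (at 0)"
    unfolding partial_deriv_def by (simp add: DERIV_deriv_iff_real_differentiable)
next
  fix i
  have "continuous_on UNIV (iter_partial [i] \<phi>)" using assms unfolding smooth_fun_def by blast
  then show "isCont (partial_deriv i \<phi>) x" by (simp add: continuous_on_eq_continuous_at)
qed auto

lemma dirderiv_iter_pseries:
  assumes c: "converges_on_ball c r" and f: "\<And>x. x \<in> ball 0 r \<Longrightarrow> f x = Re (pseries c (cvec x))"
  shows "converges_on_ball ((dirderiv_coeff v ^^ j) c) r \<and>
    (\<forall>x\<in>ball 0 r. (dirderiv v ^^ j) f x = Re (pseries ((dirderiv_coeff v ^^ j) c) (cvec x)))"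
proof (induction j)
  case (Suc j)
  then have c': "converges_on_ball ((dirderiv_coeff v ^^ j) c) r" by blast
  show ?case
  proof (intro conjI ballI)
    fix x :: "real ^ 'a" assume "x \<in> ball 0 r"
    then show "(dirderiv v ^^ Suc j) f x = Re (pseries ((dirderiv_coeff v ^^ Suc j) c) (cvec x))"
      using dirderiv_pseries[OF c', of x 0 "(dirderiv v ^^ j) f" v] Suc by simp
  qed (use converges_on_ball_dirderiv_coeff[OF c'] in simp)
qed (use c f in auto)

text \<open>Together with \<open>dirderiv_iter_pseries\<close>, this identifies the Taylor
  coefficients of the holomorphic restriction to a line, up to factorials, with iterated real
  directional derivatives.\<close>

lemma pseries_iter_deriv:
  fixes c :: "('n::finite \<Rightarrow> nat) \<Rightarrow> real"
  assumes c: "converges_on_ball c r" and U: "open U" "\<And>s. s \<in> U \<Longrightarrow> norm (z + s *s cvec v) < r"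
  shows "s \<in> U \<Longrightarrow> (deriv ^^ j) (\<lambda>s. pseries c (z + s *s cvec v)) s =
     pseries ((dirderiv_coeff v ^^ j) c) (z + s *s cvec v)"
proof (induction j arbitrary: s)
  case (Suc j)
  have c': "converges_on_ball ((dirderiv_coeff v ^^ j) c) r"
    using dirderiv_iter_pseries[OF c, of "\<lambda>x. Re (pseries c (cvec x))"] by blast
  have "\<forall>\<^sub>F s in nhds s. (deriv ^^ j) (\<lambda>s. pseries c (z + s *s cvec v)) s = pseries ((dirderiv_coeff v ^^ j) c) (z + s *s cvec v)"
    using eventually_nhds_in_open[OF U(1) Suc.prems] by eventually_elim (rule Suc.IH)
  then have "(deriv ^^ Suc j) (\<lambda>s. pseries c (z + s *s cvec v)) s = deriv (\<lambda>s. pseries ((dirderiv_coeff v ^^ j) c) (z + s *s cvec v)) s"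
    by (simp add: deriv_cong_ev)
  also have "\<dots> = pseries ((dirderiv_coeff v ^^ Suc j) c) (z + s *s cvec v)"
    using DERIV_imp_deriv[OF pseries_has_field_derivative[OF c' U(2)[OF Suc.prems]]] by simp
  finally show ?case .
qed auto

section \<open>Uniform estimates on lines\<close>


text \<open>The direction \<open>v = 0\<close> has to be covered, as it is admissible when
  \<open>f 0 \<noteq> 0\<close>; hence \<open>norm v + 1\<close> in the denominator.\<close>

lemma exists_small_step:
  fixes v :: "'a::real_normed_vector"
  assumes "\<rho> > 0" "\<epsilon> > 0"
  shows "\<exists>a>0. a \<le> \<rho> \<and> a * norm v \<le> \<epsilon>"
proof -
  have v: "norm v + 1 > 0" using norm_ge_zero[of v] by linarith
  define a where "a = min \<rho> (\<epsilon> / (norm v + 1))"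
  have "a * norm v \<le> \<epsilon> / (norm v + 1) * (norm v + 1)"
    using assms v by (intro mult_mono) (auto simp: a_def)
  then show ?thesis using assms v by (intro exI[of _ a]) (auto simp: a_def)
qed

text \<open>The restriction to the line through 0 is not identically zero, so some small circle
  misses its zeros; uniform continuity on a compact ball carries the lower bound over to the
  parallel lines through all complex points \<open>z\<close> near 0.\<close>

lemma uniform_line_bounds:
  fixes \<Phi> :: "complex ^ 'n \<Rightarrow> complex" and v :: "real ^ 'n"
  assumes R: "R > 0" and cont: "continuous_on (ball 0 R) \<Phi>"
    and hol: "(\<lambda>s. \<Phi> (s *s cvec v)) holomorphic_on {s. norm (s *s cvec v) < R}"
    and nz: "norm (s0 *s cvec v) < R" "\<Phi> (s0 *s cvec v) \<noteq> 0" and \<rho>0: "\<rho>0 > 0"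
  shows "\<exists>\<rho> c M \<epsilon>. 0 < \<rho> \<and> \<rho> < \<rho>0 \<and> 0 < c \<and> 0 < \<epsilon> \<and> \<epsilon> + 5 * \<rho> * norm v < R \<and>
     (\<forall>z t. norm z < \<epsilon> \<and> norm t \<le> 4 * \<rho> \<longrightarrow> norm (\<Phi> (z + t *s cvec v)) \<le> M) \<and>
     (\<forall>z t. norm z < \<epsilon> \<and> norm t = \<rho> \<longrightarrow> c \<le> norm (\<Phi> (z + t *s cvec v)))"
proof -
  let ?w = "cvec v"
  define h where "h = (\<lambda>s. \<Phi> (s *s ?w))"
  define S where "S = {s. norm (s *s ?w) < R}"
  have S: "open S" "connected S"
  proof -
    show "open S" unfolding S_def by (intro open_Collect_less continuous_intros)
    have "S = (if v = 0 then UNIV else ball 0 (R / norm v))"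
      using R by (auto simp: S_def norm_vscale field_simps)
    then show "connected S" by (simp add: connected_UNIV)
  qed
  obtain \<rho>1 where \<rho>1: "\<rho>1 > 0" "\<rho>1 \<le> \<rho>0" and "\<rho>1 * norm v \<le> R / 20"
    using exists_small_step[OF \<rho>0, of "R / 20" v] R by auto
  then have \<rho>1v: "5 * \<rho>1 * norm v \<le> R / 4" by simp
  have sub: "cball 0 \<rho>1 \<subseteq> S"
  proof
    fix s :: complex assume "s \<in> cball 0 \<rho>1"
    then have "norm s * norm v \<le> \<rho>1 * norm v" by (intro mult_right_mono) auto
    also have "\<dots> \<le> 5 * \<rho>1 * norm v" using \<rho>1 by simp
    also have "\<dots> < R" using \<rho>1v R by simp
    finally show "s \<in> S" by (simp add: S_def norm_vscale)
  qed
  have fin: "finite {s\<in>cball 0 \<rho>1. h s = 0}"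
  proof (cases "h constant_on S")
    case True
    then obtain y where "\<And>s. s \<in> S \<Longrightarrow> h s = y" by (auto simp: constant_on_def)
    moreover have "s0 \<in> S" "h s0 \<noteq> 0" using nz by (auto simp: S_def h_def)
    ultimately have "{s\<in>cball 0 \<rho>1. h s = 0} = {}" using sub by fastforce
    then show ?thesis by (simp only: finite.emptyI)
  next
    case False
    then show ?thesis using S sub hol
      by (intro holomorphic_compact_finite_zeros[where S = S]) (auto simp: h_def S_def)
  qed
  \<comment> \<open>Finitely many zeros have finitely many moduli, so all but finitely many radii
    are allowed.\<close>
  have "infinite {0<..<\<rho>1}" using \<rho>1 by simp
  then obtain \<rho> where \<rho>: "\<rho> \<in> {0<..<\<rho>1}" "\<rho> \<notin> norm ` {s\<in>cball 0 \<rho>1. h s = 0}"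
    using finite_imageI[OF fin, of norm] by (meson finite_subset subsetI)
  have hnz: "h s \<noteq> 0" if "norm s = \<rho>" for s
    using \<rho> that by (auto simp: image_iff)
  have \<rho>v: "5 * \<rho> * norm v \<le> R / 4"
  proof -
    have "5 * \<rho> * norm v \<le> 5 * \<rho>1 * norm v" using \<rho> by (intro mult_right_mono mult_left_mono) auto
    then show ?thesis using \<rho>1v by simp
  qed
  have tv: "norm (t *s ?w) \<le> R / 4" if "norm t \<le> 4 * \<rho>" for t
  proof -
    have "norm t * norm v \<le> 4 * \<rho> * norm v" using that by (intro mult_right_mono) auto
    also have "\<dots> \<le> 5 * \<rho> * norm v" using \<rho> by (intro mult_right_mono) auto
    finally show ?thesis using \<rho>v by (simp add: norm_vscale)
  qed
  let ?K = "cball (0 :: complex ^ 'n) (3 * R / 4)"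
  have K: "continuous_on ?K \<Phi>" using R by (intro continuous_on_subset[OF cont]) auto
  then have "bounded (\<Phi> ` ?K)" by (intro compact_imp_bounded compact_continuous_image) auto
  then obtain M where "\<forall>z\<in>?K. norm (\<Phi> z) \<le> M" by (auto simp: bounded_iff)
  then have M: "norm (\<Phi> z) \<le> M" if "z \<in> ?K" for z using that by blast
  have uc: "uniformly_continuous_on ?K \<Phi>" using K by (intro compact_uniformly_continuous) auto
  \<comment> \<open>Twice \<open>c\<close>, so that \<open>c\<close> is left after a perturbation
    smaller than \<open>c\<close>.\<close>
  have "\<exists>c>0. \<forall>t. norm t = \<rho> \<longrightarrow> 2 * c \<le> norm (h t)"
  proof -
    have "t *s ?w \<in> ?K" if "t \<in> sphere (0::complex) \<rho>" for t
      using tv[of t] that \<rho>(1) R by auto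
    then have "continuous_on (sphere 0 \<rho>) (\<lambda>t. norm (h t))"
      unfolding h_def by (intro continuous_intros continuous_on_compose2[OF K] image_subsetI)
    moreover have "sphere (0::complex) \<rho> \<noteq> {}" using \<rho> by simp
    ultimately obtain t0 where t0: "t0 \<in> sphere 0 \<rho>" "\<And>t. t \<in> sphere 0 \<rho> \<Longrightarrow> norm (h t0) \<le> norm (h t)"
      using continuous_attains_inf[of "sphere 0 \<rho>" "\<lambda>t. norm (h t)"] by auto
    then show ?thesis using hnz[of t0] by (intro exI[of _ "norm (h t0) / 2"]) auto
  qed
  then obtain c where c: "c > 0" "\<And>t. norm t = \<rho> \<Longrightarrow> 2 * c \<le> norm (h t)" by blast
  obtain d where d: "d > 0" "\<And>z z'. z \<in> ?K \<Longrightarrow> z' \<in> ?K \<Longrightarrow> dist z' z < d \<Longrightarrow> dist (\<Phi> z') (\<Phi> z) < c"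
    using uc c(1) unfolding uniformly_continuous_on_def by metis
  define \<epsilon> where "\<epsilon> = min d (R / 4)"
  have inK: "z + t *s ?w \<in> ?K" if "norm z < \<epsilon>" "norm t \<le> 4 * \<rho>" for z t
    using norm_triangle_ineq[of z "t *s ?w"] tv[OF that(2)] that(1) R by (auto simp: \<epsilon>_def)
  show ?thesis
  proof (intro exI conjI allI impI)
    show "0 < \<rho>" "\<rho> < \<rho>0" "0 < c" "0 < \<epsilon>" "\<epsilon> + 5 * \<rho> * norm v < R"
      using \<rho> \<rho>1 c d R \<rho>v by (auto simp: \<epsilon>_def)
    fix z :: "complex ^ 'n" and t :: complex assume zt: "norm z < \<epsilon> \<and> norm t \<le> 4 * \<rho>"
    then show "norm (\<Phi> (z + t *s ?w)) \<le> M" by (intro M inK) auto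
  next
    fix z :: "complex ^ 'n" and t :: complex assume zt: "norm z < \<epsilon> \<and> norm t = \<rho>"
    have t4: "norm t \<le> 4 * \<rho>" using zt \<rho> by auto
    have z0: "norm (0 :: complex ^ 'n) < \<epsilon>" using d R by (auto simp: \<epsilon>_def)
    have "dist (\<Phi> (z + t *s ?w)) (\<Phi> (0 + t *s ?w)) < c"
      using zt by (intro d(2) inK t4 z0) (auto simp: \<epsilon>_def dist_norm)
    moreover have "2 * c \<le> norm (\<Phi> (0 + t *s ?w))" using c(2)[of t] zt by (simp add: h_def)
    ultimately show "c \<le> norm (\<Phi> (z + t *s ?w))"
      using norm_triangle_ineq2[of "\<Phi> (0 + t *s ?w)" "\<Phi> (z + t *s ?w)"]
      by (simp add: dist_norm norm_minus_commute)
  qed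
qed

text \<open>For a base point outside \<open>ball 0 \<epsilon>\<close> a segment with
  \<open>a * norm v \<le> \<epsilon> / 2\<close> stays off the support of \<open>g\<close>, so the
  average over all base points sees only those where \<open>K\<close> is a bound. \<open>K\<close>
  varies with the base point because it will contain the logarithm of the discriminant
  there.\<close>

lemma nn_integral_finite_by_lines:
  fixes g K :: "real ^ 'n \<Rightarrow> ennreal" and v :: "real ^ 'n"
  assumes [measurable]: "g \<in> borel_measurable borel" and \<rho>: "\<rho> > 0" and \<epsilon>: "\<epsilon> > 0"
    and supp: "\<And>x. norm x \<ge> \<epsilon> / 2 \<Longrightarrow> g x = 0"
    and line: "AE x in lborel. norm x < \<epsilon> \<longrightarrow> (\<integral>\<^sup>+t. g (x + t *\<^sub>R v) * indicator {-\<rho>..\<rho>} t \<partial>lborel) \<le> K x"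
    and K: "(\<integral>\<^sup>+x. K x * indicator (ball 0 \<epsilon>) x \<partial>lborel) < \<infinity>"
  shows "(\<integral>\<^sup>+x. g x \<partial>lborel) < \<infinity>"
proof -
  obtain a where a: "a > 0" "a \<le> \<rho>" and av: "a * norm v \<le> \<epsilon> / 2"
    using exists_small_step[of \<rho> "\<epsilon> / 2" v] \<rho> \<epsilon> by auto
  have "ennreal (2 * a) * (\<integral>\<^sup>+x. g x \<partial>lborel) =
     (\<integral>\<^sup>+x. (\<integral>\<^sup>+t. g (x + t *\<^sub>R v) * indicator {-a..a} t \<partial>lborel) \<partial>lborel)"
    by (rule nn_integral_line_average) (use a in auto)
  also have "\<dots> \<le> (\<integral>\<^sup>+x. K x * indicator (ball 0 \<epsilon>) x \<partial>lborel)"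
  proof (rule nn_integral_mono_AE)
    show "AE x in lborel. (\<integral>\<^sup>+t. g (x + t *\<^sub>R v) * indicator {-a..a} t \<partial>lborel) \<le> K x * indicator (ball 0 \<epsilon>) x"
      using line
    proof eventually_elim
      case (elim x)
      show ?case
      proof (cases "norm x < \<epsilon>")
        case True
        have "(\<integral>\<^sup>+t. g (x + t *\<^sub>R v) * indicator {-a..a} t \<partial>lborel) \<le> (\<integral>\<^sup>+t. g (x + t *\<^sub>R v) * indicator {-\<rho>..\<rho>} t \<partial>lborel)"
          using a by (intro nn_integral_mono) (auto simp: indicator_def)
        then show ?thesis using elim True by auto
      next
        case False
        have "g (x + t *\<^sub>R v) * indicator {-a..a} t = 0" for t
        proof (cases "t \<in> {-a..a}")
          case True
          then have "norm (t *\<^sub>R v) \<le> a * norm v" by (auto intro!: mult_right_mono)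
          then have "norm (x + t *\<^sub>R v) \<ge> \<epsilon> / 2" using False av norm_diff_ineq[of x "t *\<^sub>R v"] by linarith
          then show ?thesis using supp by simp
        qed auto
        then show ?thesis by (simp only: nn_integral_const mult_zero_left zero_le)
      qed
    qed
  qed
  finally have "ennreal (2 * a) * (\<integral>\<^sup>+x. g x \<partial>lborel) < \<infinity>" using K by (rule order_le_less_trans)
  then show ?thesis using a by (auto simp: ennreal_mult_less_top)
qed

lemma borel_measurable_continuous_on_ball_indicator:
  fixes f :: "real ^ 'n \<Rightarrow> 'b::real_normed_vector"
  assumes "continuous_on (ball 0 R) f" "\<epsilon> \<le> R"
  shows "(\<lambda>x. indicator (ball 0 \<epsilon>) x *\<^sub>R f x) \<in> borel_measurable borel"
  by (intro borel_measurable_continuous_on_indicator continuous_on_subset[OF assms(1)]) (use assms(2) in auto)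

lemma borel_measurable_quotient_on_ball:
  fixes f g :: "real ^ 'n \<Rightarrow> real"
  assumes "continuous_on (ball 0 R) f" "continuous_on (ball 0 R) g" "\<epsilon> \<le> R"
  shows "(\<lambda>x. indicator (ball 0 \<epsilon>) x * (g x / f x)) \<in> borel_measurable borel"
proof -
  have [measurable]: "(\<lambda>x. indicator (ball 0 \<epsilon>) x *\<^sub>R f x) \<in> borel_measurable borel"
    "(\<lambda>x. indicator (ball 0 \<epsilon>) x *\<^sub>R g x) \<in> borel_measurable borel"
    by (rule borel_measurable_continuous_on_ball_indicator; fact assms)+
  have "(\<lambda>x. indicator (ball 0 \<epsilon>) x * (g x / f x)) =
      (\<lambda>x. (indicator (ball 0 \<epsilon>) x *\<^sub>R g x) / (indicator (ball 0 \<epsilon>) x *\<^sub>R f x))"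
    by (auto simp: indicator_def fun_eq_iff)
  also have "\<dots> \<in> borel_measurable borel" by measurable
  finally show ?thesis .
qed

lemma borel_measurable_abs_ln_on_ball:
  fixes \<Phi> :: "complex ^ 'n \<Rightarrow> complex"
  assumes cont: "continuous_on (ball 0 R) \<Phi>" and "\<epsilon> \<le> R"
  shows "(\<lambda>x. abs_ln (norm (\<Phi> (cvec x))) * indicator (ball 0 \<epsilon>) x) \<in> borel_measurable borel"
proof -
  have c1: "continuous_on (ball 0 R) (\<lambda>x. \<Phi> (cvec x))"
    by (intro continuous_on_compose2[OF cont] continuous_intros) auto
  have [measurable]: "(\<lambda>x. indicator (ball 0 \<epsilon>) x *\<^sub>R \<Phi> (cvec x)) \<in> borel_measurable borel"
    by (rule borel_measurable_continuous_on_ball_indicator[OF c1 assms(2)])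
  have [measurable]: "ball (0::real^'n) \<epsilon> \<in> sets borel" by simp
  have "(\<lambda>x. abs_ln (norm (\<Phi> (cvec x))) * indicator (ball 0 \<epsilon>) x) =
      (\<lambda>x. abs_ln (norm (indicator (ball 0 \<epsilon>) x *\<^sub>R \<Phi> (cvec x))) * indicator (ball 0 \<epsilon>) x)"
    by (auto simp: indicator_def fun_eq_iff)
  also have "\<dots> \<in> borel_measurable borel" by measurable
  finally show ?thesis .
qed

text \<open>Stated for a continuous \<open>\<Phi>\<close> holomorphic along one direction, since it
  is applied to \<open>disc k\<close> as well as to the power series of \<open>f\<close>, with
  unrelated directions.\<close>

lemma nn_integral_abs_ln_finite:
  fixes \<Phi> :: "complex ^ 'n \<Rightarrow> complex" and v :: "real ^ 'n"
  assumes R: "R > 0" and cont: "continuous_on (ball 0 R) \<Phi>"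
    and hol: "\<And>z. (\<lambda>s. \<Phi> (z + s *s cvec v)) holomorphic_on {s. norm (z + s *s cvec v) < R}"
    and nz: "norm (s0 *s cvec v) < R" "\<Phi> (s0 *s cvec v) \<noteq> 0"
  shows "\<exists>\<epsilon>>0. \<epsilon> < R \<and> (\<integral>\<^sup>+x. abs_ln (norm (\<Phi> (cvec x))) * indicator (ball 0 \<epsilon>) x \<partial>lborel) < \<infinity>"
proof -
  obtain \<rho> c M \<epsilon> where \<rho>: "0 < \<rho>" "\<rho> < 1" and c: "0 < c" and \<epsilon>: "0 < \<epsilon>" "\<epsilon> + 5 * \<rho> * norm v < R"
    and M: "\<And>z t. norm z < \<epsilon> \<and> norm t \<le> 4 * \<rho> \<Longrightarrow> norm (\<Phi> (z + t *s cvec v)) \<le> M"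
    and lo: "\<And>z t. norm z < \<epsilon> \<and> norm t = \<rho> \<Longrightarrow> c \<le> norm (\<Phi> (z + t *s cvec v))"
    using uniform_line_bounds[OF R cont _ nz, of 1] hol[of 0] by auto
  have \<epsilon>R: "\<epsilon> < R" using \<epsilon>(2) mult_nonneg_nonneg[of "5 * \<rho>" "norm v"] \<rho>(1) norm_ge_zero[of v] by linarith
  obtain C where C: "\<And>h. h holomorphic_on ball 0 (5 * \<rho>) \<and> (\<forall>t. norm t \<le> 4 * \<rho> \<longrightarrow> norm (h t) \<le> M) \<and>
      (\<forall>t. norm t = \<rho> \<longrightarrow> c \<le> norm (h t)) \<Longrightarrow>
      (\<integral>\<^sup>+t. abs_ln (norm (h (of_real t))) * indicator {-\<rho>..\<rho>} t \<partial>lborel) \<le> ennreal C"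
    using nn_integral_abs_ln_holomorphic_bound[OF \<rho>(1) c, of M] by blast
  define g where "g = (\<lambda>x. abs_ln (norm (\<Phi> (cvec x))) * indicator (ball 0 (\<epsilon> / 2)) x)"
  have [measurable]: "g \<in> borel_measurable borel"
    unfolding g_def using \<epsilon>(1) \<epsilon>R by (intro borel_measurable_abs_ln_on_ball[OF cont]) auto
  have "(\<integral>\<^sup>+x. g x \<partial>lborel) < \<infinity>"
  proof (rule nn_integral_finite_by_lines[where K = "\<lambda>_. ennreal C" and \<rho> = \<rho> and v = v and \<epsilon> = \<epsilon>])
    show "AE x in lborel. norm x < \<epsilon> \<longrightarrow> (\<integral>\<^sup>+t. g (x + t *\<^sub>R v) * indicator {-\<rho>..\<rho>} t \<partial>lborel) \<le> ennreal C"
    proof (intro AE_I2 impI)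
      fix x :: "real ^ 'n" assume x: "norm x < \<epsilon>"
      have "(\<integral>\<^sup>+t. g (x + t *\<^sub>R v) * indicator {-\<rho>..\<rho>} t \<partial>lborel) \<le>
         (\<integral>\<^sup>+t. abs_ln (norm (\<Phi> (cvec x + of_real t *s cvec v))) * indicator {-\<rho>..\<rho>} t \<partial>lborel)"
        by (intro nn_integral_mono) (auto simp: g_def indicator_def cvec_add cvec_scale)
      also have "\<dots> \<le> ennreal C"
      proof (rule C, intro conjI allI impI)
        show "(\<lambda>t. \<Phi> (cvec x + t *s cvec v)) holomorphic_on ball 0 (5 * \<rho>)"
        proof (rule holomorphic_on_subset[OF hol], safe)
          fix t :: complex assume "t \<in> ball 0 (5 * \<rho>)"
          then have "norm t * norm v \<le> 5 * \<rho> * norm v" by (intro mult_right_mono) auto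
          then show "norm (cvec x + t *s cvec v) < R"
            using norm_triangle_ineq[of "cvec x" "t *s cvec v"] x \<epsilon> by (simp add: norm_vscale)
        qed
      qed (use M lo x in auto)
      finally show "(\<integral>\<^sup>+t. g (x + t *\<^sub>R v) * indicator {-\<rho>..\<rho>} t \<partial>lborel) \<le> ennreal C" .
    qed
    show "(\<integral>\<^sup>+x. ennreal C * indicator (ball 0 \<epsilon>) x \<partial>(lborel :: (real^'n) measure)) < \<infinity>"
      by (subst nn_integral_cmult_indicator) (use emeasure_lborel_ball_finite[of "0::real^'n" \<epsilon>] in \<open>auto simp: ennreal_mult_less_top\<close>)
  qed (fact \<open>g \<in> borel_measurable borel\<close> | use \<rho> \<epsilon> in \<open>auto simp: g_def indicator_def\<close>)+
  then show ?thesis using \<epsilon>(1) \<epsilon>R by (intro exI[of _ "\<epsilon> / 2"]) (auto simp: g_def)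
qed

section \<open>Power sums and the discriminant\<close>


text \<open>A list of terms, with like terms left uncollected, is enough: the expansion is only used
  to substitute power sums for powers, term by term.\<close>

lemma prod_differences_expansion:
  fixes k :: nat
  assumes "finite P" "P \<subseteq> {..<k} \<times> {..<k}"
  shows "\<exists>L :: (complex \<times> (nat \<Rightarrow> nat)) list. \<forall>u :: nat \<Rightarrow> complex.
     (\<Prod>(a, b)\<in>P. u a - u b) = (\<Sum>(d, e)\<leftarrow>L. d * (\<Prod>a<k. u a ^ e a))"
  using assms
proof (induction P rule: finite_induct)
  case empty
  show ?case by (intro exI[of _ "[(1, \<lambda>_. 0)]"]) simp
next
  case (insert p P)
  obtain a b where p: "p = (a, b)" by force
  have ab: "a < k" "b < k" using insert.prems by (auto simp: p)
  obtain L :: "(complex \<times> (nat \<Rightarrow> nat)) list" where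
    L: "\<And>u. (\<Prod>(a, b)\<in>P. u a - u b) = (\<Sum>(d, e)\<leftarrow>L. d * (\<Prod>a<k. u a ^ e a))"
    using insert by blast
  define up where "up = (\<lambda>a (e :: nat \<Rightarrow> nat). e(a := e a + 1))"
  have up: "(\<Prod>i<k. u i ^ up a e i) = u a * (\<Prod>i<k. u i ^ e i)" if "a < k" for u :: "nat \<Rightarrow> complex" and a e
  proof -
    have "(\<Prod>i<k. u i ^ up a e i) = u a ^ up a e a * (\<Prod>i\<in>{..<k} - {a}. u i ^ up a e i)"
      using that by (intro prod.remove) auto
    also have "(\<Prod>i\<in>{..<k} - {a}. u i ^ up a e i) = (\<Prod>i\<in>{..<k} - {a}. u i ^ e i)"
      by (intro prod.cong) (auto simp: up_def)
    also have "u a ^ up a e a * \<dots> = u a * (u a ^ e a * (\<Prod>i\<in>{..<k} - {a}. u i ^ e i))" by (simp add: up_def)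
    also have "u a ^ e a * (\<Prod>i\<in>{..<k} - {a}. u i ^ e i) = (\<Prod>i<k. u i ^ e i)"
      using that by (intro prod.remove[symmetric]) auto
    finally show ?thesis .
  qed
  define L' where "L' = map (\<lambda>(d, e). (d, up a e)) L @ map (\<lambda>(d, e). (- d, up b e)) L"
  have "(\<Prod>(a, b)\<in>insert p P. u a - u b) = (\<Sum>(d, e)\<leftarrow>L'. d * (\<Prod>a<k. u a ^ e a))" for u
  proof -
    have "(\<Sum>(d, e)\<leftarrow>L'. d * (\<Prod>a<k. u a ^ e a)) =
       u a * (\<Sum>(d, e)\<leftarrow>L. d * (\<Prod>a<k. u a ^ e a)) - u b * (\<Sum>(d, e)\<leftarrow>L. d * (\<Prod>a<k. u a ^ e a))"
      by (simp add: L'_def o_def case_prod_unfold up ab sum_list_const_mult[symmetric] sum_list_subtractf[symmetric] mult_ac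
          uminus_sum_list_map[unfolded o_def])
         (simp add: sum_list_addf[symmetric] algebra_simps)
    also have "\<dots> = (u a - u b) * (\<Prod>(a, b)\<in>P. u a - u b)" by (simp add: L left_diff_distrib)
    finally show ?thesis using insert.hyps by (simp add: p)
  qed
  then show ?case by blast
qed

text \<open>
  The coefficients \<open>d\<close> and exponents \<open>e\<close> of the product of the differences \<open>u a - u b\<close>, \<open>a \<noteq> b\<close>; ordered pairs
  are used so that reordering the points does not change the product.
\<close>

definition diff_expansion :: "nat \<Rightarrow> (complex \<times> (nat \<Rightarrow> nat)) list" where
  "diff_expansion k = (SOME L. \<forall>u :: nat \<Rightarrow> complex.
     (\<Prod>(a, b)\<in>{(a, b). a < k \<and> b < k \<and> a \<noteq> b}. u a - u b) = (\<Sum>(d, e)\<leftarrow>L. d * (\<Prod>a<k. u a ^ e a)))"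

lemma diff_expansion:
  "(\<Prod>(a, b)\<in>{(a, b). a < k \<and> b < k \<and> a \<noteq> b}. u a - u b) =
     (\<Sum>(d, e)\<leftarrow>diff_expansion k. d * (\<Prod>a<k. u a ^ e a))"
proof -
  have sub: "{(a, b). a < k \<and> b < k \<and> a \<noteq> b} \<subseteq> {..<k} \<times> {..<k}" by auto
  then have "finite {(a, b). a < k \<and> b < k \<and> a \<noteq> b}" by (rule finite_subset) auto
  from someI_ex[OF prod_differences_expansion[OF this sub]] show ?thesis
    unfolding diff_expansion_def by blast
qed

text \<open>
  \<open>psum j z\<close> is the \<open>j\<close>-th power sum of the zeros \<open>zs z\<close>, counted with multiplicity, written as the contour
  integral that makes its analyticity in \<open>z\<close> visible; substituting power sums for the monomials of
  \<open>diff_expansion k\<close> turns the sum over \<open>k\<close>-tuples of zeros into \<open>disc k z\<close>.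
\<close>

locale line_family =
  fixes c :: "('n::finite \<Rightarrow> nat) \<Rightarrow> real" and r \<rho> m M \<epsilon> :: real and v :: "real ^ 'n"
  assumes conv: "converges_on_ball c r"
    and \<rho>: "0 < \<rho>" "\<rho> \<le> 1/2" and \<epsilon>: "0 < \<epsilon>" "\<epsilon> + 5 * \<rho> * norm v < r" and m: "0 < m"
    and up: "\<And>z t. norm z < \<epsilon> \<Longrightarrow> norm t \<le> 4 * \<rho> \<Longrightarrow> norm (pseries c (z + t *s cvec v)) \<le> M"
    and lo: "\<And>z t. norm z < \<epsilon> \<Longrightarrow> norm t = \<rho> \<Longrightarrow> m \<le> norm (pseries c (z + t *s cvec v))"
begin

abbreviation H :: "complex ^ 'n \<Rightarrow> complex \<Rightarrow> complex" where
  "H z t \<equiv> pseries c (z + t *s cvec v)"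

definition zs :: "complex ^ 'n \<Rightarrow> complex set" where
  "zs z = {t \<in> ball 0 \<rho>. H z t = 0}"

definition circ :: "real \<Rightarrow> complex" where
  "circ \<theta> = of_real \<rho> * exp (2 * of_real pi * \<i> * of_real \<theta>)"

definition psum :: "nat \<Rightarrow> complex ^ 'n \<Rightarrow> complex" where
  "psum j z = integral (cbox 0 1) (\<lambda>\<theta>. circ \<theta> ^ (j + 1) *
     (pseries (dirderiv_coeff v c) (z + circ \<theta> *s cvec v) / H z (circ \<theta>)))"

definition disc :: "nat \<Rightarrow> complex ^ 'n \<Rightarrow> complex" where
  "disc k z = (\<Sum>(d, e)\<leftarrow>diff_expansion k. d * (\<Prod>a<k. psum (e a) z))"

lemma \<epsilon>_less_r: "\<epsilon> < r"
  using \<epsilon> \<rho> norm_ge_zero[of v] mult_nonneg_nonneg[of "5 * \<rho>" "norm v"] by linarith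

lemma in_ball: "norm z < \<epsilon> \<Longrightarrow> norm t \<le> 5 * \<rho> \<Longrightarrow> norm (z + t *s cvec v) < r"
proof -
  assume z: "norm z < \<epsilon>" and "norm t \<le> 5 * \<rho>"
  then have "norm t * norm v \<le> 5 * \<rho> * norm v" by (intro mult_right_mono) auto
  then show ?thesis using norm_triangle_ineq[of z "t *s cvec v"] z \<epsilon> by (simp add: norm_vscale)
qed

lemma H_derivative:
  "norm z < \<epsilon> \<Longrightarrow> norm t \<le> 5 * \<rho> \<Longrightarrow>
    (H z has_field_derivative pseries (dirderiv_coeff v c) (z + t *s cvec v)) (at t)"
  by (intro pseries_has_field_derivative[OF conv] in_ball)

lemma deriv_H:
  "norm z < \<epsilon> \<Longrightarrow> norm t \<le> 5 * \<rho> \<Longrightarrow> deriv (H z) t = pseries (dirderiv_coeff v c) (z + t *s cvec v)"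
  by (intro DERIV_imp_deriv H_derivative)

lemma H_holomorphic: "norm z < \<epsilon> \<Longrightarrow> H z holomorphic_on ball 0 (5 * \<rho>)"
  unfolding holomorphic_on_open[OF open_ball]
  by (intro ballI exI, rule H_derivative) auto

lemma norm_circ [simp]: "norm (circ \<theta>) = \<rho>"
  using \<rho> by (simp add: circ_def norm_mult)

lemma continuous_on_circ [continuous_intros]: "continuous_on S g \<Longrightarrow> continuous_on S (\<lambda>x. circ (g x))"
  unfolding circ_def by (intro continuous_intros)

lemma H_circ_nonzero: "norm z < \<epsilon> \<Longrightarrow> H z (circ \<theta>) \<noteq> 0"
  using lo[of z "circ \<theta>"] m by auto

text \<open>On the circle the line element is \<open>2 * pi * \<i> * circ \<theta>\<close> times the
  element of \<open>\<theta>\<close>; this accounts for the exponent \<open>j + 1\<close> in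
  \<open>psum\<close> and for the factor on the left.\<close>

lemma psum_eq_contour_integral:
  assumes "norm z < \<epsilon>"
  shows "2 * of_real pi * \<i> * psum j z = contour_integral (circlepath 0 \<rho>) (\<lambda>t. t ^ j * (deriv (H z) t / H z t))"
proof -
  have circ: "circlepath 0 \<rho> \<theta> = circ \<theta>" for \<theta> by (simp add: circlepath circ_def)
  have d: "deriv (H z) (circ \<theta>) = pseries (dirderiv_coeff v c) (z + circ \<theta> *s cvec v)" for \<theta>
    using assms \<rho> by (intro deriv_H) auto
  have "contour_integral (circlepath 0 \<rho>) (\<lambda>t. t ^ j * (deriv (H z) t / H z t)) =
     integral {0..1} (\<lambda>\<theta>. 2 * of_real pi * \<i> * (circ \<theta> ^ (j + 1) *
       (pseries (dirderiv_coeff v c) (z + circ \<theta> *s cvec v) / H z (circ \<theta>))))"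
    unfolding contour_integral_integral
  proof (intro integral_cong)
    fix \<theta> :: real
    show "circlepath 0 \<rho> \<theta> ^ j * (deriv (H z) (circlepath 0 \<rho> \<theta>) / H z (circlepath 0 \<rho> \<theta>)) *
        vector_derivative (circlepath 0 \<rho>) (at \<theta>) =
      2 * of_real pi * \<i> * (circ \<theta> ^ (j + 1) *
       (pseries (dirderiv_coeff v c) (z + circ \<theta> *s cvec v) / H z (circ \<theta>)))"
      unfolding circ vector_derivative_circlepath d by (simp add: circ_def mult_ac)
  qed
  also have "\<dots> = 2 * of_real pi * \<i> * psum j z" unfolding psum_def cbox_interval by (rule integral_mult_right)
  finally show ?thesis by (rule sym)
qed

text \<open>\<open>zs z\<close> is a mere set, so multiplicities enter through \<open>n\<close>. One
  \<open>n\<close> must serve all \<open>j\<close>, since products of power sums with different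
  exponents are expanded together.\<close>

lemma zs_multiplicities:
  assumes z: "norm z < \<epsilon>"
  shows "finite (zs z) \<and> (\<exists>n. (\<forall>\<xi>\<in>zs z. n \<xi> \<ge> (1::nat)) \<and> real (\<Sum>\<xi>\<in>zs z. n \<xi>) \<le> ln (M / m) / ln (3/2) \<and>
    (\<forall>j. psum j z = (\<Sum>\<xi>\<in>zs z. of_nat (n \<xi>) * \<xi> ^ j)))"
proof -
  obtain Z n u where Z: "finite Z" "Z = {t \<in> ball 0 \<rho>. H z t = 0}" and u: "u holomorphic_on ball 0 (5 * \<rho>)"
    and hu: "\<And>t. t \<in> ball 0 (5 * \<rho>) \<Longrightarrow> H z t = u t * (\<Prod>\<xi>\<in>Z. ((t - \<xi>) / (2 * \<rho>)) ^ n \<xi>)"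
    and n: "\<And>\<xi>. \<xi> \<in> Z \<Longrightarrow> n \<xi> \<ge> (1::nat)"
    and lou: "\<And>t. norm t \<le> \<rho> \<Longrightarrow> m \<le> norm (u t)" and N: "real (\<Sum>\<xi>\<in>Z. n \<xi>) \<le> ln (M / m) / ln (3/2)"
    by (rule bounded_factorization[OF \<rho>(1) H_holomorphic[OF z] up[OF z] m lo[OF z]]) (assumption, assumption, (rule that; assumption))
  have "psum j z = (\<Sum>\<xi>\<in>Z. of_nat (n \<xi>) * \<xi> ^ j)" for j
  proof -
    have "((\<lambda>t. t ^ j * (deriv (H z) t / H z t)) has_contour_integral
           (2 * of_real pi * \<i> * (\<Sum>\<xi>\<in>Z. of_nat (n \<xi>) * \<xi> ^ j))) (circlepath 0 \<rho>)"
    proof (rule power_sum_contour_integral[where R = "5 * \<rho>" and u = u and a = "2 * \<rho>"])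
      show "u t \<noteq> 0" if "norm t \<le> \<rho>" for t using lou[OF that] m by auto
      show "Z \<subseteq> ball 0 \<rho>" unfolding Z(2) by blast
    qed (use \<rho> u Z(1) hu in auto)
    from contour_integral_unique[OF this] psum_eq_contour_integral[OF z, of j]
    have "2 * of_real pi * \<i> * psum j z = 2 * of_real pi * \<i> * (\<Sum>\<xi>\<in>Z. of_nat (n \<xi>) * \<xi> ^ j)" by simp
    then show ?thesis by simp
  qed
  then show ?thesis using Z n N unfolding zs_def by blast
qed

lemma continuous_on_H_circ:
  assumes c': "converges_on_ball c' r"
  shows "continuous_on (ball 0 \<epsilon> \<times> T) (\<lambda>p. pseries c' (fst p + circ (snd p) *s cvec v))"
  using \<rho> by (intro continuous_on_compose2[OF continuous_on_pseries[OF c']] continuous_intros)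
    (auto simp: image_subset_iff intro!: in_ball)

lemma continuous_on_psum: "continuous_on (ball 0 \<epsilon>) (psum j)"
  unfolding psum_def
proof (rule integral_continuous_on_param)
  show "continuous_on (ball 0 \<epsilon> \<times> cbox 0 1) (\<lambda>(z, \<theta>). circ \<theta> ^ (j + 1) *
     (pseries (dirderiv_coeff v c) (z + circ \<theta> *s cvec v) / H z (circ \<theta>)))"
    unfolding case_prod_unfold using H_circ_nonzero
    by (intro continuous_intros continuous_on_H_circ conv converges_on_ball_dirderiv_coeff) auto
qed

text \<open>Differentiation under the integral sign, the denominator being nonzero on the circle.
  The direction \<open>w\<close> is arbitrary, because the discriminant is later restricted to the
  line through a point where it is nonzero, which need not have direction \<open>v\<close>.\<close>

lemma psum_holomorphic: "(\<lambda>s. psum j (z + s *s cvec w)) holomorphic_on {s. norm (z + s *s cvec w) < \<epsilon>}"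
proof -
  let ?U = "{s. norm (z + s *s cvec w) < \<epsilon>}"
  let ?A = "dirderiv_coeff v c" and ?H' = "dirderiv_coeff w c" and ?A' = "dirderiv_coeff w (dirderiv_coeff v c)"
  have cA: "converges_on_ball ?A r" "converges_on_ball ?H' r" "converges_on_ball ?A' r"
    by (intro converges_on_ball_dirderiv_coeff conv)+
  let ?f = "\<lambda>s \<theta>. circ \<theta> ^ (j + 1) * (pseries ?A ((z + s *s cvec w) + circ \<theta> *s cvec v) / H (z + s *s cvec w) (circ \<theta>))"
  let ?fx = "\<lambda>s \<theta>. circ \<theta> ^ (j + 1) * ((pseries ?A' ((z + s *s cvec w) + circ \<theta> *s cvec v) * H (z + s *s cvec w) (circ \<theta>) -
       pseries ?A ((z + s *s cvec w) + circ \<theta> *s cvec v) * pseries ?H' ((z + s *s cvec w) + circ \<theta> *s cvec v)) /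
       (H (z + s *s cvec w) (circ \<theta>) * H (z + s *s cvec w) (circ \<theta>)))"
  have contU: "continuous_on (?U \<times> T) (\<lambda>p. pseries c' ((z + fst p *s cvec w) + circ (snd p) *s cvec v))"
    if "converges_on_ball c' r" for c' and T :: "real set"
    using continuous_on_compose2[OF continuous_on_H_circ[OF that, of T],
        of "?U \<times> T" "\<lambda>p. (z + fst p *s cvec w, snd p)"]
    by (simp add: image_subset_iff continuous_intros case_prod_unfold mem_Times_iff)
  show ?thesis unfolding psum_def
  proof (rule leibniz_rule_holomorphic[where fx = ?fx])
    fix s \<theta> assume s: "s \<in> ?U"
    have comm: "(z + s *s cvec w) + circ \<theta> *s cvec v = (z + circ \<theta> *s cvec v) + s *s cvec w" for s
      by (simp add: algebra_simps)
    have nb: "norm ((z + circ \<theta> *s cvec v) + s *s cvec w) < r"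
      using in_ball[of "z + s *s cvec w" "circ \<theta>"] s \<rho> by (simp add: comm)
    show "((\<lambda>s. ?f s \<theta>) has_field_derivative ?fx s \<theta>) (at s within ?U)"
      unfolding comm
      using H_circ_nonzero[of "z + s *s cvec w" \<theta>] s
      by (intro has_field_derivative_at_within[OF DERIV_cmult] DERIV_divide
          pseries_has_field_derivative[OF _ nb] conv cA) (simp add: comm)
  next
    fix s assume s: "s \<in> ?U"
    have 1: "continuous_on (cbox 0 1) (\<lambda>\<theta>. pseries c' ((z + s *s cvec w) + circ \<theta> *s cvec v))"
      if "converges_on_ball c' r" for c'
      using continuous_on_compose2[OF contU[OF that, of "cbox 0 1"], of "cbox 0 1" "\<lambda>\<theta>. (s, \<theta>)"] s
      by (simp add: image_subset_iff continuous_intros)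
    show "?f s integrable_on cbox 0 1"
      using s H_circ_nonzero[of "z + s *s cvec w"]
      by (intro integrable_continuous continuous_intros 1 conv cA) auto
  next
    show "continuous_on (?U \<times> cbox 0 1) (\<lambda>(s, \<theta>). ?fx s \<theta>)"
      unfolding case_prod_unfold
      using H_circ_nonzero by (intro continuous_intros contU conv cA) auto
  next
    have "convex ((\<lambda>s. z + s *s cvec w) -` ball 0 \<epsilon>)"
    proof -
      have "linear (\<lambda>s. s *s cvec w)"
        by (rule linearI) (auto simp: vec_eq_iff algebra_simps)
      then have "convex ((\<lambda>s. s *s cvec w) -` ((\<lambda>x. - z + x) ` ball 0 \<epsilon>))"
        by (intro convex_linear_vimage convex_translation convex_ball)
      also have "(\<lambda>s. s *s cvec w) -` ((\<lambda>x. - z + x) ` ball 0 \<epsilon>) = (\<lambda>s. z + s *s cvec w) -` ball 0 \<epsilon>"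
        by (auto simp: image_iff algebra_simps intro!: bexI[of _ "z + _ *s cvec w"])
      finally show ?thesis .
    qed
    then show "convex ?U" by (simp add: vimage_def)
  qed
qed

lemma continuous_on_disc: "continuous_on (ball 0 \<epsilon>) (disc k)"
proof -
  have "continuous_on (ball 0 \<epsilon>) (\<lambda>z. \<Sum>(d, e)\<leftarrow>L. d * (\<Prod>a<k. psum (e a) z))" for L
    by (induction L) (auto simp: case_prod_unfold intro!: continuous_intros continuous_on_psum)
  then show ?thesis unfolding disc_def .
qed

lemma disc_holomorphic: "(\<lambda>s. disc k (z + s *s cvec w)) holomorphic_on {s. norm (z + s *s cvec w) < \<epsilon>}"
proof -
  have "(\<lambda>s. \<Sum>(d, e)\<leftarrow>L. d * (\<Prod>a<k. psum (e a) (z + s *s cvec w))) holomorphic_on {s. norm (z + s *s cvec w) < \<epsilon>}" for L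
    by (induction L) (auto simp: case_prod_unfold intro!: holomorphic_intros psum_holomorphic)
  then show ?thesis unfolding disc_def .
qed

text \<open>Choosing one zero from each of the \<open>k\<close> power sums turns a product of sums
  into a sum over tuples; summing over the terms of \<open>diff_expansion k\<close> then reassembles
  the product of differences for each tuple.\<close>

lemma disc_eq_sum_tuples:
  assumes fin: "finite (zs z)" and n: "\<And>j. psum j z = (\<Sum>\<xi>\<in>zs z. of_nat (n \<xi>) * \<xi> ^ j)"
  shows "disc k z = (\<Sum>j\<in>PiE {..<k} (\<lambda>_. zs z). (\<Prod>a<k. of_nat (n (j a))) *
     (\<Prod>(a, b)\<in>{(a, b). a < k \<and> b < k \<and> a \<noteq> b}. j a - j b))"
proof -
  have "(\<Sum>(d, e)\<leftarrow>L. d * (\<Prod>a<k. psum (e a) z)) =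
     (\<Sum>j\<in>PiE {..<k} (\<lambda>_. zs z). (\<Prod>a<k. of_nat (n (j a))) * (\<Sum>(d, e)\<leftarrow>L. d * (\<Prod>a<k. j a ^ e a)))" for L
  proof (induction L)
    case (Cons de L)
    obtain d e where de: "de = (d, e)" by force
    have "(\<Prod>a<k. psum (e a) z) = (\<Sum>j\<in>PiE {..<k} (\<lambda>_. zs z). \<Prod>a<k. of_nat (n (j a)) * j a ^ e a)"
      unfolding n by (rule prod_sum_PiE) (use fin in auto)
    then have "d * (\<Prod>a<k. psum (e a) z) =
       (\<Sum>j\<in>PiE {..<k} (\<lambda>_. zs z). (\<Prod>a<k. of_nat (n (j a))) * (d * (\<Prod>a<k. j a ^ e a)))"
      by (simp add: sum_distrib_left prod.distrib mult_ac)
    then show ?case using Cons by (simp add: de distrib_left sum.distrib)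
  qed simp
  then show ?thesis unfolding disc_def diff_expansion .
qed

text \<open>Up to sign, the discriminant of the monic polynomial with simple roots
  \<open>zs z\<close>.\<close>

definition vander :: "complex ^ 'n \<Rightarrow> complex" where
  "vander z = (\<Prod>(p, q)\<in>{(p, q). p \<in> zs z \<and> q \<in> zs z \<and> p \<noteq> q}. p - q)"

text \<open>At most \<open>k ^ k\<close> tuples, each of weight at most the \<open>k\<close>-th
  power of the number of zeros with multiplicity.\<close>

definition disc_const :: "nat \<Rightarrow> real" where
  "disc_const k = (real k * (ln (M / m) / ln (3/2))) ^ k"

text \<open>Tuples with a repeated entry contribute 0. An injective tuple exhausts
  \<open>zs z\<close>, as there are at most \<open>k\<close> zeros, and reindexing by it gives
  \<open>vander z\<close>. Its weight is a product of positive multiplicities, so \<open>K\<close>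
  is positive as soon as one such tuple exists.\<close>

lemma disc_value:
  assumes z: "norm z < \<epsilon>" and card: "card (zs z) \<le> k"
  shows "\<exists>K::nat. disc k z = of_nat K * vander z \<and> (K > 0 \<longleftrightarrow> card (zs z) = k) \<and> real K \<le> disc_const k"
proof -
  obtain n where fin: "finite (zs z)" and n1: "\<forall>\<xi>\<in>zs z. n \<xi> \<ge> (1::nat)"
    and N: "real (\<Sum>\<xi>\<in>zs z. n \<xi>) \<le> ln (M / m) / ln (3/2)"
    and n: "\<forall>j. psum j z = (\<Sum>\<xi>\<in>zs z. of_nat (n \<xi>) * \<xi> ^ j)"
    using zs_multiplicities[OF z] by blast
  let ?P = "{(a, b). a < k \<and> b < k \<and> a \<noteq> b}" and ?T = "PiE {..<k} (\<lambda>_. zs z)"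
  let ?I = "{j \<in> ?T. inj_on j {..<k}}"
  have finT: "finite ?T" using fin by (intro finite_PiE) auto
  have finP: "finite ?P" by (rule finite_subset[of _ "{..<k} \<times> {..<k}"]) auto
  define K where "K = (\<Sum>j\<in>?I. \<Prod>a<k. n (j a))"
  have im: "j ` {..<k} = zs z \<and> card (zs z) = k" if "j \<in> ?I" for j
  proof -
    have "card (j ` {..<k}) = k" using that by (simp add: card_image)
    moreover have "j ` {..<k} \<subseteq> zs z" using that by (auto simp: PiE_def Pi_def)
    ultimately show ?thesis using card_subset_eq[OF fin] card card_mono[OF fin] by (metis le_antisym)
  qed
  have "disc k z = (\<Sum>j\<in>?T. (\<Prod>a<k. of_nat (n (j a))) * (\<Prod>(a, b)\<in>?P. j a - j b))"
    using n by (intro disc_eq_sum_tuples[OF fin]) auto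
  also have "\<dots> = (\<Sum>j\<in>?I. (\<Prod>a<k. of_nat (n (j a))) * (\<Prod>(a, b)\<in>?P. j a - j b))"
  proof (rule sum.mono_neutral_right[OF finT])
    show "\<forall>j\<in>?T - ?I. (\<Prod>a<k. of_nat (n (j a))) * (\<Prod>(a, b)\<in>?P. j a - j b) = 0"
    proof
      fix j assume "j \<in> ?T - ?I"
      then obtain a b where "a < k" "b < k" "a \<noteq> b" "j a = j b" by (auto simp: inj_on_def)
      then have "\<exists>p\<in>?P. (case p of (a, b) \<Rightarrow> j a - j b) = 0" by (intro bexI[of _ "(a, b)"]) auto
      then have "(\<Prod>(a, b)\<in>?P. j a - j b) = 0" using finP by (simp add: prod_zero_iff)
      then show "(\<Prod>a<k. of_nat (n (j a))) * (\<Prod>(a, b)\<in>?P. j a - j b) = 0" by simp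
    qed
  qed auto
  also have "\<dots> = (\<Sum>j\<in>?I. (\<Prod>a<k. of_nat (n (j a))) * vander z)"
  proof (intro sum.cong refl)
    fix j assume j: "j \<in> ?I"
    have "bij_betw (map_prod j j) ?P {(p, q). p \<in> zs z \<and> q \<in> zs z \<and> p \<noteq> q}"
      unfolding bij_betw_def
    proof
      show "inj_on (map_prod j j) ?P" using j by (auto simp: inj_on_def)
      show "map_prod j j ` ?P = {(p, q). p \<in> zs z \<and> q \<in> zs z \<and> p \<noteq> q}"
      proof (intro equalityI subsetI)
        fix x assume "x \<in> map_prod j j ` ?P"
        then obtain a b where ab: "a < k" "b < k" "a \<noteq> b" "x = (j a, j b)" by auto
        then show "x \<in> {(p, q). p \<in> zs z \<and> q \<in> zs z \<and> p \<noteq> q}"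
          using im[OF j] j by (auto simp: inj_on_def)
      next
        fix x assume "x \<in> {(p, q). p \<in> zs z \<and> q \<in> zs z \<and> p \<noteq> q}"
        then obtain p q where pq: "p \<in> j ` {..<k}" "q \<in> j ` {..<k}" "p \<noteq> q" "x = (p, q)" using im[OF j] by auto
        then show "x \<in> map_prod j j ` ?P" by (auto simp: image_iff)
      qed
    qed
    from prod.reindex_bij_betw[OF this, of "\<lambda>(p, q). p - q"]
    have "(\<Prod>(a, b)\<in>?P. j a - j b) = vander z" unfolding vander_def by (simp add: case_prod_unfold)
    then show "(\<Prod>a<k. of_nat (n (j a))) * (\<Prod>(a, b)\<in>?P. j a - j b) = (\<Prod>a<k. of_nat (n (j a))) * vander z" by simp
  qed
  also have "\<dots> = of_nat K * vander z" by (simp add: K_def sum_distrib_right)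
  finally have D: "disc k z = of_nat K * vander z" .
  have Kpos: "K > 0 \<longleftrightarrow> card (zs z) = k"
  proof
    assume "K > 0"
    then have "?I \<noteq> {}" unfolding K_def by (metis (no_types, lifting) sum.empty less_irrefl)
    then show "card (zs z) = k" using im by blast
  next
    assume ck: "card (zs z) = k"
    obtain j where j: "bij_betw j {..<k} (zs z)" using ex_bij_betw_nat_finite[OF fin] ck by (auto simp: atLeast0LessThan)
    define j' where "j' = restrict j {..<k}"
    have "j' \<in> ?I" using j by (auto simp: j'_def bij_betw_def inj_on_def)
    moreover have "(\<Prod>a<k. n (j' a)) > 0"
    proof (intro prod_pos)
      fix a assume "a \<in> {..<k}"
      then have "j' a \<in> zs z" using j by (auto simp: j'_def bij_betw_def)
      then show "0 < n (j' a)" using n1 by fastforce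
    qed
    ultimately show "K > 0" unfolding K_def using finT by (intro sum_pos2[of _ j']) auto
  qed
  have Kle: "real K \<le> disc_const k"
  proof (cases "K > 0")
    case False
    have "ln (M / m) / ln (3/2) \<ge> 0" by (rule order_trans[OF of_nat_0_le_iff N])
    then have "disc_const k \<ge> 0" unfolding disc_const_def by (intro zero_le_power mult_nonneg_nonneg) auto
    then show ?thesis using False by simp
  next
    case True
    then have ck: "card (zs z) = k" using Kpos by simp
    define NN where "NN = (\<Sum>\<xi>\<in>zs z. n \<xi>)"
    have nle: "n \<xi> \<le> NN" if "\<xi> \<in> zs z" for \<xi> unfolding NN_def using fin that by (intro member_le_sum) auto
    have "K \<le> (\<Sum>j\<in>?I. NN ^ k)" unfolding K_def
    proof (intro sum_mono)
      fix j assume "j \<in> ?I"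
      then have "(\<Prod>a<k. n (j a)) \<le> (\<Prod>a<k. NN)" by (intro prod_mono) (auto intro!: nle)
      then show "(\<Prod>a<k. n (j a)) \<le> NN ^ k" by simp
    qed
    also have "\<dots> \<le> card ?T * NN ^ k" using finT by (auto intro!: card_mono mult_right_mono)
    also have "card ?T = k ^ k" by (simp add: card_PiE ck)
    finally have "real K \<le> real (k ^ k * NN ^ k)" by (simp only: of_nat_le_iff)
    also have "\<dots> = (real k * real NN) ^ k" by (simp add: power_mult_distrib)
    also have "\<dots> \<le> disc_const k" unfolding disc_const_def
      using N by (intro power_mono mult_left_mono) (auto simp: NN_def intro!: mult_nonneg_nonneg sum_nonneg)
    finally show ?thesis .
  qed
  show ?thesis using D Kpos Kle by blast
qed

lemma vander_nonzero: "finite (zs z) \<Longrightarrow> vander z \<noteq> 0"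
proof -
  assume f: "finite (zs z)"
  have "finite {(p, q). p \<in> zs z \<and> q \<in> zs z \<and> p \<noteq> q}"
    by (rule finite_subset[of _ "zs z \<times> zs z"]) (use f in auto)
  then show ?thesis unfolding vander_def by auto
qed

lemma disc_nonzero_iff:
  assumes z: "norm z < \<epsilon>" and card: "card (zs z) \<le> k"
  shows "disc k z \<noteq> 0 \<longleftrightarrow> card (zs z) = k"
proof -
  obtain K :: nat where "disc k z = of_nat K * vander z" "K > 0 \<longleftrightarrow> card (zs z) = k"
    using disc_value[OF assms] by blast
  moreover have "vander z \<noteq> 0" using zs_multiplicities[OF z] by (intro vander_nonzero) blast
  ultimately show ?thesis by simp
qed

text \<open>Points of the disc are at most \<open>2 * \<rho> \<le> 1\<close> apart, so all other
  factors of \<open>vander z\<close> may be dropped; the restriction on \<open>\<rho>\<close> serves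
  this purpose here.\<close>

lemma disc_le_dist:
  assumes z: "norm z < \<epsilon>" and card: "card (zs z) \<le> k" and pq: "p \<in> zs z" "q \<in> zs z" "p \<noteq> q"
  shows "norm (disc k z) \<le> disc_const k * norm (p - q)"
proof -
  have fin: "finite (zs z)" using zs_multiplicities[OF z] by blast
  let ?Q = "{(p, q). p \<in> zs z \<and> q \<in> zs z \<and> p \<noteq> q}"
  have fQ: "finite ?Q" by (rule finite_subset[of _ "zs z \<times> zs z"]) (use fin in auto)
  have "vander z = (p - q) * (\<Prod>(p, q)\<in>?Q - {(p, q)}. p - q)"
    unfolding vander_def using pq fQ by (subst prod.remove[of _ "(p, q)"]) auto
  moreover have "norm (\<Prod>(p, q)\<in>?Q - {(p, q)}. p - q) \<le> 1"
    unfolding prod_norm[symmetric]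
  proof (intro prod_le_1 conjI)
    fix x assume "x \<in> ?Q - {(p, q)}"
    then obtain a b where ab: "x = (a, b)" "norm a < \<rho>" "norm b < \<rho>" by (auto simp: zs_def)
    then show "norm (case x of (p, q) \<Rightarrow> p - q) \<le> 1" using norm_triangle_ineq4[of a b] \<rho> by simp
  qed auto
  ultimately have v: "norm (vander z) \<le> norm (p - q)"
    by (simp add: norm_mult mult_left_le)
  obtain K :: nat where K: "disc k z = of_nat K * vander z" "real K \<le> disc_const k"
    using disc_value[OF z card] by blast
  have "norm (disc k z) = real K * norm (vander z)" by (simp add: K(1) norm_mult)
  also have "\<dots> \<le> disc_const k * norm (p - q)" using K(2) v by (intro mult_mono) auto
  finally show ?thesis .
qed

end

section \<open>Absence of real zeros on generic lines\<close>


text \<open>A nonzero derivative along \<open>v\<close> forces a nonzero gradient, which is the rank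
  condition for a single equation.\<close>

lemma smooth_point_regular_hypersurface:
  fixes g :: "real ^ 'n \<Rightarrow> real"
  assumes V: "open V" "q \<in> V" and g: "real_analytic_on g V" "\<And>x. x \<in> V \<Longrightarrow> dirderiv v g x \<noteq> 0"
    and X: "\<And>x. x \<in> V \<Longrightarrow> x \<in> X \<longleftrightarrow> g x = 0" and q: "q \<in> X"
  shows "smooth_point X q (CARD('n) - 1)"
proof -
  have one: "CARD('n) - (CARD('n) - 1) = 1"
    using zero_less_card_finite[where 'a='n] by linarith
  have "analytic_submanifold (V \<inter> X) V (CARD('n) - 1)"
    unfolding analytic_submanifold_def one
  proof (intro conjI ballI)
    fix q' assume q': "q' \<in> V \<inter> X"
    show "\<exists>V'. open V' \<and> q' \<in> V' \<and> V' \<subseteq> V \<and>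
        (\<exists>g :: nat \<Rightarrow> real^'n \<Rightarrow> real.
           (\<forall>j < 1. real_analytic_on (g j) V') \<and>
           (\<forall>x\<in>V'. \<exists>D :: nat \<Rightarrow> real^'n.
               (\<forall>j < 1. (g j has_derivative (\<lambda>h. D j \<bullet> h)) (at x)) \<and>
               (\<forall>a :: nat \<Rightarrow> real. (\<Sum>j < 1. a j *\<^sub>R D j) = 0 \<longrightarrow> (\<forall>j < 1. a j = 0))) \<and>
           V \<inter> X \<inter> V' = {x\<in>V'. \<forall>j < 1. g j x = 0})"
    proof (intro exI[of _ V] exI[of _ "\<lambda>_. g"] conjI ballI)
      fix x assume x: "x \<in> V"
      define G where "G = (\<chi> i. dirderiv (axis i 1) g x)"
      have "(g has_derivative (\<lambda>h. G \<bullet> h)) (at x)" "dirderiv v g x = G \<bullet> v"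
        unfolding G_def by (intro real_analytic_on_has_derivative[OF g(1) V(1) x])+
      moreover have "G \<noteq> 0" using g(2)[OF x] calculation(2) by auto
      ultimately show "\<exists>D :: nat \<Rightarrow> real^'n. (\<forall>j < (1::nat). (g has_derivative (\<lambda>h. D j \<bullet> h)) (at x)) \<and>
         (\<forall>a :: nat \<Rightarrow> real. (\<Sum>j < 1. a j *\<^sub>R D j) = 0 \<longrightarrow> (\<forall>j < 1. a j = 0))"
        by (intro exI[of _ "\<lambda>_. G"]) auto
    qed (use V q' g X in auto)
  qed auto
  then show ?thesis unfolding smooth_point_def using V q by auto
qed

context line_family
begin

section \<open>Zeros under perturbation of the base point\<close>

lemma H_uniformly_close:
  assumes e: "e > 0"
  shows "\<exists>\<eta>>0. \<forall>z z0 t. norm z < \<epsilon> \<and> norm z0 < \<epsilon> \<and> dist z z0 < \<eta> \<and> norm t \<le> 5 * \<rho> \<longrightarrow> dist (H z t) (H z0 t) < e"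
proof -
  let ?K = "cball (0 :: complex ^ 'n) (\<epsilon> + 5 * \<rho> * norm v)"
  have "uniformly_continuous_on ?K (pseries c)"
    using \<epsilon> by (intro compact_uniformly_continuous continuous_on_subset[OF continuous_on_pseries[OF conv]]) auto
  then obtain \<eta> where \<eta>: "\<eta> > 0" "\<forall>x\<in>?K. \<forall>x'\<in>?K. dist x' x < \<eta> \<longrightarrow> dist (pseries c x') (pseries c x) < e"
    using e unfolding uniformly_continuous_on_def by meson
  have K: "z + t *s cvec v \<in> ?K" if "norm z < \<epsilon>" "norm t \<le> 5 * \<rho>" for z :: "complex ^ 'n" and t
  proof -
    have "norm t * norm v \<le> 5 * \<rho> * norm v" using that by (intro mult_right_mono) auto
    then show ?thesis using norm_triangle_ineq[of z "t *s cvec v"] that by (simp add: norm_vscale)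
  qed
  show ?thesis using \<eta> K by (intro exI[of _ \<eta>]) auto
qed

text \<open>The half of Hurwitz's theorem that gives existence of a nearby zero; the count is
  supplied afterwards by the bound \<open>k\<close> on the number of zeros.\<close>

lemma zero_persists:
  assumes z0: "norm z0 < \<epsilon>" and \<xi>: "\<xi> \<in> zs z0" and d: "d > 0"
    and isol: "\<And>t. t \<noteq> \<xi> \<Longrightarrow> norm (t - \<xi>) \<le> d \<Longrightarrow> norm t < \<rho> \<and> H z0 t \<noteq> 0"
  shows "\<exists>\<eta>>0. \<forall>z. norm z < \<epsilon> \<and> dist z z0 < \<eta> \<longrightarrow> (\<exists>t\<in>zs z. norm (t - \<xi>) < d)"
proof -
  have \<xi>0: "norm \<xi> < \<rho>" "H z0 \<xi> = 0" using \<xi> by (auto simp: zs_def)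
  have in\<rho>: "norm t < \<rho>" if "norm (t - \<xi>) \<le> d" for t using isol[OF _ that] \<xi>0 by (cases "t = \<xi>") auto
  have sub: "cball \<xi> d \<subseteq> ball 0 (5 * \<rho>)"
    using in\<rho> \<rho> by (fastforce simp: dist_norm norm_minus_commute)
  have "continuous_on (sphere \<xi> d) (\<lambda>t. norm (H z0 t))"
    using sub by (intro continuous_on_norm continuous_on_subset[OF holomorphic_on_imp_continuous_on[OF H_holomorphic[OF z0]]]) auto
  moreover have "sphere \<xi> d \<noteq> {}" using d by simp
  ultimately obtain t0 where t0: "t0 \<in> sphere \<xi> d" "\<And>t. t \<in> sphere \<xi> d \<Longrightarrow> norm (H z0 t0) \<le> norm (H z0 t)"
    using continuous_attains_inf[of "sphere \<xi> d" "\<lambda>t. norm (H z0 t)"] by auto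
  define \<mu> where "\<mu> = norm (H z0 t0)"
  have "t0 \<noteq> \<xi>" "norm (t0 - \<xi>) \<le> d" using t0(1) d by (auto simp: dist_norm norm_minus_commute)
  then have \<mu>: "\<mu> > 0" using isol[of t0] by (auto simp: \<mu>_def)
  obtain \<eta> where \<eta>: "\<eta> > 0" and close: "\<And>z z0 t. norm z < \<epsilon> \<and> norm z0 < \<epsilon> \<and> dist z z0 < \<eta> \<and> norm t \<le> 5 * \<rho> \<Longrightarrow> dist (H z t) (H z0 t) < \<mu> / 3"
    using H_uniformly_close[of "\<mu> / 3"] \<mu> by auto
  have "\<exists>t\<in>zs z. norm (t - \<xi>) < d" if z: "norm z < \<epsilon>" "dist z z0 < \<eta>" for z
  proof (rule ccontr)
    assume no: "\<not> (\<exists>t\<in>zs z. norm (t - \<xi>) < d)"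
    have cl: "norm (H z t - H z0 t) < \<mu> / 3" if "t \<in> cball \<xi> d" for t
    proof -
      have "norm t \<le> 5 * \<rho>" using sub that by fastforce
      then show ?thesis using close[of z z0 t] z z0 by (simp add: dist_norm)
    qed
    have sph: "norm (H z t) \<ge> 2 * \<mu> / 3" if "t \<in> sphere \<xi> d" for t
    proof -
      have "t \<in> cball \<xi> d" using that by auto
      from cl[OF this] t0(2)[OF that] show ?thesis
        using norm_triangle_ineq2[of "H z0 t" "H z t"] by (simp add: \<mu>_def norm_minus_commute)
    qed
    have nz: "H z t \<noteq> 0" if "t \<in> cball \<xi> d" for t
    proof (cases "t \<in> sphere \<xi> d")
      case True
      then show ?thesis using sph[OF True] \<mu> by auto
    next
      case False
      then have "norm (t - \<xi>) < d" using that by (auto simp: dist_norm norm_minus_commute)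
      then show ?thesis using no in\<rho>[of t] by (auto simp: zs_def)
    qed
    \<comment> \<open>Minimum modulus principle, as in the proof of Hurwitz' theorem.\<close>
    have "norm (inverse (H z \<xi>)) \<le> inverse (2 * \<mu> / 3)"
    proof (rule maximum_modulus_frontier[of "\<lambda>t. inverse (H z t)" "cball \<xi> d"])
      show "(\<lambda>t. inverse (H z t)) holomorphic_on interior (cball \<xi> d)"
        using nz sub by (intro holomorphic_on_inverse holomorphic_on_subset[OF H_holomorphic[OF z(1)]]) auto
      show "continuous_on (closure (cball \<xi> d)) (\<lambda>t. inverse (H z t))"
        using nz sub by (intro continuous_on_inverse holomorphic_on_imp_continuous_on
           holomorphic_on_subset[OF H_holomorphic[OF z(1)]]) auto
      show "cmod (inverse (H z t)) \<le> inverse (2 * \<mu> / 3)" if "t \<in> frontier (cball \<xi> d)" for t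
      proof -
        have "t \<in> sphere \<xi> d" using that d by simp
        from sph[OF this] show ?thesis unfolding norm_inverse using \<mu> by (intro le_imp_inverse_le) auto
      qed
    qed (use d in auto)
    then have "2 * \<mu> / 3 \<le> norm (H z \<xi>)"
      unfolding norm_inverse by (rule inverse_le_imp_le) (use nz[of \<xi>] d in auto)
    moreover have "norm (H z \<xi> - H z0 \<xi>) < \<mu> / 3" using cl[of \<xi>] d by auto
    ultimately show False using \<xi>0 \<mu> by simp
  qed
  then show ?thesis using \<eta> by blast
qed

text \<open>Pigeonhole: each of \<open>k\<close> disjoint discs around the zeros of
  \<open>z0\<close> keeps at least one zero, and at most \<open>k\<close> zeros are available, so
  each disc holds exactly one. It may be multiple, which is irrelevant for counting distinct
  zeros.\<close>

lemma unique_zero_nearby: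
  assumes z0: "norm z0 < \<epsilon>" and k: "card (zs z0) = k" and \<xi>0: "\<xi>0 \<in> zs z0" and d0: "d0 > 0"
  shows "\<exists>d \<eta>. 0 < d \<and> d < d0 \<and> 0 < \<eta> \<and> (\<forall>z. norm z < \<epsilon> \<and> dist z z0 < \<eta> \<and> card (zs z) \<le> k \<longrightarrow>
     (\<exists>!t. t \<in> zs z \<and> norm (t - \<xi>0) < d))"
proof -
  have fin: "finite (zs z0)" using zs_multiplicities[OF z0] by blast
  have "\<forall>\<^sub>F d in at_right 0. \<forall>\<xi>\<in>zs z0. \<forall>\<xi>'\<in>zs z0. \<xi> \<noteq> \<xi>' \<longrightarrow> d < norm (\<xi> - \<xi>') / 2"
  proof (intro eventually_ball_finite fin ballI)
    fix \<xi> \<xi>' :: complex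
    show "\<forall>\<^sub>F d in at_right 0. \<xi> \<noteq> \<xi>' \<longrightarrow> d < norm (\<xi> - \<xi>') / 2"
    proof (cases "\<xi> = \<xi>'")
      case False
      then have "\<forall>\<^sub>F d in at_right 0. d < norm (\<xi> - \<xi>') / 2"
        by (intro order_tendstoD(2)[OF tendsto_ident_at]) simp
      then show ?thesis by eventually_elim simp
    qed simp
  qed
  moreover have "\<forall>\<^sub>F d in at_right 0. \<forall>\<xi>\<in>zs z0. d < \<rho> - norm \<xi>"
    by (intro eventually_ball_finite fin ballI order_tendstoD(2)[OF tendsto_ident_at]) (auto simp: zs_def)
  moreover have "\<forall>\<^sub>F d in at_right 0. d < d0" by (intro order_tendstoD(2)[OF tendsto_ident_at] d0)
  moreover have "\<forall>\<^sub>F d in at_right (0::real). 0 < d" by (simp add: eventually_at_right_less)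
  ultimately have "\<forall>\<^sub>F d in at_right (0::real). 0 < d \<and> d < d0 \<and> (\<forall>\<xi>\<in>zs z0. d < \<rho> - norm \<xi>) \<and>
     (\<forall>\<xi>\<in>zs z0. \<forall>\<xi>'\<in>zs z0. \<xi> \<noteq> \<xi>' \<longrightarrow> d < norm (\<xi> - \<xi>') / 2)" by eventually_elim blast
  then have "\<exists>d::real. 0 < d \<and> d < d0 \<and> (\<forall>\<xi>\<in>zs z0. d < \<rho> - norm \<xi>) \<and>
     (\<forall>\<xi>\<in>zs z0. \<forall>\<xi>'\<in>zs z0. \<xi> \<noteq> \<xi>' \<longrightarrow> d < norm (\<xi> - \<xi>') / 2)"
    by (rule eventually_happens'[OF trivial_limit_at_right_real])
  then obtain d where d: "0 < d" "d < d0" and d\<rho>: "\<forall>\<xi>\<in>zs z0. d < \<rho> - norm \<xi>"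
    and dsep: "\<forall>\<xi>\<in>zs z0. \<forall>\<xi>'\<in>zs z0. \<xi> \<noteq> \<xi>' \<longrightarrow> d < norm (\<xi> - \<xi>') / 2" by blast
  have "\<exists>\<eta>>0. \<forall>z. norm z < \<epsilon> \<and> dist z z0 < \<eta> \<longrightarrow> (\<exists>t\<in>zs z. norm (t - \<xi>) < d)" if \<xi>: "\<xi> \<in> zs z0" for \<xi>
  proof (rule zero_persists[OF z0 \<xi> d(1)], rule conjI)
    fix t assume t: "t \<noteq> \<xi>" "norm (t - \<xi>) \<le> d"
    show t\<rho>: "norm t < \<rho>" using norm_triangle_ineq2[of t \<xi>] t d\<rho> \<xi> by fastforce
    show "H z0 t \<noteq> 0"
    proof
      assume "H z0 t = 0"
      then have "t \<in> zs z0" using t\<rho> by (simp add: zs_def)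
      then have "d < norm (t - \<xi>) / 2" using dsep \<xi> t by blast
      then show False using t d by simp
    qed
  qed
  then obtain \<eta>f where \<eta>f: "\<And>\<xi>. \<xi> \<in> zs z0 \<Longrightarrow> \<eta>f \<xi> > 0"
    "\<And>\<xi> z. \<xi> \<in> zs z0 \<Longrightarrow> norm z < \<epsilon> \<and> dist z z0 < \<eta>f \<xi> \<Longrightarrow> (\<exists>t\<in>zs z. norm (t - \<xi>) < d)"
    by metis
  define \<eta> where "\<eta> = Min (\<eta>f ` zs z0)"
  have ne: "zs z0 \<noteq> {}" using \<xi>0 by auto
  have \<eta>: "\<eta> > 0" "\<And>\<xi>. \<xi> \<in> zs z0 \<Longrightarrow> \<eta> \<le> \<eta>f \<xi>" using fin ne \<eta>f(1) by (auto simp: \<eta>_def)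
  have "\<exists>!t. t \<in> zs z \<and> norm (t - \<xi>0) < d" if z: "norm z < \<epsilon>" "dist z z0 < \<eta>" "card (zs z) \<le> k" for z
  proof -
    have "\<exists>t. t \<in> zs z \<and> norm (t - \<xi>) < d" if "\<xi> \<in> zs z0" for \<xi>
      using \<eta>f(2)[OF that, of z] \<eta>(2)[OF that] z by (meson less_le_trans)
    then obtain \<tau> where \<tau>: "\<And>\<xi>. \<xi> \<in> zs z0 \<Longrightarrow> \<tau> \<xi> \<in> zs z \<and> norm (\<tau> \<xi> - \<xi>) < d" by metis
    have sep: "\<xi> = \<xi>'" if "\<xi> \<in> zs z0" "\<xi>' \<in> zs z0" "norm (t - \<xi>) < d" "norm (t - \<xi>') < d" for \<xi> \<xi>' t
    proof (rule ccontr)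
      assume "\<xi> \<noteq> \<xi>'"
      then have "2 * d < norm (\<xi> - \<xi>')" using dsep that by fastforce
      also have "\<dots> \<le> norm (t - \<xi>) + norm (t - \<xi>')"
        using norm_triangle_ineq4[of "t - \<xi>'" "t - \<xi>"] by simp
      finally show False using that by simp
    qed
    have "inj_on \<tau> (zs z0)" using sep \<tau> by (metis inj_onI)
    then have "card (\<tau> ` zs z0) = k" using k by (simp add: card_image)
    moreover have "\<tau> ` zs z0 \<subseteq> zs z" using \<tau> by auto
    moreover have finz: "finite (zs z)" using zs_multiplicities[OF z(1)] by blast
    ultimately have im: "\<tau> ` zs z0 = zs z" using z(3) card_mono[OF finz] by (intro card_subset_eq) (auto intro: le_antisym)
    show ?thesis
    proof (rule ex1I[of _ "\<tau> \<xi>0"])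
      show "\<tau> \<xi>0 \<in> zs z \<and> norm (\<tau> \<xi>0 - \<xi>0) < d" using \<tau>[OF \<xi>0] .
      fix t assume t: "t \<in> zs z \<and> norm (t - \<xi>0) < d"
      then obtain \<xi> where \<xi>: "\<xi> \<in> zs z0" "t = \<tau> \<xi>" using im by blast
      then have "\<xi> = \<xi>0" using sep[OF \<xi>(1) \<xi>0, of t] \<tau>[OF \<xi>(1)] t by simp
      then show "t = \<tau> \<xi>0" using \<xi> by simp
    qed
  qed
  then show ?thesis using d \<eta>(1) by blast
qed

lemma zs_cnj: "norm x < \<epsilon> \<Longrightarrow> t \<in> zs (cvec x) \<Longrightarrow> cnj t \<in> zs (cvec x)"
proof -
  assume x: "norm x < \<epsilon>" and t: "t \<in> zs (cvec x)"
  have "norm (cvec x + t *s cvec v) < r" using x t \<rho> by (intro in_ball) (auto simp: zs_def)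
  from pseries_cnj[OF conv this] have "H (cvec x) (cnj t) = cnj (H (cvec x) t)"
    by (simp add: plus_vec_def vector_scalar_mult_def)
  then show ?thesis using t by (simp add: zs_def)
qed

lemma card_zs_le: "norm z < \<epsilon> \<Longrightarrow> card (zs z) \<le> nat \<lfloor>ln (M / m) / ln (3/2)\<rfloor>"
proof -
  assume z: "norm z < \<epsilon>"
  obtain n where fin: "finite (zs z)" and n1: "\<forall>\<xi>\<in>zs z. n \<xi> \<ge> (1::nat)"
    and N: "real (\<Sum>\<xi>\<in>zs z. n \<xi>) \<le> ln (M / m) / ln (3/2)" using zs_multiplicities[OF z] by blast
  have "card (zs z) \<le> (\<Sum>\<xi>\<in>zs z. n \<xi>)" using sum_mono[of "zs z" "\<lambda>_. 1" n] n1 by simp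
  then have "real (card (zs z)) \<le> ln (M / m) / ln (3/2)" using N by (meson of_nat_le_iff order_trans)
  then show ?thesis by (rule le_nat_floor)
qed

text \<open>The bound on multiplicities makes the maximum exist, and it is attained at a real point
  \<open>x1\<close>. There the discriminant is nonzero, so it does not vanish identically and its
  logarithm can be integrated.\<close>

lemma max_card_zs:
  obtains k x1 where "norm x1 < \<epsilon>" "card (zs (cvec x1)) = k" "\<And>x. norm x < \<epsilon> \<Longrightarrow> card (zs (cvec x)) \<le> k"
proof -
  let ?P = "\<lambda>j. \<exists>x. norm x < \<epsilon> \<and> card (zs (cvec x)) = j"
  have P: "\<And>j. ?P j \<Longrightarrow> j \<le> nat \<lfloor>ln (M / m) / ln (3/2)\<rfloor>" using card_zs_le by fastforce
  have ex: "?P (card (zs (cvec 0)))" using \<epsilon> by (metis norm_zero)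
  define k where "k = (GREATEST j. ?P j)"
  have "?P k" unfolding k_def using ex P by (rule GreatestI_nat)
  moreover have "card (zs (cvec x)) \<le> k" if "norm x < \<epsilon>" for x
    unfolding k_def using that P by (intro Greatest_le_nat) auto
  ultimately show ?thesis using that by blast
qed

end

section \<open>Real zeros and the codimension hypothesis\<close>

locale analytic_line_family = line_family c r \<rho> m M \<epsilon> v
  for c :: "('n::finite \<Rightarrow> nat) \<Rightarrow> real" and r \<rho> m M \<epsilon> :: real and v :: "real ^ 'n" +
  fixes f :: "real ^ 'n \<Rightarrow> real" and \<Omega> :: "(real ^ 'n) set"
  assumes f_series: "\<And>x. norm x < r \<Longrightarrow> f x = Re (pseries c (cvec x))"
    and sub: "ball 0 r \<subseteq> \<Omega>" and ana: "real_analytic_on f \<Omega>"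
    and no_hypersurface: "\<And>q. norm q < r \<Longrightarrow> \<not> smooth_point {x\<in>\<Omega>. f x = 0} q (CARD('n) - 1)"
begin

lemma in_ball_real: "norm x < \<epsilon> \<Longrightarrow> \<bar>t\<bar> \<le> 5 * \<rho> \<Longrightarrow> norm (x + t *\<^sub>R v) < r"
  using in_ball[of "cvec x" "of_real t"] by (simp flip: cvec_add cvec_scale)

lemma f_line: "norm x < \<epsilon> \<Longrightarrow> \<bar>t\<bar> \<le> 5 * \<rho> \<Longrightarrow> of_real (f (x + t *\<^sub>R v)) = H (cvec x) (of_real t)"
  using f_series[OF in_ball_real, of x t] pseries_cvec[OF conv in_ball_real, of x t]
  by (simp add: cvec_add cvec_scale)

lemma dirderiv_f: "norm x < r \<Longrightarrow> of_real (dirderiv v f x) = pseries (dirderiv_coeff v c) (cvec x)"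
  using dirderiv_pseries[OF conv, of x 0 f v] f_series pseries_cvec[OF converges_on_ball_dirderiv_coeff[OF conv], of x v]
  by simp

text \<open>Otherwise the restriction to the line would vanish up to a point of the circle of radius
  \<open>\<rho>\<close>, against the lower bound \<open>m\<close>. Finite order of vanishing is what
  makes a least order available later.\<close>

lemma exists_nonzero_iterated_derivative:
  assumes x: "norm x < \<epsilon>" and t: "\<bar>t\<bar> < \<rho>"
  shows "\<exists>j. (dirderiv v ^^ j) f (x + t *\<^sub>R v) \<noteq> 0"
proof (rule ccontr)
  assume "\<not> ?thesis"
  then have z: "(dirderiv v ^^ j) f (x + t *\<^sub>R v) = 0" for j by auto
  have nq: "norm (x + t *\<^sub>R v) < r" using x t \<rho> by (intro in_ball_real) auto
  have "(deriv ^^ j) (H (cvec x)) (of_real t) = 0" for j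
  proof -
    have "(deriv ^^ j) (H (cvec x)) (of_real t) = pseries ((dirderiv_coeff v ^^ j) c) (cvec x + of_real t *s cvec v)"
      using x t \<rho> by (intro pseries_iter_deriv[OF conv, of "ball 0 (5 * \<rho>)"] in_ball) auto
    also have "\<dots> = pseries ((dirderiv_coeff v ^^ j) c) (cvec (x + t *\<^sub>R v))" by (simp add: cvec_add cvec_scale)
    also have "\<dots> = of_real ((dirderiv v ^^ j) f (x + t *\<^sub>R v))"
      using dirderiv_iter_pseries[OF conv, where f = f and v = v and j = j] f_series nq
        pseries_cvec[of "(dirderiv_coeff v ^^ j) c" r "x + t *\<^sub>R v"] by simp
    finally show ?thesis using z by simp
  qed
  \<comment> \<open>Radius \<open>4 * \<rho>\<close> keeps the disc inside the domain, yet it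
    contains \<open>\<rho>\<close>, whose distance from \<open>t\<close> is less than
    \<open>2 * \<rho>\<close>.\<close>
  moreover have "ball (complex_of_real t) (4 * \<rho>) \<subseteq> ball 0 (5 * \<rho>)"
    using t by (intro ball_subset_ball_iff[THEN iffD2]) (auto simp: dist_norm)
  ultimately have "H (cvec x) (of_real \<rho>) = 0"
    using H_holomorphic[of "cvec x"] x t \<rho>
    by (intro holomorphic_fun_eq_0_on_ball[of "H (cvec x)" "of_real t" "4 * \<rho>"])
       (auto simp: dist_norm simp flip: of_real_diff intro: holomorphic_on_subset)
  then show False using lo[of "cvec x" "of_real \<rho>"] x \<rho> m by simp
qed

text \<open>Near a real base point with nonzero discriminant the number of distinct zeros is
  constant over real base points, so a multiple zero moves without splitting. A real one can then
  neither disappear nor leave the real line, and it sweeps out a hypersurface of zeros of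
  \<open>f\<close>.\<close>

lemma no_real_zero:
  assumes k: "\<And>x. norm x < \<epsilon> \<Longrightarrow> card (zs (cvec x)) \<le> k"
    and x0: "norm x0 < \<epsilon>" "disc k (cvec x0) \<noteq> 0" and t0: "\<bar>t0\<bar> < \<rho>"
  shows "f (x0 + t0 *\<^sub>R v) \<noteq> 0"
proof
  assume f0: "f (x0 + t0 *\<^sub>R v) = 0"
  define O' where "O' = {y \<in> ball 0 \<epsilon>. disc k (cvec y) \<noteq> 0}"
  have "open O'"
  proof -
    have "continuous_on (ball 0 \<epsilon>) (\<lambda>y. disc k (cvec y))"
      by (intro continuous_on_compose2[OF continuous_on_disc] continuous_intros) auto
    then have "open (ball 0 \<epsilon> \<inter> (\<lambda>y. disc k (cvec y)) -` (- {0}))"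
      by (intro continuous_open_preimage) auto
    moreover have "O' = ball 0 \<epsilon> \<inter> (\<lambda>y. disc k (cvec y)) -` (- {0})" by (auto simp: O'_def)
    ultimately show ?thesis by simp
  qed
  \<comment> \<open>The points seen at the fixed parameter \<open>t0\<close> from base points in
    \<open>O'\<close>; conversely the base point assigned to \<open>p\<close> is \<open>p\<close>
    shifted back by \<open>t0\<close> times \<open>v\<close>.\<close>
  define W where "W = (\<lambda>y. y + t0 *\<^sub>R v) ` O'"
  have W: "open W" unfolding W_def using open_translation[OF \<open>open O'\<close>, of "t0 *\<^sub>R v"] by (simp add: add.commute)
  have Wmem: "p \<in> W \<longleftrightarrow> p - t0 *\<^sub>R v \<in> O'" for p unfolding W_def by (auto simp: image_iff intro!: bexI[of _ "p - t0 *\<^sub>R v"])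
  have Wr: "norm p < r" if "p \<in> W" for p
    using in_ball_real[of "p - t0 *\<^sub>R v" t0] that t0 \<rho> by (auto simp: Wmem O'_def)
  let ?P = "\<lambda>j. \<exists>p\<in>W. f p = 0 \<and> (dirderiv v ^^ j) f p \<noteq> 0"
  have q0: "x0 + t0 *\<^sub>R v \<in> W" using x0 by (auto simp: Wmem O'_def)
  obtain j0 where "(dirderiv v ^^ j0) f (x0 + t0 *\<^sub>R v) \<noteq> 0"
    using exists_nonzero_iterated_derivative[OF x0(1) t0] by blast
  then have ex: "?P j0" using q0 f0 by blast
  \<comment> \<open>Minimality of the order \<open>\<mu>\<close> over all zeros in \<open>W\<close> makes \<open>g\<close>, the derivative of order \<open>\<mu> - 1\<close>, vanish on all
    of them, and \<open>\<partial>\<^sub>v g \<noteq> 0\<close> at \<open>q\<close>; conversely, each line near \<open>q\<close> carries exactly one zero of \<open>f\<close> near \<open>t0\<close>,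
    which is real by conjugation symmetry and must be the zero of \<open>g\<close>.\<close>
  define \<mu> where "\<mu> = (LEAST j. ?P j)"
  have "?P \<mu>" unfolding \<mu>_def using ex by (rule LeastI)
  then obtain q where q: "q \<in> W" "f q = 0" "(dirderiv v ^^ \<mu>) f q \<noteq> 0" by blast
  then have "\<mu> \<noteq> 0" by (intro notI) simp
  then obtain j where j: "\<mu> = Suc j" by (cases \<mu>) auto
  define g where "g = (dirderiv v ^^ j) f"
  have gz: "g p = 0" if "p \<in> W" "f p = 0" for p
    using not_less_Least[of j ?P] that by (auto simp: g_def \<mu>_def[symmetric] j)
  have dg: "dirderiv v g q \<noteq> 0" using q(3) by (simp add: g_def j)
  have ga: "real_analytic_on g \<Omega>" unfolding g_def by (rule real_analytic_on_dirderiv_iter[OF ana])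
  have W\<Omega>: "W \<subseteq> \<Omega>" using Wr sub by auto
  have "isCont (dirderiv v g) q" using q W\<Omega> by (intro real_analytic_on_isCont[OF real_analytic_on_dirderiv[OF ga]]) auto
  then have "\<forall>\<^sub>F p in nhds q. dirderiv v g p \<noteq> 0"
    using dg by (simp add: isCont_def tendsto_at_iff_tendsto_nhds tendsto_imp_eventually_ne)
  moreover have "\<forall>\<^sub>F p in nhds q. p \<in> W" using q W by (simp add: eventually_nhds_in_open)
  ultimately have "\<forall>\<^sub>F p in nhds q. p \<in> W \<and> dirderiv v g p \<noteq> 0" by eventually_elim simp
  then obtain \<delta> where \<delta>: "\<delta> > 0" "\<And>p. dist p q < \<delta> \<Longrightarrow> p \<in> W \<and> dirderiv v g p \<noteq> 0"
    unfolding eventually_nhds_metric by blast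
  \<comment> \<open>Rolle's theorem: \<open>dirderiv v g\<close> has no zero in
    \<open>ball q \<delta>\<close>, so \<open>g\<close> has at most one on each line in direction
    \<open>v\<close> there.\<close>
  have inj: "s = 0" if p: "p \<in> ball q \<delta>" "p + s *\<^sub>R v \<in> ball q \<delta>" "g p = 0" "g (p + s *\<^sub>R v) = 0" for p s
  proof (rule ccontr)
    assume s: "s \<noteq> 0"
    have seg: "p + \<theta> *\<^sub>R v \<in> ball q \<delta>" if \<theta>s: "\<theta> \<in> closed_segment 0 s" for \<theta>
    proof -
      obtain u where u: "0 \<le> u" "u \<le> 1" "\<theta> = u * s" using \<theta>s unfolding in_segment by auto
      have "p + \<theta> *\<^sub>R v = (1 - u) *\<^sub>R p + u *\<^sub>R (p + s *\<^sub>R v)" by (simp add: u algebra_simps)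
      then show ?thesis using convexD[OF convex_ball p(1) p(2), of "1 - u" u] u by simp
    qed
    have der: "((\<lambda>\<theta>. g (p + \<theta> *\<^sub>R v)) has_real_derivative dirderiv v g (p + \<theta> *\<^sub>R v)) (at \<theta>)"
      if "\<theta> \<in> closed_segment 0 s" for \<theta>
    proof (rule has_real_derivative_shift_line, rule real_analytic_on_has_dirderiv[OF ga])
      have "dist (p + \<theta> *\<^sub>R v) q < \<delta>" using seg[OF that] by (simp add: dist_commute)
      then show "p + \<theta> *\<^sub>R v \<in> \<Omega>" using \<delta>(2) W\<Omega> by blast
    qed
    define lo' hi' where "lo' = min 0 s" and "hi' = max 0 s"
    have lh: "lo' < hi'" "{lo'..hi'} = closed_segment 0 s" using s by (auto simp: lo'_def hi'_def closed_segment_eq_real_ivl)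
    have "g (p + lo' *\<^sub>R v) = 0" "g (p + hi' *\<^sub>R v) = 0" using p by (auto simp: lo'_def hi'_def min_def max_def)
    then have "\<exists>\<theta>. lo' < \<theta> \<and> \<theta> < hi' \<and> dirderiv v g (p + \<theta> *\<^sub>R v) = 0"
      using MVT2[OF lh(1), of "\<lambda>\<theta>. g (p + \<theta> *\<^sub>R v)" "\<lambda>\<theta>. dirderiv v g (p + \<theta> *\<^sub>R v)"] der lh by force
    then obtain \<theta> where \<theta>: "\<theta> \<in> closed_segment 0 s" "dirderiv v g (p + \<theta> *\<^sub>R v) = 0"
      using lh(2) by (metis atLeastAtMost_iff less_imp_le)
    then show False using \<delta>(2)[of "p + \<theta> *\<^sub>R v"] seg[OF \<theta>(1)] by (simp add: dist_commute)
  qed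
  define x where "x = q - t0 *\<^sub>R v"
  have xO: "x \<in> O'" using q(1) by (simp add: Wmem x_def)
  then have xe: "norm x < \<epsilon>" "disc k (cvec x) \<noteq> 0" by (auto simp: O'_def)
  have cardx: "card (zs (cvec x)) = k" using disc_nonzero_iff[of "cvec x" k] xe k by simp
  have t0z: "of_real t0 \<in> zs (cvec x)"
    using f_line[of x t0] xe(1) t0 \<rho> q(2) by (simp add: zs_def x_def)
  \<comment> \<open>A parameter change below \<open>d0\<close> moves a point by at most
    \<open>\<delta> / 2\<close>; starting from \<open>V\<close>, the zero of \<open>f\<close> that
    is found stays in \<open>ball q \<delta>\<close>, where \<open>inj\<close> applies.\<close>
  obtain d0 where d0: "d0 > 0" "d0 * norm v \<le> \<delta> / 2"
    using exists_small_step[of 1 "\<delta> / 2" v] \<delta> by auto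
  obtain d \<eta> where d: "0 < d" "d < d0" and \<eta>: "0 < \<eta>"
    and uniq: "\<forall>z. norm z < \<epsilon> \<and> dist z (cvec x) < \<eta> \<and> card (zs z) \<le> k \<longrightarrow> (\<exists>!t. t \<in> zs z \<and> norm (t - of_real t0) < d)"
    using unique_zero_nearby[OF _ cardx t0z d0(1)] xe(1) by auto
  define V where "V = ball q (min (\<delta> / 2) \<eta>)"
  have V: "open V" "q \<in> V" using \<delta> \<eta> by (auto simp: V_def)
  have VW: "V \<subseteq> W" using \<delta> by (force simp: V_def dist_commute)
  have key: "f p = 0 \<longleftrightarrow> g p = 0" if p: "p \<in> V" for p
  proof
    show "f p = 0 \<Longrightarrow> g p = 0" using gz p VW by blast
    assume gp: "g p = 0"
    define y where "y = p - t0 *\<^sub>R v"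
    have "y \<in> O'" using p VW by (auto simp: Wmem y_def)
    then have ye: "norm y < \<epsilon>" by (simp add: O'_def)
    have "dist (cvec y) (cvec x) < \<eta>"
      using p by (simp add: dist_norm y_def x_def V_def norm_minus_commute flip: cvec_diff)
    then have "\<exists>!t. t \<in> zs (cvec y) \<and> norm (t - of_real t0) < d"
      using uniq ye k[OF ye] by simp
    then obtain t where t: "t \<in> zs (cvec y)" "norm (t - of_real t0) < d"
      and tu: "\<And>t'. t' \<in> zs (cvec y) \<Longrightarrow> norm (t' - of_real t0) < d \<Longrightarrow> t' = t" by blast
    have "norm (cnj t - of_real t0) = norm (t - of_real t0)"
      by (metis complex_cnj_complex_of_real complex_cnj_diff complex_mod_cnj)
    then have "cnj t = t" using tu[of "cnj t"] zs_cnj[OF ye t(1)] t(2) by simp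
    then obtain \<tau> where \<tau>: "t = of_real \<tau>" by (metis Reals_cases Reals_cnj_iff)
    have \<tau>\<rho>: "\<bar>\<tau>\<bar> < \<rho>" using t(1) by (simp add: zs_def \<tau>)
    have \<tau>d: "\<bar>\<tau> - t0\<bar> < d" using t(2) by (simp add: \<tau> flip: of_real_diff)
    have "f (y + \<tau> *\<^sub>R v) = 0" using f_line[OF ye, of \<tau>] \<tau>\<rho> \<rho> t(1) by (simp add: zs_def \<tau>)
    moreover have yp: "y + \<tau> *\<^sub>R v = p + (\<tau> - t0) *\<^sub>R v" by (simp add: y_def algebra_simps)
    ultimately have fp: "f (p + (\<tau> - t0) *\<^sub>R v) = 0" by simp
    have "norm ((\<tau> - t0) *\<^sub>R v) \<le> d0 * norm v"
      using \<tau>d d by (auto intro!: mult_right_mono)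
    then have "norm ((\<tau> - t0) *\<^sub>R v) \<le> \<delta> / 2" using d0(2) by simp
    then have "dist (p + (\<tau> - t0) *\<^sub>R v) p \<le> \<delta> / 2" by (simp add: dist_norm)
    moreover have "dist p q < \<delta> / 2" using p by (simp add: V_def dist_commute)
    ultimately have near: "dist (p + (\<tau> - t0) *\<^sub>R v) q < \<delta>"
      using dist_triangle[of "p + (\<tau> - t0) *\<^sub>R v" q p] by simp
    then have "g (p + (\<tau> - t0) *\<^sub>R v) = 0" using \<delta>(2) gz fp by blast
    moreover have "p \<in> ball q \<delta>" using \<open>dist p q < \<delta> / 2\<close> \<delta>(1) by (simp add: dist_commute)
    ultimately have "\<tau> - t0 = 0" using inj[of p "\<tau> - t0"] gp near by (simp add: dist_commute)
    then show "f p = 0" using fp by simp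
  qed
  have "smooth_point {x\<in>\<Omega>. f x = 0} q (CARD('n) - 1)"
  proof (rule smooth_point_regular_hypersurface[OF V])
    show "real_analytic_on g V" using VW W\<Omega> by (intro real_analytic_on_subset[OF ga]) auto
    show "dirderiv v g x \<noteq> 0" if "x \<in> V" for x using \<delta>(2)[of x] that \<delta>(1) by (auto simp: V_def dist_commute)
    show "x \<in> {x \<in> \<Omega>. f x = 0} \<longleftrightarrow> g x = 0" if "x \<in> V" for x using key[OF that] that VW W\<Omega> by auto
    show "q \<in> {x \<in> \<Omega>. f x = 0}" using q W\<Omega> by auto
  qed
  then show False using no_hypersurface[OF Wr[OF q(1)]] by simp
qed

end

section \<open>Integrability of the logarithmic derivative\<close>


lemma integral_line_average:
  fixes \<Psi> :: "'a::euclidean_space \<Rightarrow> real"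
  assumes \<Psi>: "integrable lborel \<Psi>" and a: "a > 0"
  shows "2 * a * (LINT x|lborel. \<Psi> x) = (LINT x|lborel. (LINT t|lborel. \<Psi> (x + t *\<^sub>R v) * indicator {-a..a} t))"
proof -
  have [measurable]: "\<Psi> \<in> borel_measurable borel" using \<Psi> by auto
  have int: "integrable (lborel \<Otimes>\<^sub>M lborel) (\<lambda>(x, t). \<Psi> (x + t *\<^sub>R v) * indicator {-a..a} t)"
  proof (rule integrableI_bounded)
    have "(\<integral>\<^sup>+p. ennreal (norm (case p of (x, t) \<Rightarrow> \<Psi> (x + t *\<^sub>R v) * indicator {-a..a} t)) \<partial>(lborel \<Otimes>\<^sub>M lborel)) =
      (\<integral>\<^sup>+x. (\<integral>\<^sup>+t. ennreal (norm (\<Psi> (x + t *\<^sub>R v))) * indicator {-a..a} t \<partial>lborel) \<partial>lborel)"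
      by (subst lborel.nn_integral_fst[symmetric]) (auto intro!: nn_integral_cong simp: indicator_def)
    also have "\<dots> = ennreal (2 * a) * (\<integral>\<^sup>+x. ennreal (norm (\<Psi> x)) \<partial>lborel)"
      by (rule nn_integral_line_average[symmetric]) (use a in auto)
    also have "\<dots> < \<infinity>" using \<Psi> by (auto simp: integrable_iff_bounded ennreal_mult_less_top)
    finally show "(\<integral>\<^sup>+p. ennreal (norm (case p of (x, t) \<Rightarrow> \<Psi> (x + t *\<^sub>R v) * indicator {-a..a} t)) \<partial>(lborel \<Otimes>\<^sub>M lborel)) < \<infinity>" .
  qed measurable
  have "(LINT x|lborel. (LINT t|lborel. \<Psi> (x + t *\<^sub>R v) * indicator {-a..a} t)) =
     (LINT t|lborel. (LINT x|lborel. \<Psi> (x + t *\<^sub>R v) * indicator {-a..a} t))"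
    using lborel_pair.Fubini_integral[OF int] by simp
  also have "\<dots> = (LINT t|lborel. (LINT x|lborel. \<Psi> x) * indicator {-a..a} t)"
  proof (intro Bochner_Integration.integral_cong refl)
    fix t :: real
    have "(LINT x|lborel. \<Psi> x) = (LINT x|lborel. \<Psi> (x + t *\<^sub>R v))"
      by (subst lborel_distr_plus[symmetric, of "t *\<^sub>R v"], subst integral_distr) (auto simp: add.commute)
    then show "(LINT x|lborel. \<Psi> (x + t *\<^sub>R v) * indicator {-a..a} t) = (LINT x|lborel. \<Psi> x) * indicator {-a..a} t"
      by simp
  qed
  also have "\<dots> = 2 * a * (LINT x|lborel. \<Psi> x)" using a by simp
  finally show ?thesis by simp
qed

lemma integral_translate:
  fixes u :: "'a::euclidean_space \<Rightarrow> real"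
  assumes "integrable lborel u"
  shows "integrable lborel (\<lambda>x. u (x + y))" "(LINT x|lborel. u (x + y)) = (LINT x|lborel. u x)"
proof -
  have [measurable]: "u \<in> borel_measurable borel" using assms by auto
  have "integrable (distr lborel borel ((+) y)) u" using assms by (simp add: lborel_distr_plus)
  then show "integrable lborel (\<lambda>x. u (x + y))" by (subst (asm) integrable_distr_eq) (auto simp: add.commute)
  show "(LINT x|lborel. u (x + y)) = (LINT x|lborel. u x)"
    by (subst (2) lborel_distr_plus[symmetric, of y], subst integral_distr) (auto simp: add.commute)
qed

context analytic_line_family
begin

lemma log_derivative_measurable:
  assumes "e \<le> \<epsilon>"
  shows "(\<lambda>x. indicator (ball 0 e) x * (dirderiv v f x / f x)) \<in> borel_measurable borel"
proof -
  have cont: "continuous_on (ball 0 r) f" "continuous_on (ball 0 r) (dirderiv v f)"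
    using real_analytic_on_isCont[OF ana] real_analytic_on_isCont[OF real_analytic_on_dirderiv[OF ana]] sub
    by (auto intro!: continuous_at_imp_continuous_on)
  show ?thesis
    by (rule borel_measurable_quotient_on_ball[OF cont]) (use assms \<epsilon>_less_r in simp)
qed

lemma log_gradient_integrable:
  "\<exists>\<epsilon>1>0. \<epsilon>1 < \<epsilon> \<and> (AE x in lborel. norm x < \<epsilon>1 \<longrightarrow> (\<forall>t. \<bar>t\<bar> < \<rho> \<longrightarrow> f (x + t *\<^sub>R v) \<noteq> 0)) \<and>
     (\<integral>\<^sup>+x. ennreal \<bar>dirderiv v f x / f x\<bar> * indicator (ball 0 (\<epsilon>1 / 2)) x \<partial>lborel) < \<infinity>"
proof -
  obtain k x1 where x1: "norm x1 < \<epsilon>" "card (zs (cvec x1)) = k" and k: "\<And>x. norm x < \<epsilon> \<Longrightarrow> card (zs (cvec x)) \<le> k"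
    by (rule max_card_zs) (rule that; assumption)
  have one: "1 *s cvec x1 = cvec x1" by (simp add: vec_eq_iff)
  have dx1: "disc k (cvec x1) \<noteq> 0" using disc_nonzero_iff[of "cvec x1" k] x1 by simp
  \<comment> \<open>The direction for integrating the logarithm of the discriminant is
    \<open>x1\<close> itself: the line through 0 meets \<open>x1\<close> at parameter 1.\<close>
  have "norm (1 *s cvec x1) < \<epsilon>" "disc k (1 *s cvec x1) \<noteq> 0" unfolding one using x1 dx1 by auto
  from nn_integral_abs_ln_finite[OF \<epsilon>(1) continuous_on_disc disc_holomorphic this]
  obtain \<epsilon>1 where \<epsilon>1: "\<epsilon>1 > 0" "\<epsilon>1 < \<epsilon>"
    and fin: "(\<integral>\<^sup>+x. abs_ln (norm (disc k (cvec x))) * indicator (ball 0 \<epsilon>1) x \<partial>lborel) < \<infinity>" by blast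
  have [measurable]: "(\<lambda>x. abs_ln (norm (disc k (cvec x))) * indicator (ball 0 \<epsilon>1) x) \<in> borel_measurable borel"
    using \<epsilon>1 by (intro borel_measurable_abs_ln_on_ball[OF continuous_on_disc]) auto
  have "AE x in lborel. abs_ln (norm (disc k (cvec x))) * indicator (ball 0 \<epsilon>1) x \<noteq> \<infinity>"
    using fin by (intro nn_integral_PInf_AE) auto
  then have good: "AE x in lborel. norm x < \<epsilon>1 \<longrightarrow> disc k (cvec x) \<noteq> 0"
    by eventually_elim (auto simp: abs_ln_def)
  then have nz: "AE x in lborel. norm x < \<epsilon>1 \<longrightarrow> (\<forall>t. \<bar>t\<bar> < \<rho> \<longrightarrow> f (x + t *\<^sub>R v) \<noteq> 0)"
    by eventually_elim (use no_real_zero[OF k] \<epsilon>1 in auto)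
  obtain C where C0: "C \<ge> 0" and C: "\<And>h \<delta>. h holomorphic_on ball 0 (5 * \<rho>) \<and> (\<forall>t. norm t \<le> 4 * \<rho> \<longrightarrow> norm (h t) \<le> M) \<and>
      (\<forall>t. norm t = \<rho> \<longrightarrow> m \<le> norm (h t)) \<and> 0 < \<delta> \<and> \<delta> \<le> 1 \<and>
      (\<forall>\<xi>. norm \<xi> < \<rho> \<and> h \<xi> = 0 \<longrightarrow> \<delta> \<le> \<bar>Im \<xi>\<bar>) \<Longrightarrow>
      (\<integral>\<^sup>+t. ennreal (norm (deriv h (of_real t) / h (of_real t))) * indicator {-\<rho>..\<rho>} t \<partial>lborel)
        \<le> ennreal (C + C * ln (3 / \<delta>))"
    using nn_integral_log_derivative_bound[OF \<rho> m, of M] by blast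
  \<comment> \<open>The factor 2 arises because a zero and its conjugate are
    \<open>2 * \<bar>Im \<xi>\<bar>\<close> apart; the summand 1 ensures
    \<open>ln B \<ge> 0\<close>.\<close>
  define B where "B = 2 * \<bar>disc_const k\<bar> + 1"
  have B: "B \<ge> 1" by (simp add: B_def)
  define A where "A = C + C * (ln 3 + ln B)"
  have A0: "A \<ge> 0" using C0 B by (auto simp: A_def)
  \<comment> \<open>Bounds \<open>C + C * ln (3 / \<delta>)\<close> for the \<open>\<delta>\<close>
    belonging to the base point \<open>x\<close>; \<open>A\<close> collects what is independent of
    \<open>x\<close>.\<close>
  define K where "K = (\<lambda>x. ennreal A + ennreal C * abs_ln (norm (disc k (cvec x))))"
  define g where "g = (\<lambda>x. ennreal \<bar>dirderiv v f x / f x\<bar> * indicator (ball 0 (\<epsilon>1 / 2)) x)"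
  have gm: "g \<in> borel_measurable borel"
  proof -
    have [measurable]: "(\<lambda>x. indicator (ball 0 (\<epsilon>1/2)) x * (dirderiv v f x / f x)) \<in> borel_measurable borel"
      using \<epsilon>1 by (intro log_derivative_measurable) auto
    have "g = (\<lambda>x. ennreal \<bar>indicator (ball 0 (\<epsilon>1/2)) x * (dirderiv v f x / f x)\<bar>)"
      by (auto simp: g_def indicator_def fun_eq_iff)
    also have "\<dots> \<in> borel_measurable borel" by measurable
    finally show ?thesis .
  qed
  have "(\<integral>\<^sup>+x. g x \<partial>lborel) < \<infinity>"
  proof (rule nn_integral_finite_by_lines[OF gm \<rho>(1) \<epsilon>1(1), where v = v and K = K])
    show "AE x in lborel. norm x < \<epsilon>1 \<longrightarrow> (\<integral>\<^sup>+t. g (x + t *\<^sub>R v) * indicator {-\<rho>..\<rho>} t \<partial>lborel) \<le> K x"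
      using good
    proof eventually_elim
      case (elim x)
      show ?case
      proof
        assume "norm x < \<epsilon>1"
        then have x: "norm x < \<epsilon>" and dz: "disc k (cvec x) \<noteq> 0" using elim \<epsilon>1 by auto
        then have xc: "norm (cvec x) < \<epsilon>" by simp
        define \<delta> where "\<delta> = min 1 (norm (disc k (cvec x)) / B)"
        have \<delta>: "0 < \<delta>" "\<delta> \<le> 1" using dz B by (auto simp: \<delta>_def)
        have "(\<integral>\<^sup>+t. g (x + t *\<^sub>R v) * indicator {-\<rho>..\<rho>} t \<partial>lborel) \<le>
           (\<integral>\<^sup>+t. ennreal (norm (deriv (H (cvec x)) (of_real t) / H (cvec x) (of_real t))) * indicator {-\<rho>..\<rho>} t \<partial>lborel)"
        proof (rule nn_integral_mono)
          fix t :: real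
          show "g (x + t *\<^sub>R v) * indicator {-\<rho>..\<rho>} t \<le>
             ennreal (norm (deriv (H (cvec x)) (of_real t) / H (cvec x) (of_real t))) * indicator {-\<rho>..\<rho>} t"
          proof (cases "t \<in> {-\<rho>..\<rho>}")
            case True
            then have t: "\<bar>t\<bar> \<le> 5 * \<rho>" using \<rho> by auto
            have "deriv (H (cvec x)) (of_real t) = of_real (dirderiv v f (x + t *\<^sub>R v))"
              using deriv_H[OF xc, of "of_real t"] dirderiv_f[OF in_ball_real[OF x t]] t by (simp add: cvec_add cvec_scale)
            then have "deriv (H (cvec x)) (of_real t) / H (cvec x) (of_real t) = of_real (dirderiv v f (x + t *\<^sub>R v) / f (x + t *\<^sub>R v))"
              using f_line[OF x t] by simp
            then show ?thesis by (simp only: norm_of_real) (auto simp: g_def indicator_def)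
          qed simp
        qed
        also have "\<dots> \<le> ennreal (C + C * ln (3 / \<delta>))"
        proof (rule C, intro conjI allI impI)
          show "H (cvec x) holomorphic_on ball 0 (5 * \<rho>)" by (rule H_holomorphic[OF xc])
          fix \<xi> assume "norm \<xi> < \<rho> \<and> H (cvec x) \<xi> = 0"
          then have \<xi>: "\<xi> \<in> zs (cvec x)" by (simp add: zs_def)
          have "Im \<xi> \<noteq> 0"
          proof
            assume "Im \<xi> = 0"
            then have r: "\<xi> = of_real (Re \<xi>)" by (simp add: complex_eq_iff)
            have "\<bar>Re \<xi>\<bar> < \<rho>" using \<xi> abs_Re_le_cmod[of \<xi>] by (simp add: zs_def)
            moreover have "f (x + Re \<xi> *\<^sub>R v) = 0"
              using f_line[OF x, of "Re \<xi>"] calculation \<rho> \<xi> r by (simp add: zs_def)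
            ultimately show False using no_real_zero[OF k x dz] by blast
          qed
          then have ne: "\<xi> \<noteq> cnj \<xi>" by (auto simp: complex_eq_iff)
          have "\<xi> - cnj \<xi> = of_real (2 * Im \<xi>) * \<i>" by (simp add: complex_eq_iff)
          then have "norm (\<xi> - cnj \<xi>) = 2 * \<bar>Im \<xi>\<bar>" by (simp only: norm_mult norm_of_real norm_ii)
          then have "norm (disc k (cvec x)) \<le> disc_const k * (2 * \<bar>Im \<xi>\<bar>)"
            using disc_le_dist[OF xc k[OF x] \<xi> zs_cnj[OF x \<xi>] ne] by simp
          also have "\<dots> = (2 * disc_const k) * \<bar>Im \<xi>\<bar>" by simp
          also have "\<dots> \<le> B * \<bar>Im \<xi>\<bar>" by (intro mult_right_mono) (auto simp: B_def)
          finally have "norm (disc k (cvec x)) / B \<le> \<bar>Im \<xi>\<bar>" using B by (simp add: field_simps)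
          then show "\<delta> \<le> \<bar>Im \<xi>\<bar>" by (simp add: \<delta>_def)
        qed (use \<delta> up[OF xc] lo[OF xc] in auto)
        also have "\<dots> \<le> ennreal (A + C * \<bar>ln (norm (disc k (cvec x)))\<bar>)"
        proof (rule ennreal_leI)
          have lB: "ln B \<ge> 0" using B by simp
          have "ln (3 / \<delta>) = ln 3 - ln \<delta>" using \<delta> by (simp add: ln_div)
          moreover have "- ln \<delta> \<le> ln B + \<bar>ln (norm (disc k (cvec x)))\<bar>"
          proof (cases "norm (disc k (cvec x)) / B \<le> 1")
            case True
            then have "ln \<delta> = ln (norm (disc k (cvec x))) - ln B" using dz B by (simp add: \<delta>_def ln_div)
            then show ?thesis by simp
          qed (use lB in \<open>auto simp: \<delta>_def\<close>)
          ultimately have "ln (3 / \<delta>) \<le> ln 3 + ln B + \<bar>ln (norm (disc k (cvec x)))\<bar>" by linarith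
          then have "C * ln (3 / \<delta>) \<le> C * (ln 3 + ln B + \<bar>ln (norm (disc k (cvec x)))\<bar>)"
            using C0 by (rule mult_left_mono)
          then show "C + C * ln (3 / \<delta>) \<le> A + C * \<bar>ln (norm (disc k (cvec x)))\<bar>"
            by (simp add: A_def algebra_simps)
        qed
        also have "\<dots> = K x" using A0 C0 dz by (simp add: K_def abs_ln_def ennreal_mult' )
        finally show "(\<integral>\<^sup>+t. g (x + t *\<^sub>R v) * indicator {-\<rho>..\<rho>} t \<partial>lborel) \<le> K x" .
      qed
    qed
    have "(\<integral>\<^sup>+x. K x * indicator (ball 0 \<epsilon>1) x \<partial>lborel) =
       (\<integral>\<^sup>+x. ennreal A * indicator (ball 0 \<epsilon>1) x + ennreal C * (abs_ln (norm (disc k (cvec x))) * indicator (ball 0 \<epsilon>1) x) \<partial>lborel)"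
      by (intro nn_integral_cong) (auto simp: K_def indicator_def)
    also have "\<dots> = ennreal A * emeasure lborel (ball (0::real^'n) \<epsilon>1) +
       ennreal C * (\<integral>\<^sup>+x. abs_ln (norm (disc k (cvec x))) * indicator (ball 0 \<epsilon>1) x \<partial>lborel)"
    proof (subst nn_integral_add)
      have [measurable]: "ball (0::real^'n) \<epsilon>1 \<in> sets borel" by simp
      show "(\<lambda>x. ennreal A * indicator (ball (0::real^'n) \<epsilon>1) x) \<in> borel_measurable lborel" by measurable
    qed (simp_all add: nn_integral_cmult nn_integral_cmult_indicator)
    also have "\<dots> < \<infinity>"
      using fin emeasure_lborel_ball_finite[of "0::real^'n" \<epsilon>1] by (auto simp: ennreal_mult_less_top)
    finally show "(\<integral>\<^sup>+x. K x * indicator (ball 0 \<epsilon>1) x \<partial>lborel) < \<infinity>" .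
  qed (auto simp: g_def)
  then show ?thesis using \<epsilon>1 nz unfolding g_def by blast
qed

end

section \<open>Integration by parts on lines\<close>


lemma smooth_fun_continuous:
  assumes "smooth_fun \<phi>"
  shows "continuous_on UNIV \<phi>" "continuous_on UNIV (partial_deriv i \<phi>)"
proof -
  have "continuous_on UNIV (iter_partial [] \<phi>)" "continuous_on UNIV (iter_partial [i] \<phi>)"
    using assms unfolding smooth_fun_def by blast+
  then show "continuous_on UNIV \<phi>" "continuous_on UNIV (partial_deriv i \<phi>)" by simp_all
qed

lemma test_fun_eq_0_outside:
  assumes "test_fun U \<phi>" "x \<notin> U"
  shows "\<phi> x = 0" "partial_deriv i \<phi> x = 0"
proof -
  let ?S = "closure {x. \<phi> x \<noteq> 0}"
  have x: "x \<notin> ?S" using assms unfolding test_fun_def by blast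
  have S: "y \<notin> ?S \<Longrightarrow> \<phi> y = 0" for y using closure_subset[of "{x. \<phi> x \<noteq> 0}"] by (auto simp: subset_iff)
  show "\<phi> x = 0" using S x .
  have "((\<lambda>t. x + t *\<^sub>R axis i 1) \<longlongrightarrow> x + 0 *\<^sub>R axis i 1) (nhds 0)"
    by (intro tendsto_intros filterlim_ident)
  then have "\<forall>\<^sub>F t in nhds 0. x + t *\<^sub>R axis i 1 \<in> - ?S"
    by (rule topological_tendstoD) (use x in \<open>simp_all add: open_Compl\<close>)
  then have "\<forall>\<^sub>F t in nhds 0. \<phi> (x + t *\<^sub>R axis i 1) = 0"
    by eventually_elim (rule S, simp)
  then have "deriv (\<lambda>t. \<phi> (x + t *\<^sub>R axis i 1)) 0 = deriv (\<lambda>t. 0) 0" by (intro deriv_cong_ev) auto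
  then show "partial_deriv i \<phi> x = 0" by (simp add: partial_deriv_def)
qed

lemma integrable_mult_continuous_compact_support:
  fixes w \<psi> :: "real ^ 'n \<Rightarrow> real"
  assumes w: "integrable lborel (\<lambda>x. indicator U x * w x)" and \<psi>: "continuous_on UNIV \<psi>"
    and K: "compact K" "K \<subseteq> U" "\<And>x. x \<notin> K \<Longrightarrow> \<psi> x = 0"
  shows "integrable lborel (\<lambda>x. w x * \<psi> x)"
proof -
  have "bounded (\<psi> ` K)" using K(1) \<psi> by (intro compact_imp_bounded compact_continuous_image) (auto intro: continuous_on_subset)
  then obtain B where "\<forall>x\<in>K. norm (\<psi> x) \<le> B" by (auto simp: bounded_iff)
  then have B: "\<bar>\<psi> x\<bar> \<le> max B 0" for x using K(3)[of x] by (cases "x \<in> K") force+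
  have [measurable]: "\<psi> \<in> borel_measurable borel" using \<psi> by (rule borel_measurable_continuous_onI)
  have "integrable lborel (\<lambda>x. (indicator U x * w x) * \<psi> x)"
  proof (rule Bochner_Integration.integrable_bound)
    show "integrable lborel (\<lambda>x. max B 0 * (indicator U x * w x))" using w by simp
    show "(\<lambda>x. (indicator U x * w x) * \<psi> x) \<in> borel_measurable lborel"
      using borel_measurable_integrable[OF w] by measurable
    show "AE x in lborel. norm ((indicator U x * w x) * \<psi> x) \<le> norm (max B 0 * (indicator U x * w x))"
    proof (intro AE_I2)
      fix x
      have "\<bar>indicator U x * w x\<bar> * \<bar>\<psi> x\<bar> \<le> \<bar>indicator U x * w x\<bar> * max B 0" by (intro mult_left_mono B) auto
      then show "norm ((indicator U x * w x) * \<psi> x) \<le> norm (max B 0 * (indicator U x * w x))"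
        by (simp add: abs_mult mult_ac)
    qed
  qed
  also have "(\<lambda>x. (indicator U x * w x) * \<psi> x) = (\<lambda>x. w x * \<psi> x)"
    using K(2,3) by (fastforce simp: indicator_def)
  finally show ?thesis .
qed

lemma test_fun_integrable:
  fixes w \<phi> :: "real ^ 'n \<Rightarrow> real"
  assumes w: "integrable lborel (\<lambda>x. indicator U x * w x)" and \<phi>: "test_fun U \<phi>"
  shows "integrable lborel (\<lambda>x. w x * \<phi> x)" "integrable lborel (\<lambda>x. w x * partial_deriv i \<phi> x)"
proof -
  let ?K = "closure {x. \<phi> x \<noteq> 0}"
  have K: "compact ?K" "?K \<subseteq> U" and s: "smooth_fun \<phi>" using \<phi> by (auto simp: test_fun_def)
  \<comment> \<open>With the support in place of \<open>U\<close>, the vanishing statements hold off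
    the compact set \<open>?K\<close> and not merely off \<open>U\<close>.\<close>
  have self: "test_fun ?K \<phi>" using \<phi> by (auto simp: test_fun_def)
  show "integrable lborel (\<lambda>x. w x * \<phi> x)"
    by (rule integrable_mult_continuous_compact_support[OF w smooth_fun_continuous(1)[OF s] K test_fun_eq_0_outside(1)[OF self]])
  show "integrable lborel (\<lambda>x. w x * partial_deriv i \<phi> x)"
    by (rule integrable_mult_continuous_compact_support[OF w smooth_fun_continuous(2)[OF s] K test_fun_eq_0_outside(2)[OF self]])
qed

context analytic_line_family
begin

text \<open>No boundary term survives: on almost every segment the fundamental theorem leaves the
  difference of \<open>u\<close> at the two end points, and over all base points this integrates to
  0 by translation invariance of the integrable \<open>u\<close>.\<close>

lemma integration_by_parts_line:
  assumes e: "0 < e" "e \<le> \<epsilon>1 / 2" "\<epsilon>1 < \<epsilon>"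
    and nz: "AE x in lborel. norm x < \<epsilon>1 \<longrightarrow> (\<forall>t. \<bar>t\<bar> < \<rho> \<longrightarrow> f (x + t *\<^sub>R v) \<noteq> 0)"
    and L: "integrable lborel (\<lambda>x. indicator (ball 0 e) x * ln \<bar>f x\<bar>)"
    and G: "integrable lborel (\<lambda>x. indicator (ball 0 e) x * (dirderiv v f x / f x))"
    and \<phi>: "test_fun (ball 0 e) \<phi>"
  shows "(\<Sum>i\<in>UNIV. v $ i * (LINT x|lborel. ln \<bar>f x\<bar> * partial_deriv i \<phi> x)) =
     - (LINT x|lborel. dirderiv v f x / f x * \<phi> x)"
proof -
  define d\<phi> where "d\<phi> = (\<lambda>x. \<Sum>i\<in>UNIV. v $ i * partial_deriv i \<phi> x)"
  define \<Psi> where "\<Psi> = (\<lambda>x. ln \<bar>f x\<bar> * d\<phi> x + dirderiv v f x / f x * \<phi> x)"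
  define u where "u = (\<lambda>x. ln \<bar>f x\<bar> * \<phi> x)"
  have s: "smooth_fun \<phi>" using \<phi> by (simp add: test_fun_def)
  have i1: "integrable lborel (\<lambda>x. ln \<bar>f x\<bar> * d\<phi> x)"
  proof -
    have "integrable lborel (\<lambda>x. \<Sum>i\<in>UNIV. v $ i * (ln \<bar>f x\<bar> * partial_deriv i \<phi> x))"
      by (intro Bochner_Integration.integrable_sum integrable_mult_right test_fun_integrable(2)[OF L \<phi>])
    then show ?thesis by (simp add: d\<phi>_def sum_distrib_left mult_ac)
  qed
  have i2: "integrable lborel (\<lambda>x. dirderiv v f x / f x * \<phi> x)" by (rule test_fun_integrable(1)[OF G \<phi>])
  have i\<Psi>: "integrable lborel \<Psi>" unfolding \<Psi>_def by (intro Bochner_Integration.integrable_add i1 i2)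
  have iu: "integrable lborel u" unfolding u_def by (rule test_fun_integrable(1)[OF L \<phi>])
  obtain a where a: "a > 0" "a \<le> \<rho> / 2" and av: "a * norm v \<le> \<epsilon>1 / 2"
    using exists_small_step[of "\<rho> / 2" "\<epsilon>1 / 2" v] \<rho> e by auto
  have inner: "(LINT t|lborel. \<Psi> (x + t *\<^sub>R v) * indicator {-a..a} t) = u (x + a *\<^sub>R v) - u (x + (-a) *\<^sub>R v)"
    if x: "norm x < \<epsilon>1 \<longrightarrow> (\<forall>t. \<bar>t\<bar> < \<rho> \<longrightarrow> f (x + t *\<^sub>R v) \<noteq> 0)" for x
  proof (cases "norm x < \<epsilon>1")
    case True
    then have fn: "f (x + t *\<^sub>R v) \<noteq> 0" if "\<bar>t\<bar> < \<rho>" for t using x that by blast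
    have x\<epsilon>: "norm x < \<epsilon>" using True e by simp
    have in\<Omega>: "x + t *\<^sub>R v \<in> \<Omega>" if "\<bar>t\<bar> < \<rho>" for t
      using in_ball_real[OF x\<epsilon>, of t] that \<rho> sub by auto
    show ?thesis
    proof (rule integral_FTC_Icc_real)
      fix t assume "-a \<le> t" "t \<le> a"
      then have t: "\<bar>t\<bar> < \<rho>" using a \<rho> by auto
      have df: "((\<lambda>t. f (x + t *\<^sub>R v)) has_real_derivative dirderiv v f (x + t *\<^sub>R v)) (at t)"
        by (rule has_real_derivative_shift_line, rule real_analytic_on_has_dirderiv[OF ana in\<Omega>[OF t]])
      have lnabs: "((\<lambda>y. ln \<bar>y\<bar>) has_real_derivative 1 / y) (at y)" if "y \<noteq> 0" for y :: real
      proof (cases "y > 0")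
        case True
        have "(ln has_real_derivative 1 / y) (at y)" using True by (auto intro!: derivative_eq_intros)
        then show ?thesis
          by (rule has_field_derivative_transform_within_open[where S = "{0<..}"]) (use True in auto)
      next
        case False
        then have y: "y < 0" using that by simp
        have "((\<lambda>y. ln (- y)) has_real_derivative 1 / y) (at y)" using y by (auto intro!: derivative_eq_intros)
        then show ?thesis
          by (rule has_field_derivative_transform_within_open[where S = "{..<0}"]) (use y in auto)
      qed
      have d1: "((\<lambda>t. ln \<bar>f (x + t *\<^sub>R v)\<bar>) has_real_derivative 1 / f (x + t *\<^sub>R v) * dirderiv v f (x + t *\<^sub>R v)) (at t)"
        by (rule DERIV_chain2[OF lnabs[OF fn[OF t]] df])
      have d2: "((\<lambda>t. \<phi> (x + t *\<^sub>R v)) has_real_derivative d\<phi> (x + t *\<^sub>R v)) (at t)"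
      proof -
        have "((\<lambda>t. \<phi> (x + t *\<^sub>R v)) has_derivative (\<lambda>h. \<Sum>i\<in>UNIV. (h *\<^sub>R v) $ i * partial_deriv i \<phi> (x + t *\<^sub>R v))) (at t)"
          by (rule has_derivative_compose[where f = "\<lambda>t. x + t *\<^sub>R v" and g = \<phi>, OF _ smooth_fun_has_derivative[OF s]])
             (auto intro!: derivative_eq_intros)
        then show ?thesis unfolding has_field_derivative_def
          by (rule has_derivative_eq_rhs) (simp add: d\<phi>_def fun_eq_iff sum_distrib_left sum_distrib_right mult_ac)
      qed
      show "((\<lambda>t. u (x + t *\<^sub>R v)) has_real_derivative \<Psi> (x + t *\<^sub>R v)) (at t)"
        unfolding u_def \<Psi>_def using DERIV_mult[OF d1 d2] by (simp add: algebra_simps)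
      have cf: "isCont (\<lambda>t. f (x + t *\<^sub>R v)) t" using df by (rule DERIV_isCont)
      have cdf: "isCont (\<lambda>t. dirderiv v f (x + t *\<^sub>R v)) t"
        using real_analytic_on_isCont[OF real_analytic_on_dirderiv[OF ana] in\<Omega>[OF t]]
        by (rule isCont_o2[where g = "dirderiv v f", rotated]) (intro continuous_intros)
      have c\<phi>: "isCont (\<lambda>t. \<phi> (x + t *\<^sub>R v)) t" using d2 by (rule DERIV_isCont)
      have "isCont d\<phi> (x + t *\<^sub>R v)"
        unfolding d\<phi>_def using smooth_fun_continuous(2)[OF s]
        by (intro continuous_intros) (auto simp: continuous_on_eq_continuous_at)
      then have cd\<phi>: "isCont (\<lambda>t. d\<phi> (x + t *\<^sub>R v)) t"
        by (rule isCont_o2[where g = d\<phi>, rotated]) (intro continuous_intros)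
      show "isCont (\<lambda>t. \<Psi> (x + t *\<^sub>R v)) t"
        unfolding \<Psi>_def using fn[OF t] DERIV_isCont[OF d1]
        by (intro continuous_add continuous_mult continuous_divide cf cdf c\<phi> cd\<phi>) auto
    qed (use a in auto)
  next
    \<comment> \<open>For distant base points \<open>f\<close> may have zeros on the segment; both
      sides vanish because the segment avoids the support of \<open>\<phi>\<close>.\<close>
    case False
    have out: "x + t *\<^sub>R v \<notin> ball 0 e" if "\<bar>t\<bar> \<le> a" for t
    proof -
      have "norm (t *\<^sub>R v) \<le> a * norm v" using that by (auto intro!: mult_right_mono)
      then have "norm (x + t *\<^sub>R v) \<ge> \<epsilon>1 / 2" using False av norm_diff_ineq[of x "t *\<^sub>R v"] by linarith
      then show ?thesis using e by auto
    qed
    have "\<Psi> (x + t *\<^sub>R v) * indicator {-a..a} t = 0" for t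
      using test_fun_eq_0_outside[OF \<phi> out[of t]] by (auto simp: indicator_def \<Psi>_def d\<phi>_def)
    moreover have "u (x + a *\<^sub>R v) = 0" "u (x + (-a) *\<^sub>R v) = 0"
      using test_fun_eq_0_outside(1)[OF \<phi> out[of a]] test_fun_eq_0_outside(1)[OF \<phi> out[of "-a"]] a by (auto simp: u_def)
    ultimately show ?thesis by (simp only: integral_zero)
  qed
  have [measurable]: "\<Psi> \<in> borel_measurable borel" "u \<in> borel_measurable borel" using i\<Psi> iu by auto
  have "2 * a * (LINT x|lborel. \<Psi> x) = (LINT x|lborel. (LINT t|lborel. \<Psi> (x + t *\<^sub>R v) * indicator {-a..a} t))"
    by (rule integral_line_average[OF i\<Psi> a(1)])
  also have "\<dots> = (LINT x|lborel. u (x + a *\<^sub>R v) - u (x + (-a) *\<^sub>R v))"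
  proof (rule integral_cong_AE)
    show "AE x in lborel. (LINT t|lborel. \<Psi> (x + t *\<^sub>R v) * indicator {-a..a} t) = u (x + a *\<^sub>R v) - u (x + (-a) *\<^sub>R v)"
      using nz by eventually_elim (rule inner)
  qed measurable
  also have "\<dots> = 0"
    using integral_translate[OF iu, of "a *\<^sub>R v"] integral_translate[OF iu, of "(-a) *\<^sub>R v"]
    by (subst Bochner_Integration.integral_diff) auto
  finally have "(LINT x|lborel. \<Psi> x) = 0" using a by simp
  moreover have "(LINT x|lborel. \<Psi> x) = (LINT x|lborel. ln \<bar>f x\<bar> * d\<phi> x) + (LINT x|lborel. dirderiv v f x / f x * \<phi> x)"
    unfolding \<Psi>_def by (rule Bochner_Integration.integral_add[OF i1 i2])
  moreover have "(LINT x|lborel. ln \<bar>f x\<bar> * d\<phi> x) = (\<Sum>i\<in>UNIV. v $ i * (LINT x|lborel. ln \<bar>f x\<bar> * partial_deriv i \<phi> x))"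
  proof -
    have "(LINT x|lborel. ln \<bar>f x\<bar> * d\<phi> x) = (LINT x|lborel. (\<Sum>i\<in>UNIV. v $ i * (ln \<bar>f x\<bar> * partial_deriv i \<phi> x)))"
      by (simp add: d\<phi>_def sum_distrib_left mult_ac)
    also have "\<dots> = (\<Sum>i\<in>UNIV. (LINT x|lborel. v $ i * (ln \<bar>f x\<bar> * partial_deriv i \<phi> x)))"
      by (intro Bochner_Integration.integral_sum integrable_mult_right test_fun_integrable(2)[OF L \<phi>])
    finally show ?thesis by simp
  qed
  ultimately show ?thesis by simp
qed

end

text \<open>The admissible radius depends on \<open>v\<close>; quantifying over all smaller balls
  lets finitely many directions share one. Integrability of the logarithm is a premise because it is
  established once, for all directions.\<close>

lemma log_weak_derivative_along:
  fixes f :: "real ^ 'n \<Rightarrow> real" and c :: "('n \<Rightarrow> nat) \<Rightarrow> real"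
  assumes r: "r > 0" and conv: "converges_on_ball c r"
    and f_series: "\<And>x. norm x < r \<Longrightarrow> f x = Re (pseries c (cvec x))"
    and sub: "ball 0 r \<subseteq> \<Omega>" and ana: "real_analytic_on f \<Omega>"
    and no_hypersurface: "\<And>q. norm q < r \<Longrightarrow> \<not> smooth_point {x\<in>\<Omega>. f x = 0} q (CARD('n) - 1)"
    and v: "norm v < r" "f v \<noteq> 0"
  shows "\<exists>e0>0. e0 < r \<and> (\<forall>e. 0 < e \<and> e \<le> e0 \<and> integrable lborel (\<lambda>x. indicator (ball 0 e) x * ln \<bar>f x\<bar>) \<longrightarrow>
     integrable lborel (\<lambda>x. indicator (ball 0 e) x * (dirderiv v f x / f x)) \<and>
     (\<forall>\<phi>. test_fun (ball 0 e) \<phi> \<longrightarrow>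
       (\<Sum>i\<in>UNIV. v $ i * (LINT x|lborel. ln \<bar>f x\<bar> * partial_deriv i \<phi> x)) =
         - (LINT x|lborel. dirderiv v f x / f x * \<phi> x)))"
proof -
  have one: "1 *s cvec v = cvec v" by (simp add: vec_eq_iff)
  have hol: "(\<lambda>s. pseries c (s *s cvec v)) holomorphic_on {s. norm (s *s cvec v) < r}"
  proof -
    have o: "open {s. norm (s *s cvec v) < r}" by (intro open_Collect_less continuous_intros)
    show ?thesis unfolding holomorphic_on_open[OF o]
      using pseries_has_field_derivative[OF conv, of 0 _ v] by auto
  qed
  have fv: "pseries c (1 *s cvec v) \<noteq> 0" using f_series[OF v(1)] v(2) by (auto simp: one)
  obtain \<rho> m M \<epsilon> where *: "0 < \<rho>" "\<rho> < 1/2" "0 < m" "0 < \<epsilon>" "\<epsilon> + 5 * \<rho> * norm v < r"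
     "\<And>z t. norm z < \<epsilon> \<and> norm t \<le> 4 * \<rho> \<Longrightarrow> norm (pseries c (z + t *s cvec v)) \<le> M"
     "\<And>z t. norm z < \<epsilon> \<and> norm t = \<rho> \<Longrightarrow> m \<le> norm (pseries c (z + t *s cvec v))"
    using uniform_line_bounds[OF r continuous_on_pseries[OF conv] hol _ fv, of "1/2"] v by (auto simp: one)
  interpret analytic_line_family c r \<rho> m M \<epsilon> v f \<Omega>
    by unfold_locales (use * conv f_series sub ana no_hypersurface in auto)
  obtain \<epsilon>1 where \<epsilon>1: "\<epsilon>1 > 0" "\<epsilon>1 < \<epsilon>"
    and nz: "AE x in lborel. norm x < \<epsilon>1 \<longrightarrow> (\<forall>t. \<bar>t\<bar> < \<rho> \<longrightarrow> f (x + t *\<^sub>R v) \<noteq> 0)"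
    and fin: "(\<integral>\<^sup>+x. ennreal \<bar>dirderiv v f x / f x\<bar> * indicator (ball 0 (\<epsilon>1 / 2)) x \<partial>lborel) < \<infinity>"
    using log_gradient_integrable by blast
  have main: "integrable lborel (\<lambda>x. indicator (ball 0 e) x * (dirderiv v f x / f x))" if e: "0 < e" "e \<le> \<epsilon>1 / 2" for e
  proof (rule integrableI_bounded)
    show "(\<lambda>x. indicator (ball 0 e) x * (dirderiv v f x / f x)) \<in> borel_measurable lborel"
      using log_derivative_measurable[of e] e \<epsilon>1 by simp
    have "(\<integral>\<^sup>+x. ennreal (norm (indicator (ball 0 e) x * (dirderiv v f x / f x))) \<partial>lborel) \<le>
       (\<integral>\<^sup>+x. ennreal \<bar>dirderiv v f x / f x\<bar> * indicator (ball 0 (\<epsilon>1 / 2)) x \<partial>lborel)"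
      using e by (intro nn_integral_mono) (auto simp: indicator_def)
    then show "(\<integral>\<^sup>+x. ennreal (norm (indicator (ball 0 e) x * (dirderiv v f x / f x))) \<partial>lborel) < \<infinity>"
      using fin by (rule order_le_less_trans)
  qed
  show ?thesis
  proof (intro exI[of _ "\<epsilon>1 / 2"] conjI allI impI)
    fix e assume e: "0 < e \<and> e \<le> \<epsilon>1 / 2 \<and> integrable lborel (\<lambda>x. indicator (ball 0 e) x * ln \<bar>f x\<bar>)"
    then show "integrable lborel (\<lambda>x. indicator (ball 0 e) x * (dirderiv v f x / f x))" by (intro main) auto
    fix \<phi> :: "real ^ 'n \<Rightarrow> real" assume "test_fun (ball 0 e) \<phi>"
    then show "(\<Sum>i\<in>UNIV. v $ i * (LINT x|lborel. ln \<bar>f x\<bar> * partial_deriv i \<phi> x)) = - (LINT x|lborel. dirderiv v f x / f x * \<phi> x)"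
      using e \<epsilon>1(2) nz main[of e] by (intro integration_by_parts_line[of e \<epsilon>1]) auto
  qed (use \<epsilon>1 \<epsilon>_less_r in auto)
qed

section \<open>The theorem\<close>


text \<open>\<open>d\<close> exceeds the supremum that defines the dimension, so \<open>p\<close>
  lies outside the closure of the smooth points of dimension \<open>d\<close>, and a whole ball
  around \<open>p\<close> is free of them.\<close>

lemma analytic_codim_ge_2D:
  fixes X :: "(real ^ 'n) set"
  assumes n2: "CARD('n) \<ge> 2" and codim: "analytic_codim_at X p \<ge> 2" and d: "d \<ge> CARD('n) - 1"
  shows "\<exists>r>0. \<forall>q. dist q p < r \<longrightarrow> \<not> smooth_point X q d"
proof -
  define S where "S = {d. p \<in> closure {q. smooth_point X q d}}"
  have "d \<le> CARD('n)" if "d \<in> S" for d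
  proof -
    have "{q. smooth_point X q d} \<noteq> {}" using that unfolding S_def by (metis closure_empty empty_iff mem_Collect_eq)
    then show ?thesis by (auto simp: smooth_point_def analytic_submanifold_def)
  qed
  \<comment> \<open>Needed because \<open>Sup\<close> of a set of natural numbers is an upper bound
    only when the set is bounded.\<close>
  then have bdd: "bdd_above S" by (auto simp: bdd_above_def)
  have "d \<notin> S"
  proof
    assume "d \<in> S"
    then have "d \<le> Sup S" using bdd by (rule cSup_upper)
    then show False using codim d n2 by (simp add: analytic_codim_at_def analytic_dim_at_def S_def)
  qed
  then show ?thesis by (auto simp: S_def closure_approachable)
qed

theorem theorem1p1:
  fixes f :: "real^'n \<Rightarrow> real" and \<Omega> :: "(real^'n) set"
  assumes n2: "CARD('n) \<ge> 2"
    and "open \<Omega>" and "0 \<in> \<Omega>"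
    and ana: "real_analytic_on f \<Omega>"
    and codim: "analytic_codim_at {x\<in>\<Omega>. f x = 0} 0 \<ge> 2"
  shows "\<exists>U. open U \<and> 0 \<in> U \<and> U \<subseteq> \<Omega> \<and>
           L1_on U (\<lambda>x. ln \<bar>f x\<bar>) \<and>
           (\<exists>G :: real^'n \<Rightarrow> real^'n.
              (\<forall>i. L1_on U (\<lambda>x. G x $ i)) \<and>
              weak_gradient_on U (\<lambda>x. ln \<bar>f x\<bar>) G \<and>
              (AE x in lebesgue. x \<in> U \<longrightarrow>
                 f x \<noteq> 0 \<and> (f has_derivative (\<lambda>h. (f x *\<^sub>R G x) \<bullet> h)) (at x)))"
proof -
  let ?X = "{x\<in>\<Omega>. f x = 0}"
  obtain r0 c where r0: "r0 > 0" and conv0: "converges_on_ball c r0"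
    and ser0: "\<forall>x\<in>ball 0 r0. f x = Re (pseries c (cvec (x - 0)))"
    using ana \<open>0 \<in> \<Omega>\<close> unfolding real_analytic_on_iff_pseries by blast
  obtain r1 where r1: "r1 > 0" "ball 0 r1 \<subseteq> \<Omega>" using \<open>open \<Omega>\<close> \<open>0 \<in> \<Omega>\<close> openE by blast
  obtain r2 where r2: "r2 > 0" "\<And>q. dist q 0 < r2 \<Longrightarrow> \<not> smooth_point ?X q (CARD('n) - 1)"
    using analytic_codim_ge_2D[OF n2 codim, of "CARD('n) - 1"] by auto
  \<comment> \<open>Full dimension is excluded as well; this is what keeps \<open>f\<close> from
    vanishing identically near 0.\<close>
  obtain r3 where r3: "r3 > 0" "\<And>q. dist q 0 < r3 \<Longrightarrow> \<not> smooth_point ?X q (CARD('n))"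
    using analytic_codim_ge_2D[OF n2 codim, of "CARD('n)"] by auto
  define r where "r = min (min r0 r1) (min r2 r3)"
  have r: "r > 0" "r \<le> r0" "r \<le> r1" "r \<le> r2" "r \<le> r3" using r0 r1 r2 r3 by (auto simp: r_def)
  have conv: "converges_on_ball c r" using conv0 r(2) by (auto simp: converges_on_ball_def)
  have ser: "f x = Re (pseries c (cvec x))" if "norm x < r" for x using ser0 that r(2) by simp
  have sub: "ball 0 r \<subseteq> \<Omega>" using r1(2) r(3) by auto
  have nohyp: "\<not> smooth_point ?X q (CARD('n) - 1)" if "norm q < r" for q using r2(2)[of q] that r(4) by simp
  have "\<exists>x. norm x < r \<and> f x \<noteq> 0"
  proof (rule ccontr)
    assume "\<not> ?thesis"
    then have 0: "f x = 0" if "norm x < r" for x using that by blast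
    have "ball 0 r \<inter> ?X = ball 0 r" using 0 sub by auto
    \<comment> \<open>In dimension n there are no equations: every condition ranges over
      \<open>j < 0\<close>.\<close>
    then have "analytic_submanifold (ball 0 r \<inter> ?X) (ball 0 r) (CARD('n))"
      unfolding analytic_submanifold_def by (auto intro!: exI[of _ "ball 0 r"])
    then have "smooth_point ?X 0 (CARD('n))"
      unfolding smooth_point_def using 0 r(1) \<open>0 \<in> \<Omega>\<close> by (auto intro!: exI[of _ "ball 0 r"])
    then show False using r3(2)[of 0] r3(1) by simp
  qed
  then obtain x0 where x0: "norm x0 < r" "f x0 \<noteq> 0" by blast
  have "isCont f x0" using x0 sub by (intro real_analytic_on_isCont[OF ana]) auto
  then have "\<forall>\<^sub>F x in nhds x0. f x \<noteq> 0"
    using x0(2) by (simp add: isCont_def tendsto_at_iff_tendsto_nhds tendsto_imp_eventually_ne)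
  moreover have "\<forall>\<^sub>F x in nhds x0. x \<in> ball 0 r" using x0 by (intro eventually_nhds_in_open) auto
  ultimately have "\<forall>\<^sub>F x in nhds x0. norm x < r \<and> f x \<noteq> 0" by eventually_elim simp
  then obtain \<eta>0 where \<eta>0: "\<eta>0 > 0" "\<And>x. dist x x0 < \<eta>0 \<Longrightarrow> norm x < r \<and> f x \<noteq> 0"
    unfolding eventually_nhds_metric by blast
  define \<eta> where "\<eta> = \<eta>0 / 2"
  have \<eta>: "\<eta> > 0" using \<eta>0 by (simp add: \<eta>_def)
  \<comment> \<open>Admissible because \<open>f\<close> is nonzero near \<open>x0\<close>;
    \<open>w i\<close> and \<open>x0\<close> differ by \<open>\<eta>\<close> times the i-th unit
    vector.\<close>
  define w where "w = (\<lambda>i. x0 + \<eta> *\<^sub>R axis i 1 :: real ^ 'n)"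
  have w: "norm (w i) < r" "f (w i) \<noteq> 0" for i
    using \<eta>0(2)[of "w i"] \<eta>0(1) by (auto simp: w_def \<eta>_def dist_norm)
  define good where "good = (\<lambda>v e0. e0 > 0 \<and> e0 < r \<and> (\<forall>e. 0 < e \<and> e \<le> e0 \<and> integrable lborel (\<lambda>x. indicator (ball 0 e) x * ln \<bar>f x\<bar>) \<longrightarrow>
     integrable lborel (\<lambda>x. indicator (ball 0 e) x * (dirderiv v f x / f x)) \<and>
     (\<forall>\<phi>. test_fun (ball 0 e) \<phi> \<longrightarrow>
       (\<Sum>i\<in>UNIV. v $ i * (LINT x|lborel. ln \<bar>f x\<bar> * partial_deriv i \<phi> x)) =
         - (LINT x|lborel. dirderiv v f x / f x * \<phi> x))))"
  have ex: "\<exists>e0. good v e0" if "norm v < r" "f v \<noteq> 0" for v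
    unfolding good_def using log_weak_derivative_along[OF r(1) conv ser sub ana nohyp that] by blast
  obtain ex0 where ex0: "good x0 ex0" using ex[OF x0] by blast
  obtain ew where ew: "\<And>i. good (w i) (ew i)" using ex[OF w] by metis
  have one: "1 *s cvec x0 = cvec x0" by (simp add: vec_eq_iff)
  have hol: "(\<lambda>s. pseries c (z + s *s cvec x0)) holomorphic_on {s. norm (z + s *s cvec x0) < r}" for z
  proof -
    have o: "open {s. norm (z + s *s cvec x0) < r}" by (intro open_Collect_less continuous_intros)
    show ?thesis unfolding holomorphic_on_open[OF o] using pseries_has_field_derivative[OF conv] by blast
  qed
  have fx0: "norm (1 *s cvec x0) < r" "pseries c (1 *s cvec x0) \<noteq> 0" using x0 ser[OF x0(1)] by (auto simp: one)
  obtain \<epsilon>L where \<epsilon>L: "\<epsilon>L > 0" "\<epsilon>L < r"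
    and finL: "(\<integral>\<^sup>+x. abs_ln (norm (pseries c (cvec x))) * indicator (ball 0 \<epsilon>L) x \<partial>lborel) < \<infinity>"
    using nn_integral_abs_ln_finite[OF r(1) continuous_on_pseries[OF conv] hol fx0] by blast
  \<comment> \<open>One ball for the logarithm, for the direction \<open>x0\<close> and for the n
    directions \<open>w i\<close>.\<close>
  define e where "e = Min (insert \<epsilon>L (insert ex0 (range ew)))"
  have "ex0 > 0" "\<And>i. ew i > 0" using ex0 ew by (simp_all add: good_def)
  then have "e > 0" using \<epsilon>L(1) by (auto simp: e_def)
  moreover have "e \<le> y" if "y \<in> insert \<epsilon>L (insert ex0 (range ew))" for y
    unfolding e_def using that by (intro Min_le) auto
  ultimately have e: "e > 0" "e \<le> \<epsilon>L" "e \<le> ex0" "\<And>i. e \<le> ew i" by auto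
  define U where "U = ball (0 :: real ^ 'n) e"
  have Um [measurable]: "U \<in> sets borel" by (simp add: U_def)
  have er: "e < r" using e \<epsilon>L by simp
  have U\<Omega>: "U \<subseteq> \<Omega>" using sub er by (auto simp: U_def)
  have cont: "continuous_on (ball 0 r) f"
    using real_analytic_on_isCont[OF ana] sub by (intro continuous_at_imp_continuous_on) auto
  have nf: "norm (pseries c (cvec x)) = \<bar>f x\<bar>" if "norm x < r" for x
    using pseries_cvec[OF conv that] ser[OF that] by (metis norm_of_real)
  have [measurable]: "(\<lambda>x. indicator U x *\<^sub>R f x) \<in> borel_measurable borel"
    unfolding U_def by (rule borel_measurable_continuous_on_ball_indicator[OF cont]) (use er in simp)
  have finU: "(\<integral>\<^sup>+x. abs_ln \<bar>f x\<bar> * indicator U x \<partial>lborel) < \<infinity>"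
  proof -
    have "(\<integral>\<^sup>+x. abs_ln \<bar>f x\<bar> * indicator U x \<partial>lborel) \<le> (\<integral>\<^sup>+x. abs_ln (norm (pseries c (cvec x))) * indicator (ball 0 \<epsilon>L) x \<partial>lborel)"
      using e er by (intro nn_integral_mono) (auto simp: indicator_def U_def nf)
    then show ?thesis using finL by (rule order_le_less_trans)
  qed
  have meas: "(\<lambda>x. abs_ln \<bar>f x\<bar> * indicator U x) \<in> borel_measurable borel"
  proof -
    have "(\<lambda>x. abs_ln \<bar>f x\<bar> * indicator U x) = (\<lambda>x. abs_ln \<bar>indicator U x *\<^sub>R f x\<bar> * indicator U x)"
      by (auto simp: indicator_def fun_eq_iff)
    also have "\<dots> \<in> borel_measurable borel" by measurable
    finally show ?thesis .
  qed
  have "AE x in lborel. abs_ln \<bar>f x\<bar> * indicator U x \<noteq> \<infinity>"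
    using finU meas by (intro nn_integral_PInf_AE) auto
  then have nz: "AE x in lborel. x \<in> U \<longrightarrow> f x \<noteq> 0" by eventually_elim (auto simp: abs_ln_def)
  have L: "integrable lborel (\<lambda>x. indicator U x * ln \<bar>f x\<bar>)"
  proof (rule integrableI_bounded)
    have "(\<lambda>x. indicator U x * ln \<bar>f x\<bar>) = (\<lambda>x. indicator U x * ln \<bar>indicator U x *\<^sub>R f x\<bar>)"
      by (auto simp: indicator_def fun_eq_iff)
    also have "\<dots> \<in> borel_measurable borel" by measurable
    finally show "(\<lambda>x. indicator U x * ln \<bar>f x\<bar>) \<in> borel_measurable lborel" by simp
    have "(\<integral>\<^sup>+x. ennreal (norm (indicator U x * ln \<bar>f x\<bar>)) \<partial>lborel) \<le> (\<integral>\<^sup>+x. abs_ln \<bar>f x\<bar> * indicator U x \<partial>lborel)"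
      by (intro nn_integral_mono) (auto simp: indicator_def abs_ln_def)
    then show "(\<integral>\<^sup>+x. ennreal (norm (indicator U x * ln \<bar>f x\<bar>)) \<partial>lborel) < \<infinity>" using finU by (rule order_le_less_trans)
  qed
  define grad where "grad = (\<lambda>x. (\<chi> i. dirderiv (axis i 1) f x) :: real ^ 'n)"
  have grad: "(f has_derivative (\<lambda>h. grad x \<bullet> h)) (at x)" "dirderiv v f x = grad x \<bullet> v" if "x \<in> U" for x v
    unfolding grad_def using that U\<Omega> by (blast intro: real_analytic_on_has_derivative[OF ana \<open>open \<Omega>\<close>])+
  define G where "G = (\<lambda>x. (1 / f x) *\<^sub>R grad x)"
  \<comment> \<open>Linearity in the direction makes this difference quotient with the fixed step
    \<open>\<eta>\<close> exact.\<close>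
  have GU: "G x $ i = (1/\<eta>) * (dirderiv (w i) f x / f x - dirderiv x0 f x / f x)" if "x \<in> U" for x i
  proof -
    have "dirderiv (w i) f x - dirderiv x0 f x = \<eta> * grad x $ i"
      by (simp add: grad(2)[OF that] w_def inner_add_right inner_axis)
    then show ?thesis using \<eta> by (simp add: G_def flip: diff_divide_distrib)
  qed
  have Gint: "integrable lborel (\<lambda>x. indicator U x * (dirderiv v f x / f x))"
    and byparts: "\<And>\<phi>. test_fun U \<phi> \<Longrightarrow> (\<Sum>i\<in>UNIV. v $ i * (LINT x|lborel. ln \<bar>f x\<bar> * partial_deriv i \<phi> x)) =
         - (LINT x|lborel. dirderiv v f x / f x * \<phi> x)" if "good v e0" "e \<le> e0" for v e0
    using that e(1) L unfolding good_def U_def by blast+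
  have GiL: "integrable lborel (\<lambda>x. indicator U x * G x $ i)" for i
  proof -
    have "integrable lborel (\<lambda>x. (1/\<eta>) * (indicator U x * (dirderiv (w i) f x / f x) - indicator U x * (dirderiv x0 f x / f x)))"
      using Gint[OF ew e(4)] Gint[OF ex0 e(3)] by (intro integrable_mult_right Bochner_Integration.integrable_diff)
    also have "(\<lambda>x. (1/\<eta>) * (indicator U x * (dirderiv (w i) f x / f x) - indicator U x * (dirderiv x0 f x / f x))) = (\<lambda>x. indicator U x * G x $ i)"
      by (auto simp: fun_eq_iff indicator_def GU)
    finally show ?thesis .
  qed
  \<comment> \<open>\<open>lebesgue\<close> is the completion of \<open>lborel\<close>, over which
    all estimates were made.\<close>
  have L1: "L1_on U h" if "integrable lborel (\<lambda>x. indicator U x * h x)" for h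
    using that unfolding L1_on_def set_integrable_def
    by (subst integrable_completion) auto
  have weak: "weak_gradient_on U (\<lambda>x. ln \<bar>f x\<bar>) G"
    unfolding weak_gradient_on_def
  proof (intro allI impI)
    fix \<phi> :: "real ^ 'n \<Rightarrow> real" and i assume \<phi>: "test_fun U \<phi>"
    define I where "I = (\<lambda>i. LINT x|lborel. ln \<bar>f x\<bar> * partial_deriv i \<phi> x)"
    define J where "J = (\<lambda>v. LINT x|lborel. dirderiv v f x / f x * \<phi> x)"
    \<comment> \<open>The same combination of directions on the side of the test function:
      \<open>w i\<close> differs from \<open>x0\<close> in coordinate \<open>i\<close> only.\<close>
    have S: "(\<Sum>j\<in>UNIV. w i $ j * I j) = (\<Sum>j\<in>UNIV. x0 $ j * I j) + \<eta> * I i"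
    proof -
      have "(\<Sum>j\<in>UNIV. w i $ j * I j) = (\<Sum>j\<in>UNIV. x0 $ j * I j + (if j = i then \<eta> * I i else 0))"
        by (intro sum.cong) (auto simp: w_def axis_def algebra_simps)
      then show ?thesis by (simp add: sum.distrib)
    qed
    have "(\<Sum>j\<in>UNIV. w i $ j * I j) = - J (w i)" "(\<Sum>j\<in>UNIV. x0 $ j * I j) = - J x0"
      using byparts[OF ew e(4) \<phi>] byparts[OF ex0 e(3) \<phi>] by (auto simp: I_def J_def)
    then have "\<eta> * I i = - (J (w i) - J x0)" using S by simp
    also have "J (w i) - J x0 = (LINT x|lborel. dirderiv (w i) f x / f x * \<phi> x - dirderiv x0 f x / f x * \<phi> x)"
      unfolding J_def
      by (intro Bochner_Integration.integral_diff[symmetric] test_fun_integrable(1)[OF _ \<phi>] Gint[OF ew e(4)] Gint[OF ex0 e(3)])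
    also have "\<dots> = (LINT x|lborel. \<eta> * (G x $ i * \<phi> x))"
    proof (intro Bochner_Integration.integral_cong refl)
      fix x
      show "dirderiv (w i) f x / f x * \<phi> x - dirderiv x0 f x / f x * \<phi> x = \<eta> * (G x $ i * \<phi> x)"
      proof (cases "x \<in> U")
        case True
        then show ?thesis using \<eta> by (simp add: GU algebra_simps)
      qed (simp add: test_fun_eq_0_outside(1)[OF \<phi>])
    qed
    also have "\<dots> = \<eta> * (LINT x|lborel. G x $ i * \<phi> x)" by simp
    finally have "\<eta> * I i = \<eta> * - (LINT x|lborel. G x $ i * \<phi> x)" by simp
    then have main: "I i = - (LINT x|lborel. G x $ i * \<phi> x)" using \<eta> by (subst (asm) mult_left_cancel) auto
    have leb: "(LINT x:U|lebesgue. h x) = (LINT x|lborel. h x)"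
      if "integrable lborel h" "\<And>x. x \<notin> U \<Longrightarrow> h x = 0" for h :: "real ^ 'n \<Rightarrow> real"
    proof -
      have "(LINT x:U|lebesgue. h x) = (LINT x|lebesgue. h x)" unfolding set_lebesgue_integral_def
        using that(2) by (intro Bochner_Integration.integral_cong refl) (auto simp: indicator_def)
      also have "\<dots> = (LINT x|lborel. h x)" using that(1) by (intro integral_completion) auto
      finally show ?thesis .
    qed
    show "(LINT x:U|lebesgue. ln \<bar>f x\<bar> * partial_deriv i \<phi> x) = - (LINT x:U|lebesgue. G x $ i * \<phi> x)"
      using main test_fun_integrable(2)[OF L \<phi>, of i] test_fun_integrable(1)[OF GiL \<phi>, of i] test_fun_eq_0_outside[OF \<phi>]
      by (subst (1 2) leb) (auto simp: I_def)
  qed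
  have "AE x in lborel. x \<in> U \<longrightarrow> f x \<noteq> 0 \<and> (f has_derivative (\<lambda>h. (f x *\<^sub>R G x) \<bullet> h)) (at x)"
    using nz
  proof eventually_elim
    case (elim x)
    then show ?case using grad(1)[of x] by (auto simp: G_def)
  qed
  then have "AE x in lebesgue. x \<in> U \<longrightarrow> f x \<noteq> 0 \<and> (f has_derivative (\<lambda>h. (f x *\<^sub>R G x) \<bullet> h)) (at x)"
    by (rule AE_completion)
  moreover have "open U" "0 \<in> U" using e(1) by (auto simp: U_def)
  ultimately show ?thesis using U\<Omega> L1[OF L] L1[OF GiL] weak by blast
qed

end
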